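(* Let $(X,d,\mu)$ be a metric measure space and $1<p<\infty$. Assume that $\mu$ is locally doubling and supports a local $p$-Poincaré inequality, and that $X$ is $p$-path open in its completion $\widehat X$. Then every $u\in N^{1,p}_{\rm loc}(X)$ is quasicontinuous on $X$.
   Context: Setting: $X=(X,d,\mu)$ is a metric space with a positive complete Borel measure $\mu$ such that $0<\mu(B)<\infty$ for all balls $B$. Balls are open; a ball $B$ comes with a predetermined centre and radius $r_B$, and $\lambda B$ is the concentric ball with radius $\lambda r_B$. Write $u_B=\frac1{\mu(B)}\int_B u\,d\mu$. Completion: $\widehat X$ is the completion of $X$ with respect to $d$. A set $E\subset\widehat X$ is measurable iff $E\cap X$ is $\mu$-measurable, and $\mu$ is extended by $\mu(E)=\mu(E\cap X)$, so $\mu(\widehat X\setminus X)=0$. Doubling within $B(x_0,r_0)$: there is $C>0$ such that $\mu(2B)\le C\mu(B)$ for all balls $B\subset B(x_0,r_0)$. $p$-Poincaré inequality within $B(x_0,r_0)$: there are constants $C>0$ and $\lambda\ge1$ such that for all balls $B\subset B(x_0,r_0)$, all integrable functions $u$ on $\lambda B$ and all upper gradients $g$ of $u$, $\frac1{\mu(B)}\int_B|u-u_B|\,d\mu\le Cr_B\bigl(\frac1{\mu(\lambda B)}\int_{\lambda B}g^p\,d\mu\bigr)^{1/p}$. Each property is local if for every $x_0\in X$ there is $r_0>0$ (depending on $x_0$) such that it holds within $B(x_0,r_0)$. Upper gradients: curves are nonconstant, compact and rectifiable, parameterized by arc length. A Borel function $g:X\to[0,\infty]$ is an upper gradient of $f:X\to[-\infty,\infty]$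 if $|f(\gamma(0))-f(\gamma(l_\gamma))|\le\int_\gamma g\,ds$ for all curves $\gamma:[0,l_\gamma]\to X$ (left-hand side $=\infty$ if at least one term is infinite). A property holds for $p$-almost every curve in $\widehat X$ if it fails only for a family $\Gamma$ of curves for which there is $0\le\rho\in L^p(\widehat X)$ with $\int_\gamma\rho\,ds=\infty$ for all $\gamma\in\Gamma$. Function spaces: $\|f\|_{N^{1,p}(X)}^p=\int_X|f|^p\,d\mu+\inf_g\int_Xg^p\,d\mu$, infimum over all upper gradients $g$ of $f$; $N^{1,p}(X)$ is the set of measurable everywhere-defined $f:X\to[-\infty,\infty]$ with finite norm; for measurable $E\subset X$, $N^{1,p}(E)$ is defined by regarding $E$ as a metric measure space in its own right. $f\in N^{1,p}_{\rm loc}(X)$ if for every $x\in X$ there is a ball $B_x\ni x$ with $f\in N^{1,p}(B_x)$. Capacity: $C_p^X(E)=\inf\|v\|_{N^{1,p}(X)}^p$ over all $v\in N^{1,p}(X)$ with $v=1$ on $E$. $X$ is $p$-path open in $\widehat X$ if for $p$-almost every curve $\gamma:[0,l_\gamma]\to\widehat X$ the set $\gamma^{-1}(X)$ is relatively open in $[0,l_\gamma]$. A function $u$ is quasicontinuous on $X$ if for every $\varepsilon>0$ there is an open $G\subset X$ such that $C_p^X(G)<\varepsilon$ and $u|_{X\setminus G}$ is real-valued and continuous. *)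

theory Defs
  imports "HOL-Analysis.Analysis"
begin

text \<open>
  The space \<open>X\<close> is the whole type \<open>'a\<close>.  Notions that are also needed for subspaces (balls regarded
  as metric measure spaces) or for the completion take a carrier set \<open>S\<close>; only the values on \<open>S\<close>
  of the functions involved matter.
\<close>

text \<open>A complete Borel measure: its \<open>\<sigma>\<close>-algebra is the completion of the Borel \<open>\<sigma>\<close>-algebra.\<close>

definition complete_borel_measure :: "'a::topological_space measure \<Rightarrow> bool" where
  "complete_borel_measure \<mu> \<longleftrightarrow> (\<exists>\<nu>. sets \<nu> = sets borel \<and> \<mu> = completion \<nu>)"

definition metric_measure_space :: "'a::metric_space measure \<Rightarrow> bool" where
  "metric_measure_space \<mu> \<longleftrightarrow>
     complete_borel_measure \<mu> \<and>
     (\<forall>x r. 0 < r \<longrightarrow> 0 < emeasure \<mu> (ball x r) \<and> emeasure \<mu> (ball x r) < \<infinity>)"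

definition ennpowr :: "ennreal \<Rightarrow> real \<Rightarrow> ennreal" where
  "ennpowr x a = (if x = \<infinity> then \<infinity> else ennreal (enn2real x powr a))"


subsection \<open>Curves and line integrals\<close>

definition curve_length :: "(real \<Rightarrow> 'a::metric_space) \<Rightarrow> real \<Rightarrow> real \<Rightarrow> ennreal" where
  "curve_length \<gamma> a b =
     (SUP (t, n) \<in> {(t :: nat \<Rightarrow> real, n). mono t \<and> range t \<subseteq> {a..b}}.
        \<Sum>i<n. ennreal (dist (\<gamma> (t i)) (\<gamma> (t (Suc i)))))"

text \<open>
  A nonconstant compact rectifiable curve in \<open>S\<close>, parameterized by arc length on \<open>{0..l}\<close>.
  The condition on lengths makes \<open>\<gamma>\<close> 1-Lipschitz, hence continuous, and
  \<open>0 < l\<close> makes it nonconstant.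
\<close>

definition arc_length_curve :: "'a::metric_space set \<Rightarrow> real \<Rightarrow> (real \<Rightarrow> 'a) \<Rightarrow> bool" where
  "arc_length_curve S l \<gamma> \<longleftrightarrow>
     0 < l \<and> \<gamma> ` {0..l} \<subseteq> S \<and>
     (\<forall>s t. 0 \<le> s \<longrightarrow> s \<le> t \<longrightarrow> t \<le> l \<longrightarrow> curve_length \<gamma> s t = ennreal (t - s))"

definition line_integral :: "real \<Rightarrow> (real \<Rightarrow> 'a) \<Rightarrow> ('a \<Rightarrow> ennreal) \<Rightarrow> ennreal" where
  "line_integral l \<gamma> g = (\<integral>\<^sup>+t\<in>{0..l}. g (\<gamma> t) \<partial>lborel)"

definition ereal_gap :: "ereal \<Rightarrow> ereal \<Rightarrow> ennreal" where
  "ereal_gap a b = (if \<bar>a\<bar> = \<infinity> \<or> \<bar>b\<bar> = \<infinity> then \<infinity> else e2ennreal \<bar>a - b\<bar>)"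

definition upper_gradient ::
  "'a::metric_space set \<Rightarrow> ('a \<Rightarrow> ereal) \<Rightarrow> ('a \<Rightarrow> ennreal) \<Rightarrow> bool" where
  "upper_gradient S f g \<longleftrightarrow>
     g \<in> borel_measurable (restrict_space borel S) \<and>
     (\<forall>l \<gamma>. arc_length_curve S l \<gamma> \<longrightarrow> ereal_gap (f (\<gamma> 0)) (f (\<gamma> l)) \<le> line_integral l \<gamma> g)"

text \<open>
  \<open>P l \<gamma>\<close> holds for \<open>p\<close>-almost every curve in \<open>S\<close>.  The function \<open>\<rho>\<close> is taken to be Borel,
  as usual for the modulus of curve families, so that its line integrals are defined.
\<close>

definition p_ae_curve ::
  "real \<Rightarrow> 'a::metric_space measure \<Rightarrow> 'a set \<Rightarrow> (real \<Rightarrow> (real \<Rightarrow> 'a) \<Rightarrow> bool) \<Rightarrow> bool" where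
  "p_ae_curve p M S P \<longleftrightarrow>
     (\<exists>\<rho> :: 'a \<Rightarrow> ennreal.
        \<rho> \<in> borel_measurable (restrict_space borel S) \<and>
        (\<integral>\<^sup>+x\<in>S. ennpowr (\<rho> x) p \<partial>M) < \<infinity> \<and>
        (\<forall>l \<gamma>. arc_length_curve S l \<gamma> \<longrightarrow> \<not> P l \<gamma> \<longrightarrow> line_integral l \<gamma> \<rho> = \<infinity>))"


subsection \<open>Doubling and Poincare inequality\<close>

definition doubling_within :: "'a::metric_space measure \<Rightarrow> 'a \<Rightarrow> real \<Rightarrow> bool" where
  "doubling_within \<mu> x\<^sub>0 r\<^sub>0 \<longleftrightarrow>
     (\<exists>C>0. \<forall>x r. 0 < r \<longrightarrow> ball x r \<subseteq> ball x\<^sub>0 r\<^sub>0 \<longrightarrow>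
        emeasure \<mu> (ball x (2 * r)) \<le> ennreal C * emeasure \<mu> (ball x r))"

definition locally_doubling :: "'a::metric_space measure \<Rightarrow> bool" where
  "locally_doubling \<mu> \<longleftrightarrow> (\<forall>x\<^sub>0. \<exists>r\<^sub>0>0. doubling_within \<mu> x\<^sub>0 r\<^sub>0)"

definition integrable_on_set :: "'a measure \<Rightarrow> 'a set \<Rightarrow> ('a \<Rightarrow> ereal) \<Rightarrow> bool" where
  "integrable_on_set \<mu> E u \<longleftrightarrow>
     u \<in> borel_measurable (restrict_space \<mu> E) \<and> (\<integral>\<^sup>+x\<in>E. e2ennreal \<bar>u x\<bar> \<partial>\<mu>) < \<infinity>"

text \<open>
  The average of an integrable function; an integrable function is finite almost everywhere, so
  the value \<open>0\<close> that \<open>real_of_ereal\<close> assigns to \<open>\<plusminus>\<infinity>\<close> is irrelevant.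
\<close>

definition average :: "'a measure \<Rightarrow> 'a set \<Rightarrow> ('a \<Rightarrow> ereal) \<Rightarrow> real" where
  "average \<mu> E u = (LINT x:E|\<mu>. real_of_ereal (u x)) / measure \<mu> E"

definition poincare_within :: "real \<Rightarrow> 'a::metric_space measure \<Rightarrow> 'a \<Rightarrow> real \<Rightarrow> bool" where
  "poincare_within p \<mu> x\<^sub>0 r\<^sub>0 \<longleftrightarrow>
     (\<exists>C>0. \<exists>\<Lambda>\<ge>1. \<forall>x r. 0 < r \<longrightarrow> ball x r \<subseteq> ball x\<^sub>0 r\<^sub>0 \<longrightarrow>
        (\<forall>u g. integrable_on_set \<mu> (ball x (\<Lambda> * r)) u \<longrightarrow>
               upper_gradient (ball x (\<Lambda> * r)) u g \<longrightarrow>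
           (\<integral>\<^sup>+y\<in>ball x r. e2ennreal \<bar>u y - ereal (average \<mu> (ball x r) u)\<bar> \<partial>\<mu>)
             / emeasure \<mu> (ball x r)
           \<le> ennreal (C * r) *
              ennpowr ((\<integral>\<^sup>+y\<in>ball x (\<Lambda> * r). ennpowr (g y) p \<partial>\<mu>)
                         / emeasure \<mu> (ball x (\<Lambda> * r))) (1 / p)))"

definition local_poincare :: "real \<Rightarrow> 'a::metric_space measure \<Rightarrow> bool" where
  "local_poincare p \<mu> \<longleftrightarrow> (\<forall>x\<^sub>0. \<exists>r\<^sub>0>0. poincare_within p \<mu> x\<^sub>0 r\<^sub>0)"


subsection \<open>Newtonian spaces, capacity, quasicontinuity\<close>

text \<open>The \<open>p\<close>-th power of the Newtonian norm on the subspace \<open>E\<close>.\<close>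

definition N1p_norm_pow ::
  "real \<Rightarrow> 'a::metric_space measure \<Rightarrow> 'a set \<Rightarrow> ('a \<Rightarrow> ereal) \<Rightarrow> ennreal" where
  "N1p_norm_pow p \<mu> E f =
     (\<integral>\<^sup>+x\<in>E. ennpowr (e2ennreal \<bar>f x\<bar>) p \<partial>\<mu>) +
     (INF g \<in> {g. upper_gradient E f g}. \<integral>\<^sup>+x\<in>E. ennpowr (g x) p \<partial>\<mu>)"

definition N1p :: "real \<Rightarrow> 'a::metric_space measure \<Rightarrow> 'a set \<Rightarrow> ('a \<Rightarrow> ereal) set" where
  "N1p p \<mu> E = {f. f \<in> borel_measurable (restrict_space \<mu> E) \<and> N1p_norm_pow p \<mu> E f < \<infinity>}"

definition N1p_loc :: "real \<Rightarrow> 'a::metric_space measure \<Rightarrow> ('a \<Rightarrow> ereal) set" where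
  "N1p_loc p \<mu> = {f. \<forall>x. \<exists>y r. x \<in> ball y r \<and> f \<in> N1p p \<mu> (ball y r)}"

definition capacity :: "real \<Rightarrow> 'a::metric_space measure \<Rightarrow> 'a set \<Rightarrow> ennreal" where
  "capacity p \<mu> E =
     (INF v \<in> {v \<in> N1p p \<mu> UNIV. \<forall>x\<in>E. v x = 1}. N1p_norm_pow p \<mu> UNIV v)"

definition quasicontinuous :: "real \<Rightarrow> 'a::metric_space measure \<Rightarrow> ('a \<Rightarrow> ereal) \<Rightarrow> bool" where
  "quasicontinuous p \<mu> u \<longleftrightarrow>
     (\<forall>\<epsilon>::real. 0 < \<epsilon> \<longrightarrow>
        (\<exists>G. open G \<and> capacity p \<mu> G < ennreal \<epsilon> \<and>
             (\<forall>x. x \<notin> G \<longrightarrow> \<bar>u x\<bar> \<noteq> \<infinity>) \<and>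
             continuous_on (- G) (\<lambda>x. real_of_ereal (u x))))"


subsection \<open>The completion\<close>

text \<open>
  \<open>\<iota>\<close> exhibits the complete space \<open>'b\<close> as the completion of \<open>'a\<close>, which is unique up to isometry.
\<close>

definition is_completion :: "('a::metric_space \<Rightarrow> 'b::complete_space) \<Rightarrow> bool" where
  "is_completion \<iota> \<longleftrightarrow> (\<forall>x y. dist (\<iota> x) (\<iota> y) = dist x y) \<and> closure (range \<iota>) = UNIV"

text \<open>
  The extension of \<open>\<mu>\<close> to the completion.  Its \<open>\<sigma>\<close>-algebra consists of all sets whose trace on \<open>X\<close>
  is \<open>\<mu>\<close>-measurable, so \<open>X\<close> itself is always measurable and of full measure.
\<close>

definition completion_measure :: "('a \<Rightarrow> 'b) \<Rightarrow> 'a measure \<Rightarrow> 'b measure" where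
  "completion_measure \<iota> \<mu> = distr \<mu> (sigma UNIV {E. \<iota> -` E \<in> sets \<mu>}) \<iota>"

lemma sets_completion_measure:
  assumes "space \<mu> = UNIV"
  shows "sets (completion_measure \<iota> \<mu>) = {E. \<iota> -` E \<in> sets \<mu>}"
proof -
  have "sigma_algebra UNIV {E. \<iota> -` E \<in> sets \<mu>}"
    unfolding sigma_algebra_iff2
    using assms sets.top[of \<mu>] by (auto simp: vimage_UN vimage_Compl Compl_eq_Diff_UNIV[symmetric] sets.compl_sets)
      (metis assms sets.compl_sets vimage_Compl Compl_eq_Diff_UNIV)
  then show ?thesis
    unfolding completion_measure_def by (simp add: sigma_algebra.sigma_sets_eq)
qed

lemma emeasure_completion_measure:
  assumes "space \<mu> = UNIV" "\<iota> -` E \<in> sets \<mu>"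
  shows "emeasure (completion_measure \<iota> \<mu>) E = emeasure \<mu> (\<iota> -` E)"
proof -
  have "sets (sigma UNIV {E. \<iota> -` E \<in> sets \<mu>}) = {E. \<iota> -` E \<in> sets \<mu>}"
    using sets_completion_measure[OF assms(1), of \<iota>] by (simp add: completion_measure_def)
  then show ?thesis
    unfolding completion_measure_def using assms
    by (subst emeasure_distr) (auto intro!: measurableI)
qed

definition p_path_open :: "real \<Rightarrow> ('a \<Rightarrow> 'b::metric_space) \<Rightarrow> 'a measure \<Rightarrow> bool" where
  "p_path_open p \<iota> \<mu> \<longleftrightarrow>
     p_ae_curve p (completion_measure \<iota> \<mu>) UNIV
       (\<lambda>l \<gamma>. openin (top_of_set {0..l}) {t \<in> {0..l}. \<gamma> t \<in> range \<iota>})"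

end

theory Submission
  imports Defs "HOL-Library.Diagonal_Subsequence"
begin

text \<open>
  The statement is local.  By doubling, a small closed ball \<open>Z\<close> of the completion is compact.  Choose
  a lower semicontinuous \<open>\<rho> \<ge> 1\<close> in \<open>L\<^sup>p\<close> on the ball that dominates both an upper gradient of \<open>u\<close> and
  the function witnessing path-openness, and say that \<open>y\<close> is reached from \<open>x\<close> at cost \<open>t\<close> if a curve in
  \<open>Z\<close> joins them with \<open>\<integral>\<rho> \<le> t\<close>.  This is a closed relation by Arzela--Ascoli and Fatou, and from a point of \<open>X\<close>
  only points of \<open>X\<close> are reached at small cost, with \<open>u\<close> changing by at most the cost.  If \<open>F\<close> is
  compact and carries most of the measure, the points of the ball from which neither \<open>F\<close> nor the boundary is reached at
  cost \<open>c\<close> form an open set of small capacity.  So off a small open set every point is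
  cheaply joined to a Lusin set of \<open>u\<close>, where \<open>u\<close> agrees with a continuous function \<open>h\<close>.  The difficulty
  is that \<open>h\<close> need not be related to \<open>u\<close> along curves through points outside \<open>X\<close>, and \<open>X\<close> need not be
  Borel in the completion.  The points from which two points with values of \<open>h\<close> at least
  \<open>\<delta>\<close> apart are both reached at cost \<open>t\<close> form a Borel set that contains no given point of \<open>X\<close> once
  \<open>t\<close> is small; applying Lusin's theorem to these sets as well makes them relatively closed and
  bounds the oscillation of \<open>u\<close>.
\<close>

subsection \<open>Curve length and arc-length parametrization\<close>

text \<open>The threshold below which curves from a point stay in X depends on the point and may
  shrink to 0 along a convergent sequence; this shapes the argument. If x_i tends to x, curves of
  one fixed cost c lead from x_i to points y_i of a compact set on which \<open>h\<close> is
  continuous, and a limit point y' is reached from x. But c may exceed the threshold of x_i, so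
  h(y_i) says nothing about u(x_i). A second, much cheaper curve from x_i ends at some z_i with
  h(z_i) close to u(x_i). If h(y_i) and h(z_i) differ by \<delta>, then y_i reaches two such end
  points at cost 2c; relative closedness hands this on to y' and hence, at cost 3c, to x, against
  the threshold of x, below which 3c was chosen. The capacity estimate rests on the function min(1,
  T/c), where T is the cost of reaching \<open>F\<close> or the boundary. It has the upper gradient
  \<rho>/c off \<open>F\<close> inside the ball, so its energy is at most 1 + c^(-p) times the
  integral of \<rho>^p off \<open>F\<close>. Hence \<open>F\<close> can be chosen after c, one set
  for each of countably many costs.\<close>

lemma curve_length_le:
  fixes \<gamma> :: "real \<Rightarrow> 'a::metric_space"
  assumes "1-lipschitz_on {a..b} \<gamma>" "a \<le> b"
  shows "curve_length \<gamma> a b \<le> ennreal (b - a)"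
  unfolding curve_length_def
proof (rule SUP_least, clarify)
  fix t :: "nat \<Rightarrow> real" and n assume t: "mono t" "range t \<subseteq> {a..b}"
  have "dist (\<gamma> (t i)) (\<gamma> (t (Suc i))) \<le> t (Suc i) - t i" for i
    using lipschitz_onD[OF assms(1), of "t i" "t (Suc i)"] t(2) monoD[OF t(1), of i "Suc i"]
    by (auto simp: dist_real_def image_subset_iff)
  then have "(\<Sum>i<n. dist (\<gamma> (t i)) (\<gamma> (t (Suc i)))) \<le> (\<Sum>i<n. t (Suc i) - t i)"
    by (intro sum_mono)
  also have "\<dots> = t n - t 0" by (rule sum_lessThan_telescope)
  also have "\<dots> \<le> b - a" using t(2) by (smt (verit) atLeastAtMost_iff range_subsetD)
  finally show "(\<Sum>i<n. ennreal (dist (\<gamma> (t i)) (\<gamma> (t (Suc i))))) \<le> ennreal (b - a)"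
    by (simp add: sum_ennreal ennreal_leI)
qed

lemma dist_le_curve_length:
  assumes "a \<le> b"
  shows "ennreal (dist (\<gamma> a) (\<gamma> b)) \<le> curve_length \<gamma> a b"
proof -
  let ?t = "\<lambda>i::nat. if i = 0 then a else b"
  have "(\<Sum>i<1. ennreal (dist (\<gamma> (?t i)) (\<gamma> (?t (Suc i))))) \<le> curve_length \<gamma> a b"
    unfolding curve_length_def
    by (rule SUP_upper2[of "(?t, 1)"]) (use assms in \<open>auto simp: mono_def\<close>)
  then show ?thesis by simp
qed

lemma curve_length_mono_image:
  assumes "mono_on {a..b} \<phi>" "\<phi> ` {a..b} \<subseteq> {c..d}" "a \<le> b"
    and eq: "\<And>t. t \<in> {a..b} \<Longrightarrow> \<gamma> t = \<gamma>' (\<phi> t)"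
  shows "curve_length \<gamma> a b \<le> curve_length \<gamma>' c d"
  unfolding curve_length_def
proof (rule SUP_least, clarify)
  fix t :: "nat \<Rightarrow> real" and n assume t: "mono t" "range t \<subseteq> {a..b}"
  have "(\<Sum>i<n. ennreal (dist (\<gamma> (t i)) (\<gamma> (t (Suc i))))) =
      (\<Sum>i<n. ennreal (dist (\<gamma>' ((\<phi> \<circ> t) i)) (\<gamma>' ((\<phi> \<circ> t) (Suc i)))))"
    using t(2) by (intro sum.cong) (auto simp: eq image_subset_iff)
  also have "\<dots> \<le> (SUP (t, n)\<in>{(t, n). mono t \<and> range t \<subseteq> {c..d}}.
           \<Sum>i<n. ennreal (dist (\<gamma>' (t i)) (\<gamma>' (t (Suc i)))))"
    apply (rule SUP_upper2[of "(\<phi> \<circ> t, n)"])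
    using t assms(1,2) by (auto simp: mono_def mono_on_def image_subset_iff range_subsetD)
  finally show "(\<Sum>i<n. ennreal (dist (\<gamma> (t i)) (\<gamma> (t (Suc i))))) \<le> \<dots>" .
qed

lemma ennreal_SUP_add_SUP_le:
  fixes f :: "'i \<Rightarrow> ennreal"
  assumes "I \<noteq> {}" "J \<noteq> {}" "\<And>i j. i \<in> I \<Longrightarrow> j \<in> J \<Longrightarrow> f i + g j \<le> c"
  shows "(SUP i\<in>I. f i) + (SUP j\<in>J. g j) \<le> c"
proof -
  have "f i + (SUP j\<in>J. g j) \<le> c" if "i \<in> I" for i
    using assms(2,3) that by (auto simp: ennreal_SUP_add_right intro!: SUP_least)
  then show ?thesis
    using assms(1) by (auto simp: ennreal_SUP_add_left[symmetric] intro!: SUP_least)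
qed

lemma sum_lessThan_add:
  fixes f :: "nat \<Rightarrow> 'b::comm_monoid_add"
  shows "sum f {..<n + m} = sum f {..<n} + (\<Sum>i<m. f (n + i))"
  by (induction m) (simp_all add: add.assoc)

lemma curve_length_add:
  fixes \<gamma> :: "real \<Rightarrow> 'a::metric_space"
  assumes "a \<le> b" "b \<le> c"
  shows "curve_length \<gamma> a c = curve_length \<gamma> a b + curve_length \<gamma> b c"
proof (rule antisym)
  let ?S = "\<lambda>t n. \<Sum>i<n. ennreal (dist (\<gamma> (t i)) (\<gamma> (t (Suc i))))"
  let ?I = "\<lambda>a b. {(t :: nat \<Rightarrow> real, n::nat). mono t \<and> range t \<subseteq> {a..b}}"
  show "curve_length \<gamma> a c \<le> curve_length \<gamma> a b + curve_length \<gamma> b c"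
  proof (subst (1) curve_length_def, rule SUP_least, clarify)
    fix t :: "nat \<Rightarrow> real" and n assume t: "mono t" "range t \<subseteq> {a..c}"
    \<comment> \<open>The partition is clipped at \<open>b\<close> from above and from below; the
      triangle inequality through the point at \<open>b\<close> matters only for a chord that
      crosses \<open>b\<close>.\<close>
    let ?t1 = "\<lambda>i. min b (t i)" and ?t2 = "\<lambda>i. max b (t i)"
    have "dist (\<gamma> (t i)) (\<gamma> (t (Suc i))) \<le> dist (\<gamma> (?t1 i)) (\<gamma> (?t1 (Suc i))) +
        dist (\<gamma> (?t2 i)) (\<gamma> (?t2 (Suc i)))" for i
      using monoD[OF t(1), of i "Suc i"] dist_triangle[of "\<gamma> (t i)" "\<gamma> (t (Suc i))" "\<gamma> b"]
      by (auto simp: min_def max_def)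
    then have "(\<Sum>i<n. dist (\<gamma> (t i)) (\<gamma> (t (Suc i)))) \<le> (\<Sum>i<n. dist (\<gamma> (?t1 i)) (\<gamma> (?t1 (Suc i))) +
        dist (\<gamma> (?t2 i)) (\<gamma> (?t2 (Suc i))))"
      by (intro sum_mono)
    then have "?S t n \<le> ?S ?t1 n + ?S ?t2 n"
      by (simp add: sum.distrib sum_nonneg ennreal_plus[symmetric] ennreal_leI del: ennreal_plus)
    also have "?S ?t1 n \<le> curve_length \<gamma> a b"
      unfolding curve_length_def
      by (rule SUP_upper2[of "(?t1, n)"])
         (use t assms in \<open>auto simp: mono_def image_subset_iff min.coboundedI2 min_le_iff_disj\<close>)
    also have "?S ?t2 n \<le> curve_length \<gamma> b c"
      unfolding curve_length_def
    proof (rule SUP_upper2[of "(?t2, n)"])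
      have "mono ?t2" using t(1) by (intro monoI max.mono monoD[OF t(1)]) auto
      then show "(?t2, n) \<in> ?I b c" using t assms by (auto simp: image_subset_iff)
    qed simp
    finally show "?S t n \<le> curve_length \<gamma> a b + curve_length \<gamma> b c" by (simp add: add_mono)
  qed
  have *: "?S t n + ?S t' m \<le> curve_length \<gamma> a c"
    if "(t, n) \<in> ?I a b" "(t', m) \<in> ?I b c" for t n t' m
  proof -
    have t: "mono t" "\<And>i. a \<le> t i" "\<And>i. t i \<le> b" "mono t'" "\<And>i. b \<le> t' i" "\<And>i. t' i \<le> c"
      using that by (auto simp: image_subset_iff)
    \<comment> \<open>The second partition starts at index \<open>Suc n\<close>; the chord from
      \<open>t n\<close> to \<open>t' 0\<close> is extra and only increases the sum.\<close>
    let ?u = "\<lambda>i. if i \<le> n then t i else t' (i - Suc n)"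
    have "?S t n + ?S t' m = ?S ?u n + (\<Sum>i<m. ennreal (dist (\<gamma> (?u (Suc n + i))) (\<gamma> (?u (Suc (Suc n + i))))))"
      by (intro arg_cong2[where f="(+)"] sum.cong) auto
    also have "\<dots> \<le> ?S ?u (Suc n) + (\<Sum>i<m. ennreal (dist (\<gamma> (?u (Suc n + i))) (\<gamma> (?u (Suc (Suc n + i))))))"
      by (intro add_right_mono) simp
    also have "\<dots> = ?S ?u (Suc n + m)"
      by (simp only: sum_lessThan_add)
    also have "\<dots> \<le> curve_length \<gamma> a c"
      unfolding curve_length_def
    proof (rule SUP_upper2[of "(?u, Suc n + m)"])
      have "mono ?u"
      proof (rule monoI)
        fix i j :: nat assume "i \<le> j"
        then show "?u i \<le> ?u j"
          using monoD[OF t(1), of i j] monoD[OF t(4), of "i - Suc n" "j - Suc n"] t(3)[of i] t(5)[of "j - Suc n"]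
          by auto
      qed
      moreover have "?u i \<in> {a..c}" for i
        using t(2,3)[of i] t(5,6)[of "i - Suc n"] assms by auto
      ultimately show "(?u, Suc n + m) \<in> ?I a c" by blast
    qed (simp only: prod.case order_refl)
    finally show ?thesis .
  qed
  have ne: "?I a b \<noteq> {}" "?I b c \<noteq> {}"
    using assms by (auto simp: mono_def intro!: exI[of _ "\<lambda>_. b"])
  show "curve_length \<gamma> a b + curve_length \<gamma> b c \<le> curve_length \<gamma> a c"
    unfolding curve_length_def[of \<gamma> a b] curve_length_def[of \<gamma> b c]
    by (rule ennreal_SUP_add_SUP_le) (use ne * in \<open>auto simp: split_beta\<close>)
qed

text \<open>A set inside the image of \<open>s\<close> is the image of its preimage, and a
  1-Lipschitz map does not increase Lebesgue measure. For the latter, the preimage is covered by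
  non-overlapping intervals inside an open set of almost the same measure; by monotonicity [c, d] is
  mapped into [s c, s d], which is no longer than [c, d].\<close>

lemma emeasure_le_vimage_lipschitz:
  fixes s :: "real \<Rightarrow> real"
  assumes lip: "1-lipschitz_on UNIV s" and "mono s"
    and A: "A \<in> sets borel" "A \<subseteq> s ` {0..L}"
  shows "emeasure lborel A \<le> emeasure lborel ({0..L} \<inter> s -` A)"
proof (rule ennreal_le_epsilon)
  fix e :: real assume "e > 0"
  have cont: "continuous_on UNIV s" using lipschitz_on_continuous_on[OF lip] .
  have s_meas: "s \<in> borel_measurable borel" using cont by (rule borel_measurable_continuous_onI)
  define B where "B = {0..L} \<inter> s -` A"
  have B: "B \<in> sets borel" unfolding B_def
    using measurable_sets[OF s_meas A(1)] by (auto intro!: sets.Int)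
  have "B \<in> sets lebesgue" using B by (simp add: sets_completionI_sets)
  then obtain T where T: "open T" "B \<subseteq> T" "T - B \<in> lmeasurable" "emeasure lebesgue (T - B) < ennreal e"
    using sets_lebesgue_outer_open[OF _ \<open>e > 0\<close>] by metis
  \<comment> \<open>Each interval of the covering lemma lies in \<open>g x\<close> for some
    \<open>x\<close> in \<open>B\<close>, so this gauge forces all intervals into the open set
    \<open>T\<close>.\<close>
  define g where "g x = (if x \<in> T then T else UNIV)" for x
  have g: "gauge g" using T(1) by (auto simp: gauge_def g_def)
  have Bsub: "B \<subseteq> cbox 0 L" by (auto simp: B_def)
  show "emeasure lborel A \<le> emeasure lborel ({0..L} \<inter> s -` A) + ennreal e"
  proof (cases "box 0 L = ({}::real set)")
    case True
    then have "{0..L} \<subseteq> {0}" by (auto simp: box_real)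
    then have "A \<subseteq> {s 0}" using A(2) by blast
    then have "emeasure lborel A \<le> emeasure lborel {s 0}" by (intro emeasure_mono) auto
    then show ?thesis by simp
  next
    case False
    obtain D where D: "countable D" "\<Union>D \<subseteq> cbox 0 L"
        "\<And>K. K \<in> D \<Longrightarrow> interior K \<noteq> {} \<and> (\<exists>c d. K = cbox c d)"
        "pairwise (\<lambda>A B. interior A \<inter> interior B = {}) D"
        "\<And>K. K \<in> D \<Longrightarrow> \<exists>x \<in> B \<inter> K. K \<subseteq> g x"
        "\<And>u v. cbox u v \<in> D \<Longrightarrow> \<exists>n. \<forall>i\<in>Basis. v \<bullet> i - u \<bullet> i = (L \<bullet> i - 0 \<bullet> i) / 2^n"
        "B \<subseteq> \<Union>D"
      by (rule covering_lemma[OF Bsub False g]) (rule that, assumption+)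
    have "\<forall>K\<in>D. \<exists>cd. K = {fst cd..snd cd} \<and> fst cd \<le> snd cd"
    proof
      fix K assume "K \<in> D"
      from D(3)[OF this] obtain c d where "K = cbox c d" "interior K \<noteq> {}" by blast
      then show "\<exists>cd. K = {fst cd..snd cd} \<and> fst cd \<le> snd cd" by (intro exI[of _ "(c, d)"]) auto
    qed
    then obtain cd where cd: "\<And>K. K \<in> D \<Longrightarrow> K = {fst (cd K)..snd (cd K)}" "\<And>K. K \<in> D \<Longrightarrow> fst (cd K) \<le> snd (cd K)"
      by metis
    define I where "I K = {s (fst (cd K))..s (snd (cd K))}" for K
    have "emeasure lborel A \<le> emeasure lborel (\<Union>K\<in>D. I K)"
    proof (rule emeasure_mono)
      show "A \<subseteq> (\<Union>K\<in>D. I K)"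
      proof
        fix y assume "y \<in> A"
        then obtain t where "t \<in> {0..L}" "y = s t" using A(2) by auto
        then have "t \<in> B" using \<open>y \<in> A\<close> by (auto simp: B_def)
        then obtain K where "K \<in> D" "t \<in> K" using D(7) by auto
        then have "y \<in> I K" using cd(1)[of K] monoD[OF \<open>mono s\<close>] \<open>y = s t\<close> unfolding I_def by (metis atLeastAtMost_iff)
        then show "y \<in> (\<Union>K\<in>D. I K)" using \<open>K \<in> D\<close> by blast
      qed
    qed (use D(1) in \<open>auto simp: I_def intro!: sets.countable_UN'\<close>)
    also have "\<dots> \<le> (\<integral>\<^sup>+K. emeasure lborel (I K) \<partial>count_space D)"
    proof -
      have "emeasure lborel (\<Union>K\<in>D. I K) = (\<integral>\<^sup>+x. indicator (\<Union>K\<in>D. I K) x \<partial>lborel)"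
        by (subst nn_integral_indicator) (use D(1) in \<open>auto simp: I_def intro!: sets.countable_UN'\<close>)
      also have "\<dots> \<le> (\<integral>\<^sup>+x. (\<integral>\<^sup>+K. indicator (I K) x \<partial>count_space D) \<partial>lborel)"
      proof (rule nn_integral_mono)
        fix x
        show "indicator (\<Union>K\<in>D. I K) x \<le> (\<integral>\<^sup>+K. indicator (I K) x \<partial>count_space D)"
        proof (cases "x \<in> (\<Union>K\<in>D. I K)")
          case True
          then obtain K where K: "K \<in> D" "x \<in> I K" by auto
          have "(1::ennreal) \<le> (\<integral>\<^sup>+K'. indicator {K} K' \<partial>count_space D)"
            using K by (subst nn_integral_indicator) auto
          also have "\<dots> \<le> (\<integral>\<^sup>+K. indicator (I K) x \<partial>count_space D)"
            using K by (intro nn_integral_mono) (auto split: split_indicator)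
          finally show ?thesis using True by simp
        qed simp
      qed
      also have "\<dots> = (\<integral>\<^sup>+K. (\<integral>\<^sup>+x. indicator (I K) x \<partial>lborel) \<partial>count_space D)"
        by (rule nn_integral_count_space_nn_integral) (use D(1) in \<open>auto simp: I_def\<close>)
      also have "\<dots> = (\<integral>\<^sup>+K. emeasure lborel (I K) \<partial>count_space D)"
        by (simp add: I_def)
      finally show ?thesis .
    qed
    also have "\<dots> \<le> (\<integral>\<^sup>+K. emeasure lborel (interior K) \<partial>count_space D)"
    proof (rule nn_integral_mono)
      fix K assume "K \<in> space (count_space D)"
      then have K: "K \<in> D" by simp
      have "s (snd (cd K)) - s (fst (cd K)) \<le> snd (cd K) - fst (cd K)"
        using lipschitz_onD[OF lip, of "fst (cd K)" "snd (cd K)"] cd(2)[OF K] by (simp add: dist_real_def)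
      moreover have "interior K = {fst (cd K)<..<snd (cd K)}" using cd(1)[OF K] interior_atLeastAtMost_real by metis
      moreover have "s (fst (cd K)) \<le> s (snd (cd K))" using cd(2)[OF K] monoD[OF \<open>mono s\<close>] by blast
      ultimately show "emeasure lborel (I K) \<le> emeasure lborel (interior K)"
        using cd(2)[OF K] by (simp add: I_def ennreal_leI)
    qed
    also have "\<dots> = emeasure lborel (\<Union>K\<in>D. interior K)"
      by (rule emeasure_UN_countable[symmetric])
         (use D in \<open>auto simp: disjoint_family_on_def pairwise_def\<close>)
    also have "\<dots> \<le> emeasure lborel T"
    proof (rule emeasure_mono)
      show "(\<Union>K\<in>D. interior K) \<subseteq> T"
      proof
        fix x assume "x \<in> (\<Union>K\<in>D. interior K)"
        then obtain K where K: "K \<in> D" "x \<in> K" using interior_subset by blast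
        obtain y where "y \<in> B" "K \<subseteq> g y" using D(5)[OF K(1)] by blast
        then show "x \<in> T" using T(2) K(2) by (auto simp: g_def split: if_splits)
      qed
    qed (use T(1) in auto)
    also have "\<dots> = emeasure lborel (B \<union> (T - B))" using T(2) by (simp add: Un_absorb1)
    also have "\<dots> \<le> emeasure lborel B + emeasure lborel (T - B)"
      by (rule emeasure_subadditive) (use B T(1) in auto)
    also have "emeasure lborel (T - B) \<le> ennreal e"
      using T(4) B T(1) by (simp add: borel_open sets.Diff)
    finally show ?thesis unfolding B_def by (simp add: add_left_mono)
  qed
qed

text \<open>Lebesgue measure on \<open>{0..l}\<close> is dominated, as a measure, by the image under
  \<open>s\<close> of Lebesgue measure on \<open>{0..L}\<close>. Integrating \<phi> against both
  gives the substitution inequality without differentiating \<open>s\<close>.\<close>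

lemma nn_integral_le_lipschitz_subst:
  fixes s :: "real \<Rightarrow> real" and \<phi> :: "real \<Rightarrow> ennreal"
  assumes lip: "1-lipschitz_on UNIV s" and "mono s" and "0 \<le> L"
    and s0: "s 0 = 0" "s L = l" and \<phi>: "\<phi> \<in> borel_measurable borel"
  shows "(\<integral>\<^sup>+t\<in>{0..l}. \<phi> t \<partial>lborel) \<le> (\<integral>\<^sup>+t\<in>{0..L}. \<phi> (s t) \<partial>lborel)"
proof -
  have cont: "continuous_on UNIV s" using lipschitz_on_continuous_on[OF lip] .
  have s_meas[measurable]: "s \<in> borel_measurable borel" using cont by (rule borel_measurable_continuous_onI)
  note \<phi>[measurable]
  define N where "N = distr (density lborel (indicator {0..L})) borel s"
  define M where "M = density lborel (indicator {0..l} :: real \<Rightarrow> ennreal)"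
  have onto: "{0..l} \<subseteq> s ` {0..L}"
  proof
    fix y assume "y \<in> {0..l}"
    then show "y \<in> s ` {0..L}"
      using IVT'[of s 0 y L] s0 \<open>0 \<le> L\<close> cont continuous_on_subset by (metis UNIV_I atLeastAtMost_iff image_eqI subsetI)
  qed
  have "M \<le> N"
  proof (subst le_measure)
    show "\<forall>A\<in>sets M. emeasure M A \<le> emeasure N A"
    proof
      fix A assume "A \<in> sets M"
      then have A[measurable]: "A \<in> sets borel" by (simp add: M_def)
      have "emeasure M A = emeasure lborel ({0..l} \<inter> A)"
        unfolding M_def by (subst emeasure_density) (auto simp flip: indicator_inter_arith)
      also have "\<dots> \<le> emeasure lborel ({0..L} \<inter> s -` ({0..l} \<inter> A))"
        using onto by (intro emeasure_le_vimage_lipschitz[OF lip \<open>mono s\<close>]) auto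
      also have "\<dots> \<le> emeasure lborel ({0..L} \<inter> s -` A)"
        using measurable_sets[OF s_meas A] by (intro emeasure_mono) auto
      also have "\<dots> = emeasure N A"
        unfolding N_def
        using measurable_sets[OF s_meas A]
        by (subst emeasure_distr; simp) (subst emeasure_density; auto simp flip: indicator_inter_arith)
      finally show "emeasure M A \<le> emeasure N A" .
    qed
  qed (simp add: M_def N_def)
  have "(\<integral>\<^sup>+t\<in>{0..l}. \<phi> t \<partial>lborel) = (\<integral>\<^sup>+t. \<phi> t \<partial>M)"
    unfolding M_def by (subst nn_integral_density) (auto simp: mult.commute)
  also have "\<dots> \<le> (\<integral>\<^sup>+t. \<phi> t \<partial>N)"
    by (rule nn_integral_mono_measure) (use \<open>M \<le> N\<close> in \<open>auto simp: M_def N_def\<close>)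
  also have "\<dots> = (\<integral>\<^sup>+t\<in>{0..L}. \<phi> (s t) \<partial>lborel)"
  proof -
    have "(\<integral>\<^sup>+t. \<phi> t \<partial>N) = (\<integral>\<^sup>+t. \<phi> (s t) \<partial>density lborel (indicator {0..L}))"
      unfolding N_def by (rule nn_integral_distr) auto
    also have "\<dots> = (\<integral>\<^sup>+t\<in>{0..L}. \<phi> (s t) \<partial>lborel)"
      by (subst nn_integral_density) (auto simp: mult.commute)
    finally show ?thesis .
  qed
  finally show ?thesis .
qed

text \<open>Extension by constants to the whole line: total curves are Borel and can be shifted,
  reversed and joined without side conditions on domains.\<close>

lemma lipschitz_on_clamp:
  fixes \<gamma> :: "real \<Rightarrow> 'a::metric_space"
  assumes "1-lipschitz_on {a..b} \<gamma>" "a \<le> b"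
  shows "1-lipschitz_on UNIV (\<lambda>t. \<gamma> (max a (min b t)))"
proof (rule lipschitz_onI)
  fix x y
  have "dist (\<gamma> (max a (min b x))) (\<gamma> (max a (min b y))) \<le> 1 * dist (max a (min b x)) (max a (min b y))"
    by (rule lipschitz_onD[OF assms(1)]) (use assms(2) in auto)
  also have "\<dots> \<le> 1 * dist x y" by (auto simp: dist_real_def)
  finally show "dist (\<gamma> (max a (min b x))) (\<gamma> (max a (min b y))) \<le> 1 * dist x y" .
qed simp

lemma lipschitz_on_arc_length_curve:
  assumes "arc_length_curve S l \<gamma>"
  shows "1-lipschitz_on {0..l} \<gamma>"
proof (rule lipschitz_on_leI)
  fix x y assume xy: "x \<in> {0..l}" "y \<in> {0..l}" "x \<le> y"
  then have "ennreal (dist (\<gamma> x) (\<gamma> y)) \<le> ennreal (y - x)"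
    using dist_le_curve_length[of x y \<gamma>] assms by (auto simp: arc_length_curve_def)
  then show "dist (\<gamma> x) (\<gamma> y) \<le> 1 * dist x y"
    using xy by (simp add: dist_real_def)
qed simp

lemma borel_measurable_lipschitz:
  fixes \<gamma> :: "real \<Rightarrow> 'a::metric_space"
  assumes "1-lipschitz_on UNIV \<gamma>"
  shows "\<gamma> \<in> borel_measurable borel"
  using lipschitz_on_continuous_on[OF assms] by (rule borel_measurable_continuous_onI)

text \<open>Costs are defined with 1-Lipschitz curves because these survive pointwise limits,
  whereas upper gradients and path-openness speak of arc-length curves; this is the bridge.
  \<open>s\<close> is the length function of \<gamma>, and \<sigma> is \<gamma> after a right
  inverse \<tau> of \<open>s\<close>. Since \<open>s\<close> is 1-Lipschitz, passing to arc length
  cannot increase a line integral.\<close>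

lemma arc_length_reparametrization:
  fixes \<gamma> :: "real \<Rightarrow> 'a::metric_space"
  assumes lip: "1-lipschitz_on UNIV \<gamma>" and "0 \<le> L" and t0: "t0 \<in> {0..L}" "\<gamma> t0 \<noteq> \<gamma> 0"
  obtains l \<sigma> s where "arc_length_curve (\<gamma> ` {0..L}) l \<sigma>"
    "1-lipschitz_on UNIV s" "mono s" "s 0 = 0" "s L = l"
    "\<And>t. t \<in> {0..L} \<Longrightarrow> \<sigma> (s t) = \<gamma> t"
    "\<And>f. f \<in> borel_measurable borel \<Longrightarrow> line_integral l \<sigma> f \<le> line_integral L \<gamma> f"
proof -
  let ?V = "curve_length \<gamma>"
  have fin: "?V a b \<le> ennreal (b - a)" if "a \<le> b" for a b
    by (rule curve_length_le[OF lipschitz_on_subset[OF lip] that]) simp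
  have fin': "ennreal (enn2real (?V a b)) = ?V a b" if "a \<le> b" for a b
    using fin[OF that] by (intro ennreal_enn2real) (meson ennreal_less_top order.strict_trans1)
  define s where "s t = enn2real (?V 0 (max 0 (min L t)))" for t
  have s_diff: "?V a b = ennreal (s b - s a) \<and> s a \<le> s b" if "0 \<le> a" "a \<le> b" "b \<le> L" for a b
  proof -
    have s: "s a = enn2real (?V 0 a)" "s b = enn2real (?V 0 b)" using that by (auto simp: s_def)
    have "ennreal (s b) = ennreal (s a) + ?V a b"
      using curve_length_add[of 0 a b \<gamma>] fin'[of 0 a] fin'[of 0 b] that s by simp
    also have "\<dots> = ennreal (s a + enn2real (?V a b))"
      using fin'[of a b] that by (simp add: ennreal_plus s)
    finally have "s b = s a + enn2real (?V a b)"
      by (simp add: s del: ennreal_plus)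
    then show ?thesis using fin'[of a b] that by simp
  qed
  have s_lip0: "\<bar>s b - s a\<bar> \<le> b - a" if "0 \<le> a" "a \<le> b" "b \<le> L" for a b
    using s_diff[OF that] fin[OF that(2)] that by simp
  have s_clamp: "s = (\<lambda>t. s (max 0 (min L t)))" using \<open>0 \<le> L\<close> by (auto simp: s_def fun_eq_iff max_def min_def)
  have "1-lipschitz_on {0..L} s"
    by (rule lipschitz_on_leI) (use s_lip0 in \<open>auto simp: dist_real_def abs_minus_commute\<close>)
  then have s_lip: "1-lipschitz_on UNIV s"
    using lipschitz_on_clamp[of 0 L s] \<open>0 \<le> L\<close> s_clamp by metis
  have "mono s"
  proof (rule monoI)
    fix x y :: real assume "x \<le> y"
    then have "s (max 0 (min L x)) \<le> s (max 0 (min L y))" using s_diff \<open>0 \<le> L\<close> by (simp add: max_def min_def)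
    then show "s x \<le> s y" using s_clamp by metis
  qed
  have s0: "s 0 = 0"
    using fin[of 0 0] \<open>0 \<le> L\<close> by (simp add: s_def)
  define l where "l = s L"
  have "0 < l"
  proof -
    have "0 < ennreal (dist (\<gamma> 0) (\<gamma> t0))" using t0 by simp
    also have "\<dots> \<le> ennreal (s t0 - s 0)"
      using dist_le_curve_length[of 0 t0 \<gamma>] s_diff[of 0 t0] t0 by auto
    finally have "0 < s t0" using s0 by simp
    also have "s t0 \<le> l" unfolding l_def using t0 monoD[OF \<open>mono s\<close>] by auto
    finally show ?thesis .
  qed
  have cont: "continuous_on {0..L} s" using s_lip lipschitz_on_continuous_on continuous_on_subset by blast
  have "\<exists>t. t \<in> {0..L} \<and> s t = y" if "y \<in> {0..l}" for y
    using IVT'[of s 0 y L, OF _ _ _ cont] that s0 \<open>0 \<le> L\<close> by (auto simp: l_def)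
  then obtain \<tau> where \<tau>: "\<And>y. y \<in> {0..l} \<Longrightarrow> \<tau> y \<in> {0..L} \<and> s (\<tau> y) = y" by metis
  have \<tau>_mono: "\<tau> y \<le> \<tau> y'" if "y \<in> {0..l}" "y' \<in> {0..l}" "y \<le> y'" for y y'
  proof (rule ccontr)
    assume "\<not> \<tau> y \<le> \<tau> y'"
    then have "y' \<le> y" using monoD[OF \<open>mono s\<close>, of "\<tau> y'" "\<tau> y"] \<tau> that by auto
    then show False using that \<open>\<not> \<tau> y \<le> \<tau> y'\<close> by auto
  qed
  have s_range: "s t \<in> {0..l}" for t
    using monoD[OF \<open>mono s\<close>, of 0 "max 0 (min L t)"] monoD[OF \<open>mono s\<close>, of "max 0 (min L t)" L] s0 \<open>0 \<le> L\<close>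
    by (subst (1) s_clamp) (auto simp: l_def)
  define \<sigma> where "\<sigma> y = \<gamma> (\<tau> (max 0 (min l y)))" for y
  have \<sigma>_eq: "\<sigma> y = \<gamma> (\<tau> y)" if "y \<in> {0..l}" for y using that by (simp add: \<sigma>_def)
  \<comment> \<open>The parameter \<open>\<tau> (s t)\<close> may differ from \<open>t\<close>, but
    \<open>s\<close> takes the same value at both, so the piece of \<gamma> between them has length
    zero.\<close>
  have \<sigma>s: "\<sigma> (s t) = \<gamma> t" if t: "t \<in> {0..L}" for t
  proof -
    define a where "a = min t (\<tau> (s t))"
    define b where "b = max t (\<tau> (s t))"
    have "s a = s t" "s b = s t" "0 \<le> a" "a \<le> b" "b \<le> L"
      using \<tau>[OF s_range[of t]] t by (auto simp: a_def b_def min_def max_def)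
    then have "ennreal (dist (\<gamma> a) (\<gamma> b)) \<le> 0"
      using dist_le_curve_length[of a b \<gamma>] s_diff[of a b] by simp
    then have "\<gamma> a = \<gamma> b" by simp
    then show ?thesis using s_range[of t] by (auto simp: \<sigma>_eq a_def b_def min_def max_def split: if_splits)
  qed
  have len: "curve_length \<sigma> y y' = ennreal (y' - y)" if "0 \<le> y" "y \<le> y'" "y' \<le> l" for y y'
  proof (rule antisym)
    have "curve_length \<sigma> y y' \<le> curve_length \<gamma> (\<tau> y) (\<tau> y')"
      by (rule curve_length_mono_image[of _ _ \<tau>]) (use that in \<open>auto simp: \<sigma>_eq mono_on_def intro!: \<tau>_mono\<close>)
    also have "\<dots> = ennreal (y' - y)"
      using s_diff[of "\<tau> y" "\<tau> y'"] \<tau>[of y] \<tau>[of y'] \<tau>_mono[of y y'] that by auto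
    finally show "curve_length \<sigma> y y' \<le> ennreal (y' - y)" .
    have "ennreal (y' - y) = curve_length \<gamma> (\<tau> y) (\<tau> y')"
      using s_diff[of "\<tau> y" "\<tau> y'"] \<tau>[of y] \<tau>[of y'] \<tau>_mono[of y y'] that by auto
    also have "\<dots> \<le> curve_length \<sigma> y y'"
    proof (rule curve_length_mono_image[of _ _ s])
      show "mono_on {\<tau> y..\<tau> y'} s" using \<open>mono s\<close> by (simp add: mono_on_def mono_def)
      show "s ` {\<tau> y..\<tau> y'} \<subseteq> {y..y'}"
        using monoD[OF \<open>mono s\<close>] \<tau>[of y] \<tau>[of y'] that by (fastforce simp: image_subset_iff)
      show "\<tau> y \<le> \<tau> y'" using \<tau>_mono that by auto
      show "\<gamma> t = \<sigma> (s t)" if "t \<in> {\<tau> y..\<tau> y'}" for t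
        using \<sigma>s[of t] that \<tau>[of y] \<tau>[of y'] \<open>0 \<le> y\<close> \<open>y \<le> y'\<close> \<open>y' \<le> l\<close> by auto
    qed
    finally show "ennreal (y' - y) \<le> curve_length \<sigma> y y'" .
  qed
  have arc: "arc_length_curve (\<gamma> ` {0..L}) l \<sigma>"
    unfolding arc_length_curve_def using \<open>0 < l\<close> len \<tau> by (auto simp: \<sigma>_eq)
  have \<sigma>_clamp: "\<sigma> = (\<lambda>y. \<sigma> (max 0 (min l y)))" using \<open>0 < l\<close> by (auto simp: \<sigma>_def fun_eq_iff)
  have "1-lipschitz_on UNIV \<sigma>"
    using lipschitz_on_clamp[OF lipschitz_on_arc_length_curve[OF arc]] \<open>0 < l\<close> \<sigma>_clamp by (metis less_imp_le)
  then have [measurable]: "\<sigma> \<in> borel_measurable borel" by (rule borel_measurable_lipschitz)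
  have int: "line_integral l \<sigma> f \<le> line_integral L \<gamma> f" if [measurable]: "f \<in> borel_measurable borel" for f
  proof -
    have "line_integral l \<sigma> f \<le> (\<integral>\<^sup>+t\<in>{0..L}. f (\<sigma> (s t)) \<partial>lborel)"
      unfolding line_integral_def
      by (rule nn_integral_le_lipschitz_subst[OF s_lip \<open>mono s\<close> \<open>0 \<le> L\<close> s0]) (auto simp: l_def)
    also have "\<dots> = line_integral L \<gamma> f"
      unfolding line_integral_def by (intro nn_integral_cong) (auto simp: \<sigma>s split: split_indicator)
    finally show ?thesis .
  qed
  show ?thesis
    using that[OF arc s_lip \<open>mono s\<close> s0] \<sigma>s int by (simp add: l_def)
qed

subsection \<open>Curves of bounded cost\<close>

lemma enumerate_rationals:
  obtains q :: "nat \<Rightarrow> real" where "range q = \<rat>"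
  using range_from_nat_into[of "\<rat> :: real set"] countable_rat Rats_0 that by (metis empty_iff)

lemma lipschitz_on_pointwise_limit:
  assumes "\<And>i. C-lipschitz_on S (f i)" "\<And>x. x \<in> S \<Longrightarrow> (\<lambda>i::nat. f i x) \<longlonglongrightarrow> g x"
  shows "C-lipschitz_on S g"
proof (rule lipschitz_onI)
  fix x y assume "x \<in> S" "y \<in> S"
  then have "(\<lambda>i. dist (f i x) (f i y)) \<longlonglongrightarrow> dist (g x) (g y)" by (intro tendsto_dist assms)
  then show "dist (g x) (g y) \<le> C * dist x y"
    by (rule LIMSEQ_le_const2) (use lipschitz_onD[OF assms(1)] \<open>x \<in> S\<close> \<open>y \<in> S\<close> in auto)
qed (use lipschitz_on_nonneg[OF assms(1)] in auto)

text \<open>Arzela-Ascoli: a diagonal sequence converges at all rational parameters, and the common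
  Lipschitz constant turns this into a Cauchy condition at every real one.\<close>

lemma lipschitz_curves_convergent_subsequence:
  fixes \<gamma> :: "nat \<Rightarrow> real \<Rightarrow> 'a::metric_space"
  assumes "compact Z" and lip: "\<And>i. 1-lipschitz_on UNIV (\<gamma> i)" and rng: "\<And>i. range (\<gamma> i) \<subseteq> Z"
  obtains r :: "nat \<Rightarrow> nat" and \<delta> where "strict_mono r" "1-lipschitz_on UNIV \<delta>" "range \<delta> \<subseteq> Z"
    "\<And>t. (\<lambda>i. \<gamma> (r i) t) \<longlonglongrightarrow> \<delta> t"
proof -
  obtain q :: "nat \<Rightarrow> real" where q: "range q = \<rat>" by (rule enumerate_rationals)
  interpret subseqs "\<lambda>n s. \<exists>l. (\<lambda>i. \<gamma> (s i) (q n)) \<longlonglongrightarrow> l"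
  proof
    fix n and s :: "nat \<Rightarrow> nat"
    have "\<forall>i. \<gamma> (s i) (q n) \<in> Z" using rng by auto
    then obtain l r where "strict_mono r" "((\<lambda>i. \<gamma> (s i) (q n)) \<circ> r) \<longlonglongrightarrow> l"
      using \<open>compact Z\<close> unfolding compact_def by meson
    then show "\<exists>r'. strict_mono r' \<and> (\<exists>l. (\<lambda>i. \<gamma> ((s \<circ> r') i) (q n)) \<longlonglongrightarrow> l)" by (auto simp: o_def)
  qed
  let ?r = diagseq
  have conv_q: "\<exists>l. (\<lambda>i. \<gamma> (?r i) (q n)) \<longlonglongrightarrow> l" for n
  proof -
    \<comment> \<open>The diagonal sequence inherits the \<open>n\<close>-th property only from
      index \<open>Suc n\<close> on; the shift is undone afterwards.\<close>
    have "\<exists>l. (\<lambda>i. \<gamma> ((?r \<circ> ((+) (Suc n))) i) (q n)) \<longlonglongrightarrow> l"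
      by (rule diagseq_holds) (auto simp: o_def intro: LIMSEQ_subseq_LIMSEQ[unfolded o_def])
    then show ?thesis
      using LIMSEQ_offset[of "\<lambda>i. \<gamma> (?r i) (q n)" "Suc n"] by (auto simp: add.commute)
  qed
  have "\<exists>l. l \<in> Z \<and> (\<lambda>i. \<gamma> (?r i) t) \<longlonglongrightarrow> l" for t
  proof -
    have "Cauchy (\<lambda>i. \<gamma> (?r i) t)"
    proof (rule metric_CauchyI)
      fix e :: real assume "e > 0"
      obtain u where "u \<in> \<rat>" "t < u" "u < t + e / 3"
        using Rats_dense_in_real[of t "t + e/3"] \<open>e > 0\<close> by auto
      then obtain n where n: "q n = u" using q by (metis imageE)
      have d: "dist (\<gamma> i t) (\<gamma> i u) < e / 3" for i
        using lipschitz_onD[OF lip[of i], of t u] \<open>t < u\<close> \<open>u < t + e/3\<close> by (simp add: dist_real_def)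
      have "Cauchy (\<lambda>i. \<gamma> (?r i) u)" using conv_q[of n] n LIMSEQ_imp_Cauchy by auto
      then obtain M where M: "\<And>i j. i \<ge> M \<Longrightarrow> j \<ge> M \<Longrightarrow> dist (\<gamma> (?r i) u) (\<gamma> (?r j) u) < e/3"
        using \<open>e > 0\<close> by (meson metric_CauchyD divide_pos_pos zero_less_numeral)
      have "dist (\<gamma> (?r i) t) (\<gamma> (?r j) t) < e" if "i \<ge> M" "j \<ge> M" for i j
      proof -
        have "dist (\<gamma> (?r i) t) (\<gamma> (?r j) t) \<le> dist (\<gamma> (?r i) t) (\<gamma> (?r i) u)
            + dist (\<gamma> (?r i) u) (\<gamma> (?r j) u) + dist (\<gamma> (?r j) u) (\<gamma> (?r j) t)"
          by (meson dist_triangle_le add_right_mono dist_triangle order_trans)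
        then show ?thesis using d[of "?r i"] d[of "?r j"] M[OF that] by (simp add: dist_commute)
      qed
      then show "\<exists>M. \<forall>m\<ge>M. \<forall>n\<ge>M. dist (\<gamma> (?r m) t) (\<gamma> (?r n) t) < e" by blast
    qed
    moreover have "\<forall>i. \<gamma> (?r i) t \<in> Z" using rng by auto
    ultimately show ?thesis
      using compact_imp_complete[OF \<open>compact Z\<close>, unfolded complete_def, rule_format, OF conjI] by (simp add: Bex_def)
  qed
  then have "\<exists>\<delta>. \<forall>t. \<delta> t \<in> Z \<and> (\<lambda>i. \<gamma> (?r i) t) \<longlonglongrightarrow> \<delta> t"
    by (intro choice allI)
  then obtain \<delta> where "\<forall>t. \<delta> t \<in> Z \<and> (\<lambda>i. \<gamma> (?r i) t) \<longlonglongrightarrow> \<delta> t" by (rule exE)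
  then have \<delta>: "\<And>t. \<delta> t \<in> Z" "\<And>t. (\<lambda>i. \<gamma> (?r i) t) \<longlonglongrightarrow> \<delta> t" by simp_all
  have "1-lipschitz_on UNIV \<delta>"
    by (rule lipschitz_on_pointwise_limit[of _ _ "\<lambda>i. \<gamma> (?r i)"]) (use lip \<delta> in auto)
  then show ?thesis using that[OF subseq_diagseq _ _ \<delta>(2)] \<delta>(1) by blast
qed

section \<open>Concatenation and reversal of Lipschitz curves\<close>

definition concat_curve :: "real \<Rightarrow> (real \<Rightarrow> 'a) \<Rightarrow> (real \<Rightarrow> 'a) \<Rightarrow> real \<Rightarrow> 'a" where
  "concat_curve L \<gamma> \<gamma>' t = (if t \<le> L then \<gamma> t else \<gamma>' (t - L))"

lemma lipschitz_on_concat_curve: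
  assumes "1-lipschitz_on UNIV \<gamma>" "1-lipschitz_on UNIV \<gamma>'" "\<gamma> L = \<gamma>' 0"
  shows "1-lipschitz_on UNIV (concat_curve L \<gamma> \<gamma>')"
proof (rule lipschitz_on_leI)
  fix x y :: real assume "x \<le> y"
  consider "y \<le> L" | "x \<le> L" "L < y" | "L < x" using \<open>x \<le> y\<close> by linarith
  then show "dist (concat_curve L \<gamma> \<gamma>' x) (concat_curve L \<gamma> \<gamma>' y) \<le> 1 * dist x y"
  proof cases
    case 1
    then show ?thesis using lipschitz_onD[OF assms(1), of x y] \<open>x \<le> y\<close> by (simp add: concat_curve_def)
  next
    case 2
    have "dist (\<gamma> x) (\<gamma>' (y - L)) \<le> dist (\<gamma> x) (\<gamma> L) + dist (\<gamma>' 0) (\<gamma>' (y - L))"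
      by (metis assms(3) dist_triangle)
    also have "\<dots> \<le> dist x L + dist 0 (y - L)"
      using lipschitz_onD[OF assms(1), of x L] lipschitz_onD[OF assms(2), of 0 "y - L"] by simp
    also have "\<dots> = dist x y" using 2 by (simp add: dist_real_def)
    finally show ?thesis using 2 by (simp add: concat_curve_def)
  next
    case 3
    then show ?thesis
      using lipschitz_onD[OF assms(2), of "x - L" "y - L"] \<open>x \<le> y\<close> by (simp add: concat_curve_def dist_real_def)
  qed
qed simp

lemma lipschitz_on_reverse:
  fixes \<gamma> :: "real \<Rightarrow> 'a::metric_space"
  assumes "1-lipschitz_on UNIV \<gamma>"
  shows "1-lipschitz_on UNIV (\<lambda>t. \<gamma> (L - t))"
proof (rule lipschitz_onI)
  fix s t
  show "dist (\<gamma> (L - s)) (\<gamma> (L - t)) \<le> 1 * dist s t"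
    using lipschitz_onD[OF assms, of "L - s" "L - t"] by (simp add: dist_real_def abs_minus_commute)
qed simp

lemma line_integral_shift:
  fixes \<gamma> :: "real \<Rightarrow> 'a::metric_space"
  assumes [measurable]: "f \<in> borel_measurable borel" "\<gamma> \<in> borel_measurable borel"
  shows "line_integral (b - a) (\<lambda>t. \<gamma> (t + a)) f = (\<integral>\<^sup>+t\<in>{a..b}. f (\<gamma> t) \<partial>lborel)"
proof -
  have "(\<integral>\<^sup>+t\<in>{a..b}. f (\<gamma> t) \<partial>lborel) = (\<integral>\<^sup>+t. f (\<gamma> (a + 1 * t)) * indicator {a..b} (a + 1 * t) \<partial>lborel)"
    using nn_integral_real_affine[of "\<lambda>t. f (\<gamma> t) * indicator {a..b} t" 1 a] by simp
  also have "\<dots> = line_integral (b - a) (\<lambda>t. \<gamma> (t + a)) f"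
    unfolding line_integral_def by (intro nn_integral_cong) (auto simp: add.commute split: split_indicator)
  finally show ?thesis ..
qed

lemma line_integral_reverse:
  fixes \<gamma> :: "real \<Rightarrow> 'a::metric_space"
  assumes [measurable]: "f \<in> borel_measurable borel" "\<gamma> \<in> borel_measurable borel"
  shows "line_integral L (\<lambda>t. \<gamma> (L - t)) f = line_integral L \<gamma> f"
proof -
  have "line_integral L \<gamma> f = (\<integral>\<^sup>+t. f (\<gamma> (L + -1 * t)) * indicator {0..L} (L + -1 * t) \<partial>lborel)"
    using nn_integral_real_affine[of "\<lambda>t. f (\<gamma> t) * indicator {0..L} t" "-1" L] by (simp add: line_integral_def)
  also have "\<dots> = line_integral L (\<lambda>t. \<gamma> (L - t)) f"
    unfolding line_integral_def by (intro nn_integral_cong) (auto split: split_indicator)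
  finally show ?thesis ..
qed

lemma line_integral_concat_curve_le:
  fixes \<gamma> :: "real \<Rightarrow> 'a::metric_space"
  assumes [measurable]: "f \<in> borel_measurable borel" "\<gamma> \<in> borel_measurable borel" "\<gamma>' \<in> borel_measurable borel"
    and "0 \<le> L" "0 \<le> M"
  shows "line_integral (L + M) (concat_curve L \<gamma> \<gamma>') f \<le> line_integral L \<gamma> f + line_integral M \<gamma>' f"
proof -
  have "line_integral (L + M) (concat_curve L \<gamma> \<gamma>') f \<le>
      (\<integral>\<^sup>+t. f (\<gamma> t) * indicator {0..L} t + f (\<gamma>' (t - L)) * indicator {L..L+M} t \<partial>lborel)"
    unfolding line_integral_def
    by (intro nn_integral_mono) (auto simp: concat_curve_def split: split_indicator)
  also have "\<dots> = line_integral L \<gamma> f + (\<integral>\<^sup>+t\<in>{L..L+M}. f (\<gamma>' (t - L)) \<partial>lborel)"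
    unfolding line_integral_def by (rule nn_integral_add) auto
  also have "(\<integral>\<^sup>+t\<in>{L..L+M}. f (\<gamma>' (t - L)) \<partial>lborel) = line_integral M \<gamma>' f"
    using line_integral_shift[of f "\<lambda>t. \<gamma>' (t - L)" "L + M" L] by simp
  finally show ?thesis .
qed

lemma line_integral_mono:
  assumes "L \<le> L'" "\<And>t. 0 \<le> t \<Longrightarrow> t \<le> L \<Longrightarrow> f (\<gamma> t) \<le> f' (\<gamma>' t)"
  shows "line_integral L \<gamma> f \<le> line_integral L' \<gamma>' f'"
  unfolding line_integral_def using assms
  by (intro nn_integral_mono) (auto split: split_indicator)

text \<open>\<open>ge1\<close> bounds length by cost, so curves of bounded cost have bounded
  parameter intervals and distances are at most costs. \<open>lsc\<close> is what Fatou's lemma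
  needs to pass costs to a limit curve, which \<open>compact_Z\<close> supplies.\<close>

locale cost_space =
  fixes Z :: "'b::metric_space set" and \<rho> :: "'b \<Rightarrow> ennreal"
  assumes compact_Z: "compact Z"
    and lsc: "\<And>c. open {y. c < \<rho> y}"
    and ge1: "\<And>y. 1 \<le> \<rho> y"
begin

definition reach :: "real \<Rightarrow> 'b \<Rightarrow> 'b \<Rightarrow> bool" where
  "reach t x y \<longleftrightarrow> (\<exists>\<gamma> L. 0 \<le> L \<and> 1-lipschitz_on UNIV \<gamma> \<and> range \<gamma> \<subseteq> Z \<and> \<gamma> 0 = x \<and> \<gamma> L = y \<and>
     line_integral L \<gamma> \<rho> \<le> ennreal t)"

lemma rho_measurable[measurable]: "\<rho> \<in> borel_measurable borel"
proof (rule borel_measurableI_greater)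
  fix c
  have "{w \<in> space borel. c < \<rho> w} = {w. c < \<rho> w}" by simp
  then show "{w \<in> space borel. c < \<rho> w} \<in> sets borel" using lsc[of c] by simp
qed

lemma length_le_line_integral: "ennreal L \<le> line_integral L \<gamma> \<rho>"
proof -
  have "ennreal L \<le> (\<integral>\<^sup>+t\<in>{0..L}. 1 \<partial>lborel)" by (cases "0 \<le> L") (auto simp: ennreal_neg)
  also have "\<dots> \<le> line_integral L \<gamma> \<rho>"
    unfolding line_integral_def using ge1 by (intro nn_integral_mono mult_right_mono) auto
  finally show ?thesis .
qed

lemma limit_curve:
  fixes \<gamma> :: "nat \<Rightarrow> real \<Rightarrow> 'b"
  assumes lip: "\<And>i. 1-lipschitz_on UNIV (\<gamma> i)" and rng: "\<And>i. range (\<gamma> i) \<subseteq> Z"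
    and L: "\<And>i. L i \<in> {0..T}" and cost: "\<And>i. line_integral (L i) (\<gamma> i) \<rho> \<le> c i" "c \<longlonglongrightarrow> c'"
  obtains r :: "nat \<Rightarrow> nat" and \<delta> M where "strict_mono r" "1-lipschitz_on UNIV \<delta>" "range \<delta> \<subseteq> Z"
    "\<And>t. (\<lambda>i. \<gamma> (r i) t) \<longlonglongrightarrow> \<delta> t" "(\<lambda>i. L (r i)) \<longlonglongrightarrow> M" "M \<in> {0..T}" "line_integral M \<delta> \<rho> \<le> c'"
proof -
  obtain r1 \<delta> where r1: "strict_mono r1" "1-lipschitz_on UNIV \<delta>" "range \<delta> \<subseteq> Z"
      "\<And>t. (\<lambda>i. \<gamma> (r1 i) t) \<longlonglongrightarrow> \<delta> t"
    by (rule lipschitz_curves_convergent_subsequence[OF compact_Z lip rng]) (rule that)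
  have "\<forall>i. L (r1 i) \<in> {0..T}" using L by blast
  then obtain M r2 where M: "M \<in> {0..T}" "strict_mono r2" "((\<lambda>i. L (r1 i)) \<circ> r2) \<longlonglongrightarrow> M"
    using compact_Icc[of 0 T] unfolding compact_def by meson
  define r where "r = r1 \<circ> r2"
  have r: "strict_mono r" using r1(1) M(2) by (simp add: r_def strict_mono_o)
  have lim: "(\<lambda>i. \<gamma> (r i) t) \<longlonglongrightarrow> \<delta> t" for t
    using LIMSEQ_subseq_LIMSEQ[OF r1(4) M(2)] by (simp add: r_def o_def)
  have LM: "(\<lambda>i. L (r i)) \<longlonglongrightarrow> M" using M(3) by (simp add: r_def o_def)
  have [measurable]: "\<gamma> i \<in> borel_measurable borel" "\<delta> \<in> borel_measurable borel" for i
    using lip r1(2) by (auto intro: borel_measurable_lipschitz)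
  \<comment> \<open>The end point \<open>M\<close> is dropped, since only \<open>t < M\<close> is
    sure to lie in \<open>{0..L (r i)}\<close> for large \<open>i\<close>.\<close>
  have "line_integral M \<delta> \<rho> = (\<integral>\<^sup>+t\<in>{0..<M}. \<rho> (\<delta> t) \<partial>lborel)"
    unfolding line_integral_def
    by (intro nn_integral_cong_AE eventually_mono[OF AE_lborel_singleton[of M]]) (auto split: split_indicator)
  also have "\<dots> \<le> (\<integral>\<^sup>+t. liminf (\<lambda>i. \<rho> (\<gamma> (r i) t) * indicator {0..L (r i)} t) \<partial>lborel)"
  proof (rule nn_integral_mono)
    fix t
    show "\<rho> (\<delta> t) * indicator {0..<M} t \<le> liminf (\<lambda>i. \<rho> (\<gamma> (r i) t) * indicator {0..L (r i)} t)"
    proof (cases "t \<in> {0..<M}")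
      case True
      have "\<rho> (\<delta> t) \<le> liminf (\<lambda>i. \<rho> (\<gamma> (r i) t) * indicator {0..L (r i)} t)"
        unfolding le_Liminf_iff
      proof (intro allI impI)
        fix y assume "y < \<rho> (\<delta> t)"
        then have "eventually (\<lambda>i. \<gamma> (r i) t \<in> {z. y < \<rho> z}) sequentially"
          by (intro topological_tendstoD[OF lim lsc]) simp
        moreover have "eventually (\<lambda>i. t < L (r i)) sequentially"
          by (rule order_tendstoD(1)[OF LM]) (use True in auto)
        ultimately show "eventually (\<lambda>i. y < \<rho> (\<gamma> (r i) t) * indicator {0..L (r i)} t) sequentially"
          by eventually_elim (use True in auto)
      qed
      then show ?thesis using True by simp
    qed simp
  qed
  also have "\<dots> \<le> liminf (\<lambda>i. \<integral>\<^sup>+t. \<rho> (\<gamma> (r i) t) * indicator {0..L (r i)} t \<partial>lborel)"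
    by (rule nn_integral_liminf) simp
  also have "\<dots> \<le> liminf (\<lambda>i. c (r i))"
    using cost by (intro Liminf_mono) (simp add: line_integral_def)
  also have "\<dots> = c'"
    using LIMSEQ_subseq_LIMSEQ[OF cost(2) r] by (intro lim_imp_Liminf) (auto simp: o_def)
  finally show ?thesis using that[OF r r1(2,3) lim LM M(1)] by blast
qed

lemma reach_refl: "x \<in> Z \<Longrightarrow> reach t x x"
  unfolding reach_def by (rule exI[of _ "\<lambda>_. x"], rule exI[of _ 0])
    (auto simp: line_integral_def lipschitz_on_def nn_integral_0_iff_AE intro!: eventually_mono[OF AE_lborel_singleton[of 0]])

lemma reach_mono: "reach s x y \<Longrightarrow> s \<le> t \<Longrightarrow> reach t x y"
  unfolding reach_def using order_trans[OF _ ennreal_leI[of s t]] by blast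

lemma reach_sym:
  assumes "reach t x y" shows "reach t y x"
proof -
  obtain \<gamma> L where "0 \<le> L" and lip: "1-lipschitz_on UNIV \<gamma>" and *: "range \<gamma> \<subseteq> Z" "\<gamma> 0 = x" "\<gamma> L = y"
      "line_integral L \<gamma> \<rho> \<le> ennreal t"
    using assms unfolding reach_def by blast
  note lipschitz_on_reverse[OF lip, of L]
  then show ?thesis
    unfolding reach_def
    by (intro exI[of _ "\<lambda>t. \<gamma> (L - t)"] exI[of _ L])
       (use * \<open>0 \<le> L\<close> in \<open>auto simp: line_integral_reverse borel_measurable_lipschitz[OF lip]\<close>)
qed

lemma reach_trans:
  assumes "reach s x y" "reach t y z" "0 \<le> s" "0 \<le> t" shows "reach (s + t) x z"
proof -
  obtain \<gamma> L where 1: "0 \<le> L" "1-lipschitz_on UNIV \<gamma>" "range \<gamma> \<subseteq> Z" "\<gamma> 0 = x" "\<gamma> L = y"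
      "line_integral L \<gamma> \<rho> \<le> ennreal s"
    using assms(1) unfolding reach_def by blast
  obtain \<gamma>' M where 2: "0 \<le> M" "1-lipschitz_on UNIV \<gamma>'" "range \<gamma>' \<subseteq> Z" "\<gamma>' 0 = y" "\<gamma>' M = z"
      "line_integral M \<gamma>' \<rho> \<le> ennreal t"
    using assms(2) unfolding reach_def by blast
  have "line_integral (L + M) (concat_curve L \<gamma> \<gamma>') \<rho> \<le> line_integral L \<gamma> \<rho> + line_integral M \<gamma>' \<rho>"
    using 1 2 by (intro line_integral_concat_curve_le) (auto intro: borel_measurable_lipschitz)
  also have "\<dots> \<le> ennreal (s + t)" using 1 2 assms by (simp add: ennreal_plus add_mono)
  finally show ?thesis
    unfolding reach_def using 1 2 lipschitz_on_concat_curve[of \<gamma> \<gamma>' L]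
    by (intro exI[of _ "concat_curve L \<gamma> \<gamma>'"] exI[of _ "L + M"]) (auto simp: concat_curve_def)
qed

lemma reach_dist_le:
  assumes "reach t x y" "0 \<le> t" shows "dist x y \<le> t"
proof -
  obtain \<gamma> L where *: "0 \<le> L" "1-lipschitz_on UNIV \<gamma>" "\<gamma> 0 = x" "\<gamma> L = y"
      "line_integral L \<gamma> \<rho> \<le> ennreal t"
    using assms unfolding reach_def by blast
  have "ennreal L \<le> ennreal t" using length_le_line_integral *(5) order_trans by blast
  then show ?thesis using lipschitz_onD[OF *(2), of 0 L] * assms by simp
qed

text \<open>The end points move with the lengths \<open>L i\<close> as well as with the curves; the
  common Lipschitz constant reduces their convergence to that of \<open>L i\<close> and of the
  curves at the single parameter \<open>M\<close>.\<close>

lemma reach_closed: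
  assumes "\<And>i. reach (t i) (x i) (y i)" "x \<longlonglongrightarrow> x'" "y \<longlonglongrightarrow> y'" "t \<longlonglongrightarrow> t'"
  shows "reach t' x' y'"
proof -
  obtain \<gamma> L where *: "\<And>i. 0 \<le> L i" "\<And>i. 1-lipschitz_on UNIV (\<gamma> i)" "\<And>i. range (\<gamma> i) \<subseteq> Z"
     "\<And>i. \<gamma> i 0 = x i" "\<And>i. \<gamma> i (L i) = y i" "\<And>i. line_integral (L i) (\<gamma> i) \<rho> \<le> ennreal (t i)"
    using assms(1) unfolding reach_def by metis
  obtain T where T: "\<And>i. \<bar>t i\<bar> \<le> T"
    using convergent_imp_Bseq[OF convergentI[OF assms(4)]] by (auto simp: Bseq_def)
  have "ennreal (L i) \<le> ennreal T" for i
    using length_le_line_integral[of "L i" "\<gamma> i"] *(6)[of i] T[of i]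
    by (meson abs_le_D1 ennreal_leI order_trans)
  then have L: "L i \<in> {0..T}" for i using *(1)[of i] T[of i] by simp
  have "(\<lambda>i. ennreal (t i)) \<longlonglongrightarrow> ennreal t'" using assms(4) by (rule tendsto_ennrealI)
  then obtain r \<delta> M where r: "strict_mono r" "1-lipschitz_on UNIV \<delta>" "range \<delta> \<subseteq> Z"
    "\<And>t. (\<lambda>i. \<gamma> (r i) t) \<longlonglongrightarrow> \<delta> t" "(\<lambda>i. L (r i)) \<longlonglongrightarrow> M" "M \<in> {0..T}"
    "line_integral M \<delta> \<rho> \<le> ennreal t'"
    using limit_curve[of \<gamma> L, OF *(2,3) L *(6)] by blast
  have "\<delta> 0 = x'"
    using r(4)[of 0] LIMSEQ_subseq_LIMSEQ[OF assms(2) r(1)] *(4) LIMSEQ_unique by (fastforce simp: o_def)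
  have "(\<lambda>i. y (r i)) \<longlonglongrightarrow> y'"
    using LIMSEQ_subseq_LIMSEQ[OF assms(3) r(1)] by (simp add: o_def)
  moreover have "(\<lambda>i. \<gamma> (r i) (L (r i))) \<longlonglongrightarrow> \<delta> M"
  proof (rule iffD2[OF tendsto_dist_iff])
    have "(\<lambda>i. dist (L (r i)) M + dist (\<gamma> (r i) M) (\<delta> M)) \<longlonglongrightarrow> 0 + 0"
      using r(5) r(4)[of M] by (intro tendsto_add) (auto simp: tendsto_dist_iff[symmetric])
    then have "(\<lambda>i. dist (L (r i)) M + dist (\<gamma> (r i) M) (\<delta> M)) \<longlonglongrightarrow> 0" by simp
    then show "(\<lambda>i. dist (\<gamma> (r i) (L (r i))) (\<delta> M)) \<longlonglongrightarrow> 0"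
    proof (rule Lim_null_comparison[rotated], intro always_eventually allI)
      fix i
      show "norm (dist (\<gamma> (r i) (L (r i))) (\<delta> M)) \<le> dist (L (r i)) M + dist (\<gamma> (r i) M) (\<delta> M)"
        using lipschitz_onD[OF *(2), of "L (r i)" M "r i"] dist_triangle[of "\<gamma> (r i) (L (r i))" "\<delta> M" "\<gamma> (r i) M"]
        by simp
    qed
  qed
  ultimately have "\<delta> M = y'" using *(5) LIMSEQ_unique by fastforce
  then show ?thesis unfolding reach_def using r \<open>\<delta> 0 = x'\<close> by (intro exI[of _ \<delta>] exI[of _ M]) auto
qed

end

section \<open>Cheap curves that start in X\<close>

lemma curve_length_isometry:
  assumes "\<And>s t. s \<in> {a..b} \<Longrightarrow> t \<in> {a..b} \<Longrightarrow> dist (\<gamma> s) (\<gamma> t) = dist (\<gamma>' s) (\<gamma>' t)"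
  shows "curve_length \<gamma> a b = curve_length \<gamma>' a b"
  unfolding curve_length_def
  by (intro SUP_cong refl) (auto intro!: sum.cong simp: assms image_subset_iff)

lemma arc_length_curve_mono: "arc_length_curve S l \<gamma> \<Longrightarrow> S \<subseteq> S' \<Longrightarrow> arc_length_curve S' l \<gamma>"
  by (auto simp: arc_length_curve_def)

context cost_space
begin

lemma reach_segment:
  fixes a b :: real
  assumes lip: "1-lipschitz_on {a..b} \<gamma>" and "a \<le> b" and Z: "\<gamma> ` {a..b} \<subseteq> Z"
    and le: "(\<integral>\<^sup>+t\<in>{a..b}. \<rho> (\<gamma> t) \<partial>lborel) \<le> ennreal c"
  shows "reach c (\<gamma> a) (\<gamma> b)"
proof -
  define \<eta> where "\<eta> t = \<gamma> (max a (min b t))" for t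
  have \<eta>: "1-lipschitz_on UNIV \<eta>" unfolding \<eta>_def by (rule lipschitz_on_clamp[OF lip \<open>a \<le> b\<close>])
  have "1-lipschitz_on UNIV (\<lambda>t. \<eta> (t + a))"
  proof (rule lipschitz_onI)
    fix s t show "dist (\<eta> (s + a)) (\<eta> (t + a)) \<le> 1 * dist s t"
      using lipschitz_onD[OF \<eta>, of "s + a" "t + a"] by (simp add: dist_real_def)
  qed simp
  moreover have "line_integral (b - a) (\<lambda>t. \<eta> (t + a)) \<rho> \<le> ennreal c"
  proof -
    have "line_integral (b - a) (\<lambda>t. \<eta> (t + a)) \<rho> = (\<integral>\<^sup>+t\<in>{a..b}. \<rho> (\<eta> t) \<partial>lborel)"
      by (rule line_integral_shift) (auto intro: borel_measurable_lipschitz[OF \<eta>])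
    also have "\<dots> = (\<integral>\<^sup>+t\<in>{a..b}. \<rho> (\<gamma> t) \<partial>lborel)"
      by (intro nn_integral_cong) (auto simp: \<eta>_def split: split_indicator)
    finally show ?thesis using le by simp
  qed
  moreover have "range (\<lambda>t. \<eta> (t + a)) \<subseteq> Z" using Z \<open>a \<le> b\<close> by (auto simp: \<eta>_def)
  ultimately show ?thesis
    unfolding reach_def using \<open>a \<le> b\<close>
    by (intro exI[of _ "\<lambda>t. \<eta> (t + a)"] exI[of _ "b - a"]) (auto simp: \<eta>_def)
qed

text \<open>Pairs from a compact subset of the product have jointly convergent subsequences, so
  \<open>reach_closed\<close> applies to both end points at once. The pairs in view are those
  between which \<open>h\<close> jumps.\<close>

lemma closed_reach_set:
  assumes "compact K"
  shows "closed {x. \<exists>(a, b)\<in>K. reach t x a \<and> reach t x b}"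
  unfolding closed_sequential_limits
proof (intro allI impI, elim conjE)
  fix x l assume x: "\<forall>n. x n \<in> {x. \<exists>(a, b)\<in>K. reach t x a \<and> reach t x b}" "x \<longlonglongrightarrow> l"
  then have "\<forall>n. \<exists>ab. ab \<in> K \<and> reach t (x n) (fst ab) \<and> reach t (x n) (snd ab)" by fastforce
  then obtain ab where ab: "\<And>n. ab n \<in> K \<and> reach t (x n) (fst (ab n)) \<and> reach t (x n) (snd (ab n))"
    by metis
  then have "\<forall>n. ab n \<in> K" by blast
  then obtain c r where c: "c \<in> K" "strict_mono r" "(ab \<circ> r) \<longlonglongrightarrow> c"
    using \<open>compact K\<close> unfolding compact_def by meson
  have xr: "(\<lambda>n. x (r n)) \<longlonglongrightarrow> l" using LIMSEQ_subseq_LIMSEQ[OF x(2) c(2)] by (simp add: o_def)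
  have "reach t l (fst c)"
    by (rule reach_closed[of "\<lambda>_. t" "\<lambda>n. x (r n)" "\<lambda>n. fst (ab (r n))"])
       (use ab xr tendsto_fst[OF c(3)] in \<open>auto simp: o_def\<close>)
  moreover have "reach t l (snd c)"
    by (rule reach_closed[of "\<lambda>_. t" "\<lambda>n. x (r n)" "\<lambda>n. snd (ab (r n))"])
       (use ab xr tendsto_snd[OF c(3)] in \<open>auto simp: o_def\<close>)
  ultimately show "l \<in> {x. \<exists>(a, b)\<in>K. reach t x a \<and> reach t x b}" using c(1) by (auto intro!: bexI[of _ c])
qed

lemma closed_reach_from:
  assumes "compact K"
  shows "closed {x. \<exists>y\<in>K. reach t x y}"
proof -
  have "compact ((\<lambda>y. (y, y)) ` K)"
    using assms by (intro compact_continuous_image continuous_intros)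
  from closed_reach_set[OF this, of t] show ?thesis by simp
qed

text \<open>
  Otherwise there are curves of cost at most \<open>2\<^sup>-\<^sup>n\<close> from \<open>x\<close> to points outside \<open>X\<close>.  Running
  through each of them back and forth, one after the other, gives a curve of finite cost that
  ends at \<open>x\<close> and leaves \<open>X\<close> arbitrarily close to its end.
\<close>

lemma cheap_curves_stay:
  assumes path_open: "\<And>l \<sigma>. arc_length_curve UNIV l \<sigma> \<Longrightarrow> line_integral l \<sigma> \<rho> < \<infinity> \<Longrightarrow>
      openin (top_of_set {0..l}) {t \<in> {0..l}. \<sigma> t \<in> X}"
    and "x \<in> X" "x \<in> Z"
  obtains w :: real where "0 < w"
    "\<And>t \<gamma> L. t < w \<Longrightarrow> 0 \<le> L \<Longrightarrow> 1-lipschitz_on UNIV \<gamma> \<Longrightarrow> range \<gamma> \<subseteq> Z \<Longrightarrow> \<gamma> 0 = x \<Longrightarrow>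
      line_integral L \<gamma> \<rho> \<le> ennreal t \<Longrightarrow> \<gamma> ` {0..L} \<subseteq> X"
proof (rule ccontr)
  assume neg: "\<not> thesis"
  \<comment> \<open>A curve that leaves X is cut off at a parameter where it is outside X; its cost
    does not grow, so the bad curves may be assumed to end outside X.\<close>
  have "\<exists>\<gamma> L. 0 \<le> L \<and> 1-lipschitz_on UNIV \<gamma> \<and> range \<gamma> \<subseteq> Z \<and> \<gamma> 0 = x \<and>
      line_integral L \<gamma> \<rho> \<le> ennreal ((1/2)^n) \<and> \<gamma> L \<notin> X" for n :: nat
  proof (rule ccontr)
    assume *: "\<not> ?thesis"
    have "\<gamma> ` {0..L} \<subseteq> X" if "t < (1/2)^n" "1-lipschitz_on UNIV \<gamma>" "range \<gamma> \<subseteq> Z" "\<gamma> 0 = x"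
      "line_integral L \<gamma> \<rho> \<le> ennreal t" for t \<gamma> L
    proof (intro image_subsetI)
      fix t' assume t': "t' \<in> {0..L}"
      have "line_integral t' \<gamma> \<rho> \<le> line_integral L \<gamma> \<rho>" using t' by (intro line_integral_mono) auto
      also have "\<dots> \<le> ennreal ((1/2)^n)" using that(1,5) by (meson ennreal_leI less_imp_le order_trans)
      finally show "\<gamma> t' \<in> X" using * that t' by auto
    qed
    then show False using neg that[of "(1/2)^n"] by simp
  qed
  then have "\<forall>n::nat. \<exists>c. 0 \<le> snd c \<and> 1-lipschitz_on UNIV (fst c) \<and> range (fst c) \<subseteq> Z \<and> fst c 0 = x \<and>
      line_integral (snd c) (fst c) \<rho> \<le> ennreal ((1/2)^n) \<and> fst c (snd c) \<notin> X"
    by simp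
  from choice[OF this] obtain c where c: "\<And>n::nat. 0 \<le> snd (c n) \<and> 1-lipschitz_on UNIV (fst (c n)) \<and>
      range (fst (c n)) \<subseteq> Z \<and> fst (c n) 0 = x \<and>
      line_integral (snd (c n)) (fst (c n)) \<rho> \<le> ennreal ((1/2)^n) \<and> fst (c n) (snd (c n)) \<notin> X"
    by blast
  define \<gamma> where "\<gamma> n = fst (c n)" for n
  define L where "L n = snd (c n)" for n
  have \<gamma>: "\<And>n. 0 \<le> L n" "\<And>n. 1-lipschitz_on UNIV (\<gamma> n)" "\<And>n. range (\<gamma> n) \<subseteq> Z"
    "\<And>n. \<gamma> n 0 = x" "\<And>n. line_integral (L n) (\<gamma> n) \<rho> \<le> ennreal ((1/2)^n)" "\<And>n. \<gamma> n (L n) \<notin> X"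
    using c by (simp_all add: \<gamma>_def L_def)
  have L_pos: "0 < L n" for n using \<gamma>(1,4,6)[of n] \<open>x \<in> X\<close> by (cases "L n = 0") auto
  have L_le: "L n \<le> (1/2)^n" for n
  proof -
    have "ennreal (L n) \<le> ennreal ((1/2)^n)" using length_le_line_integral \<gamma>(5) by (rule order_trans)
    then show ?thesis by simp
  qed
  define loop where "loop n = concat_curve (L n) (\<gamma> n) (\<lambda>t. \<gamma> n (L n - t))" for n
  note rev = lipschitz_on_reverse[OF \<gamma>(2)]
  have loop: "1-lipschitz_on UNIV (loop n)" "range (loop n) \<subseteq> Z" "loop n 0 = x" "loop n (2 * L n) = x"
    "loop n (L n) = \<gamma> n (L n)" for n
    subgoal unfolding loop_def using \<gamma>(2) rev by (rule lipschitz_on_concat_curve) simp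
    using \<gamma>(3,4)[of n] L_pos[of n] by (auto simp: loop_def concat_curve_def)
  have loop_cost: "line_integral (2 * L n) (loop n) \<rho> \<le> ennreal (2 * (1/2)^n)" for n
  proof -
    have "line_integral (L n + L n) (loop n) \<rho> \<le> line_integral (L n) (\<gamma> n) \<rho> + line_integral (L n) (\<lambda>t. \<gamma> n (L n - t)) \<rho>"
      unfolding loop_def using L_pos[of n] \<gamma>(2) rev
      by (intro line_integral_concat_curve_le) (auto intro: borel_measurable_lipschitz)
    also have "\<dots> = line_integral (L n) (\<gamma> n) \<rho> + line_integral (L n) (\<gamma> n) \<rho>"
      using \<gamma>(2) by (subst line_integral_reverse) (auto intro: borel_measurable_lipschitz)
    also have "\<dots> \<le> ennreal ((1/2)^n) + ennreal ((1/2)^n)" using \<gamma>(5) by (intro add_mono)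
    also have "\<dots> = ennreal (2 * (1/2)^n)" by (subst ennreal_plus[symmetric]) simp_all
    finally show ?thesis by (simp only: mult_2)
  qed
  define a where "a N = (\<Sum>k<N. 2 * L k)" for N
  \<comment> \<open>\<open>\<alpha> N\<close> runs through the first \<open>N\<close> loops and
    agrees with all later ones up to parameter \<open>a N\<close> (see \<open>stable\<close>). A
    limit curve obtained by compactness can therefore replace the infinite concatenation. The costs
    sum to at most 4, since loop \<open>k\<close> costs at most \<open>2 * (1/2)^k\<close>.\<close>
  define \<alpha> where "\<alpha> = rec_nat (\<lambda>_. x) (\<lambda>N \<beta>. concat_curve (a N) \<beta> (loop N))"
  have \<alpha>_simps: "\<alpha> 0 = (\<lambda>_. x)" "\<And>N. \<alpha> (Suc N) = concat_curve (a N) (\<alpha> N) (loop N)"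
    by (simp_all add: \<alpha>_def)
  have a_Suc: "a (Suc N) = a N + 2 * L N" and a0: "a 0 = 0" for N by (simp_all add: a_def)
  have a_nonneg: "0 \<le> a N" for N using \<gamma>(1) by (auto simp: a_def intro!: sum_nonneg)
  have "incseq a" by (rule incseq_SucI) (use \<gamma>(1) a_Suc in auto)
  have geo: "(\<Sum>k<N. 2 * (1/2)^k) \<le> (4::real)" for N
  proof -
    have "(\<Sum>k<N. 2 * (1/2)^k) = 4 - 4 * (1/2::real)^N" by (induction N) (auto simp: field_simps)
    then show ?thesis by simp
  qed
  have a_le: "a N \<le> 4" for N
  proof -
    have "a N \<le> (\<Sum>k<N. 2 * (1/2)^k)" unfolding a_def using L_le by (intro sum_mono) auto
    then show ?thesis using geo[of N] by linarith
  qed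
  have \<alpha>: "1-lipschitz_on UNIV (\<alpha> N) \<and> range (\<alpha> N) \<subseteq> Z \<and> \<alpha> N (a N) = x \<and> \<alpha> N 0 = x \<and>
      line_integral (a N) (\<alpha> N) \<rho> \<le> ennreal (\<Sum>k<N. 2 * (1/2)^k)" for N
  proof (induction N)
    case 0
    have "line_integral 0 (\<lambda>_. x) \<rho> = 0"
      unfolding line_integral_def
      by (subst nn_integral_0_iff_AE) (auto intro!: eventually_mono[OF AE_lborel_singleton[of 0]])
    then show ?case using \<open>x \<in> Z\<close> by (simp add: \<alpha>_simps a0 lipschitz_on_def)
  next
    case (Suc N)
    have "line_integral (a N + 2 * L N) (\<alpha> (Suc N)) \<rho> \<le> line_integral (a N) (\<alpha> N) \<rho> + line_integral (2 * L N) (loop N) \<rho>"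
      unfolding \<alpha>_simps using Suc loop(1)[of N] a_nonneg[of N] \<gamma>(1)[of N]
      by (intro line_integral_concat_curve_le) (auto intro: borel_measurable_lipschitz)
    also have "\<dots> \<le> ennreal (\<Sum>k<N. 2 * (1/2)^k) + ennreal (2 * (1/2)^N)"
      using Suc loop_cost[of N] by (intro add_mono) auto
    also have "\<dots> = ennreal (\<Sum>k<Suc N. 2 * (1/2)^k)" by (subst ennreal_plus[symmetric]) (auto simp: sum_nonneg)
    finally have "line_integral (a (Suc N)) (\<alpha> (Suc N)) \<rho> \<le> ennreal (\<Sum>k<Suc N. 2 * (1/2)^k)" by (simp add: a_Suc)
    moreover have "1-lipschitz_on UNIV (\<alpha> (Suc N))"
      unfolding \<alpha>_simps using Suc loop(1,3)[of N] by (intro lipschitz_on_concat_curve) auto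
    moreover have "range (\<alpha> (Suc N)) \<subseteq> Z" using Suc loop(2)[of N] by (auto simp: \<alpha>_simps concat_curve_def)
    moreover have "\<alpha> (Suc N) (a (Suc N)) = x"
      using loop(4)[of N] L_pos[of N] by (auto simp: \<alpha>_simps concat_curve_def a_Suc)
    moreover have "\<alpha> (Suc N) 0 = x" using Suc a_nonneg[of N] by (simp add: \<alpha>_simps concat_curve_def)
    ultimately show ?case by blast
  qed
  have stable: "\<alpha> M t = \<alpha> N t" if "N \<le> M" "t \<le> a N" for M N t
    using that
  proof (induction M rule: dec_induct)
    case (step M)
    then have "t \<le> a M" using incseqD[OF \<open>incseq a\<close>, of N M] by linarith
    then show ?case using step by (simp add: \<alpha>_simps concat_curve_def)
  qed simp
  have cost4: "line_integral (a N) (\<alpha> N) \<rho> \<le> ennreal 4" for N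
    using \<alpha>[of N] geo[of N] by (meson ennreal_leI order_trans)
  obtain r \<delta> M where r: "strict_mono r" "1-lipschitz_on UNIV \<delta>" "range \<delta> \<subseteq> Z"
    "\<And>t. (\<lambda>i. \<alpha> (r i) t) \<longlonglongrightarrow> \<delta> t" "(\<lambda>i. a (r i)) \<longlonglongrightarrow> M" "M \<in> {0..4}"
    "line_integral M \<delta> \<rho> \<le> ennreal 4"
    by (rule limit_curve[of \<alpha> a 4 "\<lambda>_. ennreal 4" "ennreal 4"])
       (use \<alpha> a_nonneg a_le cost4 in \<open>auto\<close>)
  have a_lim: "a \<longlonglongrightarrow> M"
  proof -
    obtain M' where "a \<longlonglongrightarrow> M'" using incseq_convergent[OF \<open>incseq a\<close>] a_le by blast
    moreover from LIMSEQ_subseq_LIMSEQ[OF this r(1)] have "M' = M" using r(5) LIMSEQ_unique by (auto simp: o_def)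
    ultimately show ?thesis by simp
  qed
  have a_M: "a N \<le> M" for N using incseq_le[OF \<open>incseq a\<close> a_lim] .
  \<comment> \<open>The turning point of loop \<open>n\<close>, where the curve is outside
    X.\<close>
  define t where "t n = a n + L n" for n
  have t: "a n \<le> t n" "t n \<le> a (Suc n)" "0 \<le> t n" "t n \<le> M" for n
    using \<gamma>(1)[of n] a_Suc[of n] a_M[of "Suc n"] a_nonneg[of n] by (auto simp: t_def)
  have \<delta>t: "\<delta> (t n) \<notin> X" for n
  proof -
    have "eventually (\<lambda>i. \<alpha> (r i) (t n) = \<gamma> n (L n)) sequentially"
      unfolding eventually_sequentially
    proof (intro exI allI impI)
      fix i assume "Suc n \<le> i"
      then have "Suc n \<le> r i" using seq_suble[OF r(1), of i] by linarith
      then have "\<alpha> (r i) (t n) = \<alpha> (Suc n) (t n)" using t(2) by (rule stable)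
      also have "\<dots> = \<gamma> n (L n)" using L_pos[of n] loop(5)[of n] by (simp add: \<alpha>_simps concat_curve_def t_def)
      finally show "\<alpha> (r i) (t n) = \<gamma> n (L n)" .
    qed
    then have "(\<lambda>i. \<alpha> (r i) (t n)) \<longlonglongrightarrow> \<gamma> n (L n)" by (rule tendsto_eventually)
    then have "\<delta> (t n) = \<gamma> n (L n)" using r(4) LIMSEQ_unique by blast
    then show ?thesis using \<gamma>(6) by simp
  qed
  have "(\<lambda>i. \<alpha> (r i) 0) \<longlonglongrightarrow> x" using \<alpha> by simp
  then have \<delta>0: "\<delta> 0 = x" using r(4) LIMSEQ_unique by blast
  have \<delta>M: "\<delta> M = x"
  proof -
    have "(\<lambda>i. dist (\<alpha> (r i) M) x) \<longlonglongrightarrow> 0"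
    proof (rule Lim_null_comparison)
      show "(\<lambda>i. dist M (a (r i))) \<longlonglongrightarrow> 0" using tendsto_dist[OF tendsto_const r(5), of M] by simp
      show "\<forall>\<^sub>F i in sequentially. norm (dist (\<alpha> (r i) M) x) \<le> dist M (a (r i))"
      proof (intro always_eventually allI)
        fix i
        have "dist (\<alpha> (r i) M) (\<alpha> (r i) (a (r i))) \<le> 1 * dist M (a (r i))"
          using \<alpha>[of "r i"] by (intro lipschitz_onD[of 1 UNIV]) auto
        then show "norm (dist (\<alpha> (r i) M) x) \<le> dist M (a (r i))" using \<alpha>[of "r i"] by simp
      qed
    qed
    then have "(\<lambda>i. \<alpha> (r i) M) \<longlonglongrightarrow> x" using tendsto_dist_iff by blast
    then show ?thesis using r(4) LIMSEQ_unique by blast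
  qed
  have "\<delta> (t 0) \<noteq> \<delta> 0" using \<delta>t[of 0] \<delta>0 \<open>x \<in> X\<close> by auto
  then obtain l \<sigma> s where s: "arc_length_curve (\<delta> ` {0..M}) l \<sigma>"
    "1-lipschitz_on UNIV s" "mono s" "s 0 = 0" "s M = l"
    "\<And>t. t \<in> {0..M} \<Longrightarrow> \<sigma> (s t) = \<delta> t"
    "\<And>f. f \<in> borel_measurable borel \<Longrightarrow> line_integral l \<sigma> f \<le> line_integral M \<delta> f"
    using arc_length_reparametrization[OF r(2), of M "t 0"] t[of 0] r(6) by auto
  have "line_integral l \<sigma> \<rho> < \<infinity>"
    using s(7)[OF rho_measurable] r(7) by (simp add: order_le_less_trans)
  \<comment> \<open>Openness is used at the end parameter \<open>l\<close>, where \<sigma> is back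
    at \<open>x\<close>; the arc-length parameters of the turning points tend to
    \<open>l\<close>.\<close>
  then have "openin (top_of_set {0..l}) {t \<in> {0..l}. \<sigma> t \<in> X}"
    using path_open arc_length_curve_mono[OF s(1)] by blast
  moreover have "l \<in> {t \<in> {0..l}. \<sigma> t \<in> X}"
    using s(1) s(6)[of M] \<delta>M s(5) r(6) \<open>x \<in> X\<close> by (auto simp: arc_length_curve_def)
  ultimately obtain e where e: "e > 0" "\<And>t. t \<in> {0..l} \<Longrightarrow> dist t l < e \<Longrightarrow> \<sigma> t \<in> X"
    unfolding openin_euclidean_subtopology_iff by blast
  obtain n where "dist (a n) M < e" using a_lim \<open>e > 0\<close> metric_LIMSEQ_D by blast
  then have "dist (t n) M < e" using t(1,4)[of n] by (simp add: dist_real_def)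
  then have "dist (s (t n)) l < e"
    using lipschitz_onD[OF s(2), of "t n" M] s(5) by simp
  moreover have "s (t n) \<in> {0..l}" using monoD[OF s(3), of 0 "t n"] monoD[OF s(3), of "t n" M] s(4,5) t(3,4)[of n] by auto
  ultimately have "\<delta> (t n) \<in> X" using e(2)[of "s (t n)"] s(6)[of "t n"] t(3,4)[of n] by simp
  then show False using \<delta>t by blast
qed

text \<open>Below the threshold of \<open>cheap_curves_stay\<close> a curve lies in the image of
  \<iota>, so it can be pulled back, with equal lengths, to an arc-length curve in \<open>B\<close>,
  where \<open>g\<close> controls \<open>u\<close>. The alternative \<open>x' = x\<close> cannot be
  merged with the estimate: \<open>ereal_gap (u x) (u x)\<close> is infinite when \<open>u x\<close>
  is.\<close>

lemma reach_local:
  fixes \<iota> :: "'a::metric_space \<Rightarrow> 'b" and u :: "'a \<Rightarrow> ereal"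
  assumes isom: "\<And>x y. dist (\<iota> x) (\<iota> y) = dist x y"
    and path_open: "\<And>l \<sigma>. arc_length_curve UNIV l \<sigma> \<Longrightarrow> line_integral l \<sigma> \<rho> < \<infinity> \<Longrightarrow>
      openin (top_of_set {0..l}) {t \<in> {0..l}. \<sigma> t \<in> range \<iota>}"
    and ug: "upper_gradient B u g" and g: "\<And>x. x \<in> B \<Longrightarrow> g x \<le> \<rho> (\<iota> x)"
    and BZ: "\<iota> -` Z \<subseteq> B" and x: "\<iota> x \<in> Z"
  obtains w :: real where "0 < w"
    "\<And>t y. t < w \<Longrightarrow> reach t (\<iota> x) y \<Longrightarrow> \<exists>x'. y = \<iota> x' \<and> (x' = x \<or> ereal_gap (u x) (u x') \<le> ennreal t)"
proof -
  obtain w :: real where w: "0 < w"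
    "\<And>t \<gamma> L. t < w \<Longrightarrow> 0 \<le> L \<Longrightarrow> 1-lipschitz_on UNIV \<gamma> \<Longrightarrow> range \<gamma> \<subseteq> Z \<Longrightarrow> \<gamma> 0 = \<iota> x \<Longrightarrow>
      line_integral L \<gamma> \<rho> \<le> ennreal t \<Longrightarrow> \<gamma> ` {0..L} \<subseteq> range \<iota>"
    using cheap_curves_stay[OF path_open rangeI x] by blast
  have inj: "\<iota> a = \<iota> b \<longleftrightarrow> a = b" for a b using isom[of a b] by (metis dist_eq_0_iff)
  have "\<exists>x'. y = \<iota> x' \<and> (x' = x \<or> ereal_gap (u x) (u x') \<le> ennreal t)" if "t < w" "reach t (\<iota> x) y" for t y
  proof -
    obtain \<gamma> L where \<gamma>: "0 \<le> L" "1-lipschitz_on UNIV \<gamma>" "range \<gamma> \<subseteq> Z" "\<gamma> 0 = \<iota> x" "\<gamma> L = y"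
      "line_integral L \<gamma> \<rho> \<le> ennreal t" using \<open>reach t (\<iota> x) y\<close> unfolding reach_def by blast
    have X: "\<gamma> ` {0..L} \<subseteq> range \<iota>" using w(2)[OF \<open>t < w\<close> \<gamma>(1,2,3,4,6)] .
    show ?thesis
    proof (cases "y = \<iota> x")
      case False
      then have "\<gamma> L \<noteq> \<gamma> 0" "L \<in> {0..L}" using \<gamma> by auto
      then obtain l \<sigma> s where s: "arc_length_curve (\<gamma> ` {0..L}) l \<sigma>" "s 0 = 0" "s L = l"
        "\<And>t. t \<in> {0..L} \<Longrightarrow> \<sigma> (s t) = \<gamma> t"
        "\<And>f. f \<in> borel_measurable borel \<Longrightarrow> line_integral l \<sigma> f \<le> line_integral L \<gamma> f"
        using arc_length_reparametrization[OF \<gamma>(2,1)] by metis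
      define \<kappa> where "\<kappa> t = inv \<iota> (\<sigma> t)" for t
      have \<kappa>: "\<iota> (\<kappa> t) = \<sigma> t" if "t \<in> {0..l}" for t
      proof -
        have "\<sigma> t \<in> range \<iota>" using s(1) X that unfolding arc_length_curve_def by blast
        then show ?thesis by (simp add: \<kappa>_def f_inv_into_f)
      qed
      have \<kappa>B: "\<kappa> t \<in> B" if "t \<in> {0..l}" for t
        using s(1) \<gamma>(3) \<kappa>[OF that] that BZ by (fastforce simp: arc_length_curve_def)
      have "curve_length \<kappa> a b = curve_length \<sigma> a b" if "0 \<le> a" "b \<le> l" for a b
        by (rule curve_length_isometry) (use that \<kappa> isom in \<open>metis atLeastAtMost_iff order_trans\<close>)
      then have arc: "arc_length_curve B l \<kappa>"
        using s(1) \<kappa>B by (auto simp: arc_length_curve_def)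
      have l: "0 \<in> {0..l}" "l \<in> {0..l}" using arc by (auto simp: arc_length_curve_def)
      have "\<iota> (\<kappa> 0) = \<iota> x" using \<kappa>[OF l(1)] s(4)[of 0] s(2) \<gamma>(1,4) by simp
      moreover have y: "\<iota> (\<kappa> l) = y" using \<kappa>[OF l(2)] s(4)[of L] s(3) \<gamma>(1,5) by simp
      ultimately have "ereal_gap (u x) (u (\<kappa> l)) \<le> line_integral l \<kappa> g"
        using ug arc unfolding upper_gradient_def inj by metis
      also have "\<dots> \<le> line_integral l \<sigma> \<rho>"
        by (rule line_integral_mono) (use g \<kappa>B \<kappa> in \<open>auto simp flip: \<kappa>\<close>)
      also have "\<dots> \<le> ennreal t" using s(5)[OF rho_measurable] \<gamma>(6) by (rule order_trans)
      finally show ?thesis using y by blast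
    qed auto
  qed
  with w(1) show ?thesis using that by blast
qed

end

subsection \<open>Finite Borel measures on metric spaces\<close>

lemma (in finite_measure) measure_countable_sum_le:
  assumes "range A \<subseteq> sets M" "\<And>i. measure M (A i) \<le> e * (1/2)^(Suc i)" "0 \<le> e"
  shows "measure M (\<Union>i. A i) \<le> e"
proof -
  have "(\<lambda>i. e * (1/2)^(Suc i)) sums (e * 1)" using power_half_series by (rule sums_mult)
  then have s: "summable (\<lambda>i. e * (1/2)^(Suc i))" "(\<Sum>i. e * (1/2)^(Suc i)) = e" by (auto simp: sums_iff)
  have sA: "summable (\<lambda>i. measure M (A i))"
    by (rule summable_comparison_test'[OF s(1), of 0]) (use assms in auto)
  have "measure M (\<Union>i. A i) \<le> (\<Sum>i. measure M (A i))"
    by (rule finite_measure_subadditive_countably[OF assms(1) sA])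
  also have "\<dots> \<le> (\<Sum>i. e * (1/2)^(Suc i))" by (rule suminf_le[OF assms(2) sA s(1)])
  finally show ?thesis using s(2) by linarith
qed

text \<open>Induction over the generation of the Borel sets: an open set is an increasing union of
  closed sets, complements exchange the two approximations, and in a countable union finitely many
  of the closed sets suffice by continuity from above.\<close>

lemma finite_borel_measure_regular:
  fixes N :: "'a::metric_space measure"
  assumes "finite_measure N" and sN: "sets N = sets borel" and "A \<in> sets borel" and "0 < e"
  shows "\<exists>C U. closed C \<and> open U \<and> C \<subseteq> A \<and> A \<subseteq> U \<and> measure N (U - C) < e"
proof -
  interpret finite_measure N by fact
  have space: "space N = UNIV" using sets_eq_imp_space_eq[OF sN] by simp
  have "A \<in> sigma_sets UNIV {S. open S}" using assms(3) by (simp add: borel_def)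
  then show ?thesis using \<open>0 < e\<close>
  proof (induction A arbitrary: e rule: sigma_sets.induct)
    case (Basic a)
    then have a: "open a" by simp
    show ?case
    \<comment> \<open>The whole space is separate because \<open>infdist\<close> to the empty set is
      0 by convention, which would make every \<open>C n\<close> empty.\<close>
    proof (cases "a = UNIV")
      case True
      then show ?thesis using Basic by (intro exI[of _ UNIV]) auto
    next
      case False
      define C where "C n = {x. inverse (real (Suc n)) \<le> infdist x (- a)}" for n
      have C: "closed (C n)" for n unfolding C_def by (intro closed_Collect_le continuous_intros)
      have sub: "C n \<subseteq> a" for n
      proof
        fix x assume "x \<in> C n"
        then have "0 < infdist x (- a)" unfolding C_def by (auto intro: less_le_trans[rotated])
        then show "x \<in> a" using infdist_zero[of x "- a"] by (metis ComplI less_irrefl)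
      qed
      have "\<exists>n. x \<in> C n" if "x \<in> a" for x
      proof -
        have "infdist x (- a) > 0"
          using infdist_pos_not_in_closed[of "- a" x] a False that by auto
        then show ?thesis unfolding C_def using reals_Archimedean[of "infdist x (- a)"] by (auto intro: less_imp_le)
      qed
      then have empty: "(\<Inter>n. a - C n) = {}" by blast
      have dec: "decseq (\<lambda>n. a - C n)"
      proof (rule decseq_SucI)
        fix n
        have le: "inverse (real (Suc (Suc n))) \<le> inverse (real (Suc n))" by (simp add: field_simps)
        show "a - C (Suc n) \<subseteq> a - C n" unfolding C_def using order_trans[OF le] by blast
      qed
      have "(\<lambda>n. measure N (a - C n)) \<longlonglongrightarrow> measure N (\<Inter>n. a - C n)"
        by (rule finite_Lim_measure_decseq[OF _ dec]) (use a C in \<open>auto simp: sN\<close>)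
      then have "(\<lambda>n. measure N (a - C n)) \<longlonglongrightarrow> 0" by (simp only: empty measure_empty)
      from eventually_happens'[OF sequentially_bot order_tendstoD(2)[OF this \<open>0 < e\<close>]]
      obtain n where "measure N (a - C n) < e" by (rule exE)
      then show ?thesis using a C sub by blast
    qed
  next
    case Empty
    then show ?case by (intro exI[of _ "{}"]) auto
  next
    case (Compl a)
    from Compl.IH[OF Compl.prems] obtain C U
      where "closed C" "open U" "C \<subseteq> a" "a \<subseteq> U" "measure N (U - C) < e" by (elim exE conjE)
    moreover have "- C - - U = U - C" by auto
    ultimately show ?case
      by (intro exI[of _ "- U"] exI[of _ "- C"]) (auto simp: Compl_eq_Diff_UNIV[symmetric])
  next
    case (Union a)
    have "\<forall>i. \<exists>CU. closed (fst CU) \<and> open (snd CU) \<and> fst CU \<subseteq> a i \<and> a i \<subseteq> snd CU \<and>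
        measure N (snd CU - fst CU) < e/2 * (1/2)^(Suc i)"
      using Union.IH[of "e/2 * (1/2)^(Suc i)" for i] \<open>0 < e\<close> by simp
    from choice[OF this] obtain CU where CU: "\<And>i. closed (fst (CU i)) \<and> open (snd (CU i)) \<and> fst (CU i) \<subseteq> a i \<and>
        a i \<subseteq> snd (CU i) \<and> measure N (snd (CU i) - fst (CU i)) < e/2 * (1/2)^(Suc i)" by blast
    define C where "C i = fst (CU i)" for i
    define U where "U i = snd (CU i)" for i
    have C: "\<And>i. closed (C i)" and U: "\<And>i. open (U i)" and sub: "\<And>i. C i \<subseteq> a i" "\<And>i. a i \<subseteq> U i"
      and m: "\<And>i. measure N (U i - C i) < e/2 * (1/2)^(Suc i)"
      using CU unfolding C_def U_def by blast+
    let ?U = "\<Union>i. U i"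
    have meas: "C i \<in> sets N" "U i \<in> sets N" for i using C U by (auto simp: sN)
    have "measure N (?U - (\<Union>i. C i)) \<le> measure N (\<Union>i. U i - C i)"
      using meas by (intro finite_measure_mono) auto
    also have "\<dots> \<le> e/2"
      using meas m \<open>0 < e\<close> by (intro measure_countable_sum_le) (auto intro: less_imp_le)
    finally have 1: "measure N (?U - (\<Union>i. C i)) < e" using \<open>0 < e\<close> by simp
    have "(\<lambda>n. measure N (?U - (\<Union>i<n. C i))) \<longlonglongrightarrow> measure N (\<Inter>n. ?U - (\<Union>i<n. C i))"
    proof (rule finite_Lim_measure_decseq)
      show "decseq (\<lambda>n. ?U - (\<Union>i<n. C i))" by (rule decseq_SucI) (auto simp: lessThan_Suc)
    qed (use meas in auto)
    moreover have "(\<Inter>n. ?U - (\<Union>i<n. C i)) = ?U - (\<Union>i. C i)" by (auto intro: lessI)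
    ultimately have "(\<lambda>n. measure N (?U - (\<Union>i<n. C i))) \<longlonglongrightarrow> measure N (?U - (\<Union>i. C i))" by simp
    from eventually_happens'[OF sequentially_bot order_tendstoD(2)[OF this 1]]
    obtain n where "measure N (?U - (\<Union>i<n. C i)) < e" by (rule exE)
    moreover have "closed (\<Union>i<n. C i)" using C by auto
    moreover have "open ?U" using U by auto
    moreover have "(\<Union>i<n. C i) \<subseteq> \<Union> (range a)" "\<Union> (range a) \<subseteq> ?U" using sub by blast+
    ultimately show ?case by blast
  qed
qed

text \<open>The supremum is an explicit lower semicontinuous majorant, and the series bounds its
  integral. The layers k < q <= k + 1, weighted by k + 1, have total measure at most the integral of
  q + 1; enlarging layer k to an open set with excess 2^-(k+1) / (k+1) adds at most 1 in
  total.\<close>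

lemma vitali_caratheodory:
  fixes N :: "'a::metric_space measure" and q :: "'a \<Rightarrow> ennreal"
  assumes "finite_measure N" and sN: "sets N = sets borel" and [measurable]: "q \<in> borel_measurable borel"
    and fin: "(\<integral>\<^sup>+x. q x \<partial>N) < \<infinity>"
  obtains V :: "nat \<Rightarrow> 'a set" where "\<And>k. open (V k)"
    "\<And>x. q x \<le> (SUP k. ennreal (Suc k) * indicator (V k) x)"
    "(\<Sum>k. ennreal (Suc k) * emeasure N (V k)) < \<infinity>"
proof -
  interpret finite_measure N by fact
  have [measurable_cong]: "sets N = sets borel" by fact
  \<comment> \<open>Points with \<open>q x = \<infinity>\<close> are put into every layer, so that
    the supremum is infinite there; points with \<open>q x = 0\<close> are in none.\<close>
  define A where "A k = {x. (of_nat k < q x \<and> q x \<le> of_nat (Suc k)) \<or> q x = \<infinity>}" for k :: nat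
  have A[measurable]: "A k \<in> sets borel" for k unfolding A_def by measurable
  have "\<forall>k. \<exists>U. open U \<and> A k \<subseteq> U \<and> measure N U \<le> measure N (A k) + (1/2)^(Suc k) / Suc k"
  proof
    fix k
    obtain C U where CU: "closed C" "open U" "C \<subseteq> A k" "A k \<subseteq> U" "measure N (U - C) < (1/2)^(Suc k) / Suc k"
      using finite_borel_measure_regular[OF assms(1) sN A, of "(1/2)^(Suc k) / Suc k" k] by auto
    have "measure N U = measure N (A k) + measure N (U - A k)"
      using CU A[of k] by (simp add: finite_measure_Diff sN)
    also have "measure N (U - A k) \<le> measure N (U - C)"
      using CU A[of k] by (intro finite_measure_mono) (auto simp: sN)
    finally show "\<exists>U. open U \<and> A k \<subseteq> U \<and> measure N U \<le> measure N (A k) + (1/2)^(Suc k) / Suc k"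
      using CU by (intro exI[of _ U]) auto
  qed
  from choice[OF this] obtain V where V: "\<And>k. open (V k)" "\<And>k. A k \<subseteq> V k"
    "\<And>k. measure N (V k) \<le> measure N (A k) + (1/2)^(Suc k) / Suc k" by blast
  have "q x \<le> (SUP k. ennreal (Suc k) * indicator (V k) x)" for x
  proof (cases "q x = \<infinity>")
    case True
    then have "x \<in> V k" for k using V(2)[of k] by (auto simp: A_def)
    then have "of_nat k \<le> (SUP k. ennreal (Suc k) * indicator (V k) x)" for k
      by (intro SUP_upper2[of k]) (auto simp: ennreal_of_nat_eq_real_of_nat)
    then have "(SUP k. of_nat k :: ennreal) \<le> (SUP k. ennreal (Suc k) * indicator (V k) x)" by (intro SUP_least)
    then show ?thesis using True by (simp add: ennreal_SUP_of_nat_eq_top top_unique)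
  next
    case False
    then obtain r where r: "q x = ennreal r" "0 \<le> r" by (cases "q x") auto
    show ?thesis
    proof (cases "r = 0")
      case False
      define n where "n = (LEAST n. r \<le> real n)"
      have n: "r \<le> real n" unfolding n_def by (rule LeastI_ex) (rule real_arch_simple)
      then obtain k where k: "n = Suc k" using False r(2) by (cases n) auto
      have "\<not> r \<le> real k" using not_less_Least[of k "\<lambda>n. r \<le> real n"] k unfolding n_def by auto
      then have "x \<in> A k" using n k r by (auto simp: A_def ennreal_of_nat_eq_real_of_nat ennreal_less_iff simp del: of_nat_Suc)
      then have "x \<in> V k" using V(2) by auto
      then show ?thesis using n k r by (intro SUP_upper2[of k]) (auto intro: ennreal_leI simp del: of_nat_Suc)
    qed (use r in auto)
  qed
  moreover have "(\<Sum>k. ennreal (Suc k) * emeasure N (V k)) < \<infinity>"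
  proof -
    have le: "ennreal (Suc k) * emeasure N (V k) \<le> ennreal (Suc k) * emeasure N (A k) + ennreal ((1/2)^(Suc k))" for k
    proof -
      have "ennreal (Suc k) * emeasure N (V k) = ennreal (Suc k * measure N (V k))"
        by (simp add: emeasure_eq_measure ennreal_mult)
      also have "\<dots> \<le> ennreal (Suc k * measure N (A k) + (1/2)^(Suc k))"
        using mult_left_mono[OF V(3)[of k], of "Suc k"] by (intro ennreal_leI) (simp add: distrib_left del: of_nat_Suc)
      also have "\<dots> = ennreal (Suc k) * emeasure N (A k) + ennreal ((1/2)^(Suc k))"
        by (simp add: emeasure_eq_measure ennreal_mult ennreal_plus del: of_nat_Suc)
      finally show ?thesis .
    qed
    have pt: "(\<Sum>k. ennreal (Suc k) * indicator (A k) x) \<le> q x + 1" for x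
    proof (cases "q x = \<infinity> \<or> (\<forall>k. x \<notin> A k)")
      case False
      then obtain k where k: "x \<in> A k" and "q x \<noteq> \<infinity>" by blast
      have "x \<notin> A k'" if "k' \<noteq> k" for k'
      proof
        assume "x \<in> A k'"
        then have "of_nat k' < q x" "q x \<le> of_nat (Suc k')" "of_nat k < q x" "q x \<le> of_nat (Suc k)"
          using k \<open>q x \<noteq> \<infinity>\<close> by (simp_all add: A_def del: of_nat_Suc)
        then have "(of_nat k' :: ennreal) < of_nat (Suc k)" "(of_nat k :: ennreal) < of_nat (Suc k')"
          by (blast intro: less_le_trans)+
        then show False using that by (simp add: ennreal_of_nat_eq_real_of_nat ennreal_less_iff del: of_nat_Suc)
      qed
      then have "(\<Sum>k. ennreal (Suc k) * indicator (A k) x) = (\<Sum>k\<in>{k}. ennreal (Suc k) * indicator (A k) x)"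
        by (intro suminf_finite) auto
      also have "\<dots> = of_nat k + 1" using k by (simp add: ennreal_of_nat_eq_real_of_nat ennreal_plus)
      also have "\<dots> \<le> q x + 1" using k \<open>q x \<noteq> \<infinity>\<close> by (auto simp: A_def intro: add_right_mono less_imp_le)
      finally show ?thesis .
    qed auto
    have "(\<Sum>k. ennreal (Suc k) * emeasure N (A k)) = (\<Sum>k. \<integral>\<^sup>+x. ennreal (Suc k) * indicator (A k) x \<partial>N)"
      using A by (simp add: nn_integral_cmult_indicator sN del: of_nat_Suc)
    also have "\<dots> = (\<integral>\<^sup>+x. (\<Sum>k. ennreal (Suc k) * indicator (A k) x) \<partial>N)"
      by (rule nn_integral_suminf[symmetric]) measurable
    also have "\<dots> \<le> (\<integral>\<^sup>+x. q x + 1 \<partial>N)" using pt by (rule nn_integral_mono)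
    also have "\<dots> = (\<integral>\<^sup>+x. q x \<partial>N) + emeasure N (space N)" by (subst nn_integral_add) auto
    also have "\<dots> < \<infinity>" using fin by (simp add: emeasure_eq_measure)
    finally have 1: "(\<Sum>k. ennreal (Suc k) * emeasure N (A k)) < \<infinity>" .
    have 2: "(\<Sum>k. ennreal ((1/2)^(Suc k))) = ennreal 1"
      using power_half_series by (intro suminf_ennreal_eq) auto
    have "(\<Sum>k. ennreal (Suc k) * emeasure N (V k)) \<le> (\<Sum>k. ennreal (Suc k) * emeasure N (A k) + ennreal ((1/2)^(Suc k)))"
      by (rule suminf_le[OF le]) auto
    also have "\<dots> = (\<Sum>k. ennreal (Suc k) * emeasure N (A k)) + (\<Sum>k. ennreal ((1/2)^(Suc k)))"
      by (rule suminf_add[symmetric]) auto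
    also have "\<dots> < \<infinity>" using 1 2 by simp
    finally show ?thesis .
  qed
  ultimately show ?thesis using that V(1) by blast
qed

text \<open>A simultaneous Lusin theorem: each \<open>E n\<close> is enclosed between a closed and
  an open set, and the gaps, of total measure at most \<open>e/2\<close>, are removed. In the closed
  set that remains every \<open>E n\<close> is relatively open and closed.\<close>

lemma lusin_family:
  fixes N :: "'a::metric_space measure"
  assumes "finite_measure N" and sN: "sets N = sets borel" and S: "S \<in> sets borel"
    and E: "\<And>n::nat. E n \<in> sets borel" and "0 < e"
  obtains F where "closed F" "F \<subseteq> S" "measure N (S - F) < e"
    "\<And>n. closed (F \<inter> E n)" "\<And>n. closed (F - E n)"
proof -
  interpret finite_measure N by fact
  obtain C0 U0 where C0: "closed C0" "open U0" "C0 \<subseteq> S" "S \<subseteq> U0" "measure N (U0 - C0) < e/2"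
    using finite_borel_measure_regular[OF assms(1) sN S, of "e/2"] \<open>0 < e\<close> by auto
  have "\<forall>n. \<exists>CU. closed (fst CU) \<and> open (snd CU) \<and> fst CU \<subseteq> E n \<and> E n \<subseteq> snd CU \<and>
      measure N (snd CU - fst CU) < e/2 * (1/2)^(Suc n)"
    using finite_borel_measure_regular[OF assms(1) sN E, of "e/2 * (1/2)^(Suc n)" n for n] \<open>0 < e\<close> by simp
  from choice[OF this] obtain CU where CU: "\<And>i. closed (fst (CU i)) \<and> open (snd (CU i)) \<and> fst (CU i) \<subseteq> E i \<and>
      E i \<subseteq> snd (CU i) \<and> measure N (snd (CU i) - fst (CU i)) < e/2 * (1/2)^(Suc i)" by blast
  define C where "C i = fst (CU i)" for i
  define U where "U i = snd (CU i)" for i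
  have C: "\<And>i. closed (C i)" and U: "\<And>i. open (U i)" and sub: "\<And>i. C i \<subseteq> E i" "\<And>i. E i \<subseteq> U i"
    and m: "\<And>i. measure N (U i - C i) < e/2 * (1/2)^(Suc i)"
    using CU unfolding C_def U_def by blast+
  have meas: "C i \<in> sets N" "U i \<in> sets N" for i using C U by (auto simp: sN)
  define F where "F = C0 \<inter> (\<Inter>n. C n \<union> - U n)"
  have cl: "closed F" unfolding F_def using C0(1) C U by (intro closed_Int closed_INT ballI closed_Un) auto
  have "S - F \<subseteq> (U0 - C0) \<union> (\<Union>n. U n - C n)" using C0(4) by (auto simp: F_def)
  then have "measure N (S - F) \<le> measure N ((U0 - C0) \<union> (\<Union>n. U n - C n))"
    using C0 meas by (intro finite_measure_mono) (auto simp: sN)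
  also have "\<dots> \<le> measure N (U0 - C0) + measure N (\<Union>n. U n - C n)"
    using C0 meas by (intro measure_Un_le) (auto simp: sN)
  also have "measure N (\<Union>n. U n - C n) \<le> e/2"
    using meas m \<open>0 < e\<close> by (intro measure_countable_sum_le) (auto intro: less_imp_le)
  finally have "measure N (S - F) < e" using C0(5) by simp
  moreover have "F \<inter> E n = F \<inter> C n" "F - E n = F \<inter> - U n" for n
    using sub[of n] by (auto simp: F_def)
  moreover have "closed (F \<inter> C n)" "closed (F \<inter> - U n)" for n using cl C U by auto
  moreover have "F \<subseteq> S" using C0(3) by (auto simp: F_def)
  ultimately show ?thesis using cl by (intro that[of F]) simp_all
qed

lemma continuous_on_rational_superlevel:
  fixes h :: "'a::metric_space \<Rightarrow> real"
  assumes "\<And>q. q \<in> \<rat> \<Longrightarrow> closed (F \<inter> {x. q < h x})" "\<And>q. q \<in> \<rat> \<Longrightarrow> closed (F - {x. q < h x})"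
  shows "continuous_on F h"
  unfolding continuous_on_iff
proof (intro ballI allI impI)
  fix x e assume "x \<in> F" "(0::real) < e"
  obtain q1 where q1: "q1 \<in> \<rat>" "h x - e < q1" "q1 < h x" using Rats_dense_in_real[of "h x - e" "h x"] \<open>0 < e\<close> by auto
  obtain q2 where q2: "q2 \<in> \<rat>" "h x < q2" "q2 < h x + e" using Rats_dense_in_real[of "h x" "h x + e"] \<open>0 < e\<close> by auto
  let ?U = "- (F - {x. q1 < h x}) \<inter> - (F \<inter> {x. q2 < h x})"
  have "open ?U" using assms q1(1) q2(1) by (intro open_Int open_Compl) auto
  moreover have "x \<in> ?U" using q1 q2 by auto
  ultimately obtain d where d: "d > 0" "ball x d \<subseteq> ?U" using open_contains_ball by blast
  have "dist (h x') (h x) < e" if "x' \<in> F" "dist x' x < d" for x'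
  proof -
    have "x' \<in> ball x d" using that by (simp add: dist_commute)
    then have "x' \<in> ?U" using d(2) by blast
    then show ?thesis using that q1 q2 by (auto simp: dist_real_def)
  qed
  then show "\<exists>d>0. \<forall>x'\<in>F. dist x' x < d \<longrightarrow> dist (h x') (h x) < e" using d(1) by blast
qed

subsection \<open>Test functions for the capacity\<close>

lemma ennpowr_mono: "0 < a \<Longrightarrow> x \<le> y \<Longrightarrow> ennpowr x a \<le> ennpowr y a"
  unfolding ennpowr_def
  by (auto simp: top_unique less_top intro!: ennreal_leI powr_mono2 enn2real_mono)

lemma ennpowr_ennpowr: "0 < a \<Longrightarrow> a * b = 1 \<Longrightarrow> ennpowr (ennpowr x a) b = x"
  unfolding ennpowr_def by (cases x) (auto simp: powr_powr)

lemma ennpowr_0: "ennpowr 0 a = 0"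
  by (simp add: ennpowr_def)

lemma ennpowr_ennreal: "0 \<le> x \<Longrightarrow> ennpowr (ennreal x) a = ennreal (x powr a)"
  by (simp add: ennpowr_def)

lemma ennpowr_mult_ennreal: "0 < c \<Longrightarrow> ennpowr (x * ennreal c) a = ennpowr x a * ennreal (c powr a)"
  unfolding ennpowr_def
  by (cases x) (auto simp: powr_mult ennreal_mult_top ennreal_top_mult simp flip: ennreal_mult)

lemma borel_measurable_ennpowr[measurable]:
  assumes [measurable]: "f \<in> borel_measurable M"
  shows "(\<lambda>x. ennpowr (f x) a) \<in> borel_measurable M"
proof -
  have "{x \<in> space M. f x = \<infinity>} = f -` {\<infinity>} \<inter> space M" by auto
  then have "{x \<in> space M. f x = \<infinity>} \<in> sets M" using measurable_sets[OF assms, of "{\<infinity>}"] by simp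
  then show ?thesis unfolding ennpowr_def by (intro measurable_If) simp_all
qed

lemma measurable_restrict_UNIV: "measurable (restrict_space M UNIV) N = measurable M N"
  by (rule measurable_cong_sets) (simp_all add: sets_restrict_UNIV)

lemma ennreal_le_suminf: "(f i :: ennreal) \<le> suminf f"
proof -
  have "sum f {i} \<le> suminf f" by (rule sum_le_suminf) auto
  then show ?thesis by simp
qed

text \<open>A bound on the capacity together with its witness. Fixing one upper gradient, instead of
  taking an infimum over all of them, makes countable unions a matter of combining
  witnesses.\<close>

definition cap_test :: "real \<Rightarrow> 'a::metric_space measure \<Rightarrow> 'a set \<Rightarrow> real \<Rightarrow> bool" where
  "cap_test p \<mu> E e \<longleftrightarrow>
     (\<exists>v g. v \<in> borel_measurable \<mu> \<and> range v \<subseteq> {0..1} \<and> (\<forall>x\<in>E. v x = 1) \<and>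
        upper_gradient UNIV (\<lambda>x. ereal (v x)) g \<and>
        (\<integral>\<^sup>+x. ennreal (v x powr p) \<partial>\<mu>) + (\<integral>\<^sup>+x. ennpowr (g x) p \<partial>\<mu>) \<le> ennreal e)"

lemma capacity_less_cap_test:
  assumes "cap_test p \<mu> E e" "e < \<epsilon>" "0 < \<epsilon>"
  shows "capacity p \<mu> E < ennreal \<epsilon>"
proof -
  obtain v g where v: "v \<in> borel_measurable \<mu>" "range v \<subseteq> {0..1}" "\<forall>x\<in>E. v x = 1"
    "upper_gradient UNIV (\<lambda>x. ereal (v x)) g"
    "(\<integral>\<^sup>+x. ennreal (v x powr p) \<partial>\<mu>) + (\<integral>\<^sup>+x. ennpowr (g x) p \<partial>\<mu>) \<le> ennreal e"
    using assms(1) unfolding cap_test_def by blast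
  have eq: "ennpowr (e2ennreal \<bar>ereal (v x)\<bar>) p = ennreal (v x powr p)" for x
    using v(2) by (subst ennpowr_ennreal[symmetric]) (auto simp: image_subset_iff ennreal.abs_eq eq_onp_def simp flip: ennreal.abs_eq e2ennreal_ereal)
  have "N1p_norm_pow p \<mu> UNIV (\<lambda>x. ereal (v x)) \<le> (\<integral>\<^sup>+x. ennreal (v x powr p) \<partial>\<mu>) + (\<integral>\<^sup>+x. ennpowr (g x) p \<partial>\<mu>)"
    unfolding N1p_norm_pow_def eq using v(4) by (intro add_mono INF_lower2[of g]) auto
  also note v(5)
  finally have le: "N1p_norm_pow p \<mu> UNIV (\<lambda>x. ereal (v x)) \<le> ennreal e" .
  have "(\<lambda>x. ereal (v x)) \<in> N1p p \<mu> UNIV"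
    unfolding N1p_def using v(1) le by (auto simp: measurable_restrict_UNIV order_le_less_trans)
  then have "capacity p \<mu> E \<le> ennreal e"
    unfolding capacity_def using v(3) le by (intro INF_lower2[of "\<lambda>x. ereal (v x)"]) auto
  also have "\<dots> < ennreal \<epsilon>" using assms(2,3) by (simp add: ennreal_lessI)
  finally show ?thesis .
qed

lemma ereal_gap_real: "ereal_gap (ereal a) (ereal b) = ennreal \<bar>a - b\<bar>"
  by (simp add: ereal_gap_def)

text \<open>The supremum of the test functions is a test function for the union. Its upper gradient
  is the l^p norm of the sequence \<open>g i\<close>: it dominates each \<open>g i\<close>, and its
  \<open>p\<close>-th power integrates to the sum of the single energies.\<close>

lemma cap_test_UN:
  assumes "0 < p" and E: "\<And>i::nat. cap_test p \<mu> (E i) (e i)" and e: "\<And>i. 0 \<le> e i" "summable e"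
    and meas: "sets borel \<subseteq> sets \<mu>" "space \<mu> = UNIV"
  shows "cap_test p \<mu> (\<Union>i. E i) (suminf e)"
proof -
  obtain v g where v[measurable]: "\<And>i. v i \<in> borel_measurable \<mu>" and v01: "\<And>i. range (v i) \<subseteq> {0..1}"
    and vE: "\<And>i. \<forall>x\<in>E i. v i x = 1" and ug: "\<And>i. upper_gradient UNIV (\<lambda>x. ereal (v i x)) (g i)"
    and le: "\<And>i. (\<integral>\<^sup>+x. ennreal (v i x powr p) \<partial>\<mu>) + (\<integral>\<^sup>+x. ennpowr (g i x) p \<partial>\<mu>) \<le> ennreal (e i)"
    using E unfolding cap_test_def by metis
  have v01': "0 \<le> v i x" "v i x \<le> 1" for i x using v01[of i] by (auto simp: image_subset_iff)
  have gb[measurable]: "g i \<in> borel_measurable borel" for i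
    using ug[of i] by (simp add: upper_gradient_def measurable_restrict_UNIV)
  have g\<mu>[measurable]: "g i \<in> borel_measurable \<mu>" for i
    by (rule measurable_mono[THEN subsetD, OF _ _ _ _ gb]) (use meas in auto)
  define w where "w x = (SUP i. v i x)" for x
  define k where "k x = ennpowr (\<Sum>i. ennpowr (g i x) p) (1/p)" for x
  have bdd: "bdd_above (range (\<lambda>i. v i x))" for x using v01' by (auto intro!: bdd_aboveI[of _ 1])
  have v_le: "v i x \<le> w x" for i x unfolding w_def using bdd by (rule cSUP_upper2) auto
  have w01: "0 \<le> w x" "w x \<le> 1" for x
    using v_le[of 0 x] v01'[of 0 x] by (auto simp: w_def intro!: cSUP_least v01')
  have g_le: "g i x \<le> k x" for i x
  proof -
    have "ennpowr (g i x) p \<le> (\<Sum>i. ennpowr (g i x) p)"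
      by (rule ennreal_le_suminf)
    from ennpowr_mono[OF _ this, of "1/p"] show ?thesis
      using \<open>0 < p\<close> ennpowr_ennpowr[of p "1/p" "g i x"] by (simp add: k_def)
  qed
  have kp: "ennpowr (k x) p = (\<Sum>i. ennpowr (g i x) p)" for x
    unfolding k_def using \<open>0 < p\<close> by (intro ennpowr_ennpowr) auto
  have wp: "ennreal (w x powr p) \<le> (\<Sum>i. ennreal (v i x powr p))" for x
  proof -
    define S where "S = (\<Sum>i. ennreal (v i x powr p))"
    have "ennreal (v i x) \<le> ennpowr S (1/p)" for i
    proof -
      have "ennreal (v i x powr p) \<le> S"
        unfolding S_def by (rule ennreal_le_suminf)
      from ennpowr_mono[OF _ this, of "1/p"] show ?thesis
        using \<open>0 < p\<close> ennpowr_ennpowr[of p "1/p" "ennreal (v i x)"] v01'(1)[of i x] by (simp add: ennpowr_ennreal)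
    qed
    note vS = this
    have "ennreal (w x) \<le> ennpowr S (1/p)"
    proof (cases "ennpowr S (1/p)")
      case (real r)
      then have "v i x \<le> r" for i using vS[of i] by simp
      then have "w x \<le> r" unfolding w_def by (intro cSUP_least) auto
      then show ?thesis using real by (simp add: ennreal_leI)
    qed auto
    from ennpowr_mono[OF \<open>0 < p\<close> this] have "ennreal (w x powr p) \<le> S"
      using \<open>0 < p\<close> w01(1)[of x] ennpowr_ennpowr[of "1/p" p S] by (simp add: ennpowr_ennreal)
    then show ?thesis by (simp only: S_def)
  qed
  have "w \<in> borel_measurable \<mu>" unfolding w_def by (rule borel_measurable_cSUP) (use bdd in auto)
  moreover have "\<forall>x\<in>(\<Union>i. E i). w x = 1"
  proof
    fix x assume "x \<in> (\<Union>i. E i)"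
    then obtain i where "v i x = 1" using vE by blast
    then show "w x = 1" using v_le[of i x] w01(2)[of x] by simp
  qed
  moreover have "upper_gradient UNIV (\<lambda>x. ereal (w x)) k"
    unfolding upper_gradient_def
  proof (intro conjI allI impI)
    show "k \<in> borel_measurable (restrict_space borel UNIV)"
      unfolding k_def measurable_restrict_UNIV by measurable
    fix l \<gamma> assume arc: "arc_length_curve UNIV l (\<gamma> :: real \<Rightarrow> 'a)"
    show "ereal_gap (ereal (w (\<gamma> 0))) (ereal (w (\<gamma> l))) \<le> line_integral l \<gamma> k"
    proof (cases "line_integral l \<gamma> k")
      case (real r)
      have "ennreal \<bar>v i (\<gamma> 0) - v i (\<gamma> l)\<bar> \<le> ennreal r" for i
      proof -
        have "ennreal \<bar>v i (\<gamma> 0) - v i (\<gamma> l)\<bar> \<le> line_integral l \<gamma> (g i)"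
          using ug[of i] arc unfolding upper_gradient_def ereal_gap_real by blast
        also have "\<dots> \<le> line_integral l \<gamma> k" by (rule line_integral_mono) (auto simp: g_le)
        finally show ?thesis using real by simp
      qed
      then have d: "\<bar>v i (\<gamma> 0) - v i (\<gamma> l)\<bar> \<le> r" for i using real by simp
      have "w (\<gamma> 0) \<le> w (\<gamma> l) + r" unfolding w_def[of "\<gamma> 0"]
      proof (rule cSUP_least)
        fix i show "v i (\<gamma> 0) \<le> w (\<gamma> l) + r" using d[of i] v_le[of i "\<gamma> l"] by linarith
      qed simp
      moreover have "w (\<gamma> l) \<le> w (\<gamma> 0) + r" unfolding w_def[of "\<gamma> l"]
      proof (rule cSUP_least)
        fix i show "v i (\<gamma> l) \<le> w (\<gamma> 0) + r" using d[of i] v_le[of i "\<gamma> 0"] by linarith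
      qed simp
      ultimately show ?thesis using real by (simp add: ereal_gap_real ennreal_leI abs_le_iff)
    qed auto
  qed
  moreover have "(\<integral>\<^sup>+x. ennreal (w x powr p) \<partial>\<mu>) + (\<integral>\<^sup>+x. ennpowr (k x) p \<partial>\<mu>) \<le> ennreal (suminf e)"
  proof -
    have "(\<integral>\<^sup>+x. ennreal (w x powr p) \<partial>\<mu>) + (\<integral>\<^sup>+x. ennpowr (k x) p \<partial>\<mu>) \<le>
        (\<integral>\<^sup>+x. (\<Sum>i. ennreal (v i x powr p)) \<partial>\<mu>) + (\<integral>\<^sup>+x. (\<Sum>i. ennpowr (g i x) p) \<partial>\<mu>)"
      by (intro add_mono nn_integral_mono) (auto simp: wp kp)
    also have "\<dots> = (\<Sum>i. (\<integral>\<^sup>+x. ennreal (v i x powr p) \<partial>\<mu>)) + (\<Sum>i. \<integral>\<^sup>+x. ennpowr (g i x) p \<partial>\<mu>)"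
      by (subst (1 2) nn_integral_suminf) auto
    also have "\<dots> = (\<Sum>i. (\<integral>\<^sup>+x. ennreal (v i x powr p) \<partial>\<mu>) + (\<integral>\<^sup>+x. ennpowr (g i x) p \<partial>\<mu>))"
      by (rule suminf_add) auto
    also have "\<dots> \<le> (\<Sum>i. ennreal (e i))" by (rule suminf_le[OF le]) auto
    also have "\<dots> = ennreal (suminf e)" using e by (intro suminf_ennreal2) auto
    finally show ?thesis .
  qed
  ultimately show ?thesis unfolding cap_test_def using w01 by (intro exI[of _ w] exI[of _ k]) auto
qed

context cost_space
begin

lemma reach_limit_compact:
  assumes "compact K" "\<And>n. y n \<in> K" "\<And>n. reach (t n) (x n) (y n)" "x \<longlonglongrightarrow> x'" "t \<longlonglongrightarrow> t'"
  obtains r :: "nat \<Rightarrow> nat" and y' where "strict_mono r" "y' \<in> K" "(\<lambda>n. y (r n)) \<longlonglongrightarrow> y'" "reach t' x' y'"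
proof -
  have "\<forall>n. y n \<in> K" using assms(2) by blast
  then obtain y' r where r: "y' \<in> K" "strict_mono r" "(y \<circ> r) \<longlonglongrightarrow> y'"
    using \<open>compact K\<close> unfolding compact_def by meson
  have "reach t' x' y'"
    by (rule reach_closed[of "t \<circ> r" "x \<circ> r" "y \<circ> r"])
       (use assms r in \<open>auto intro: LIMSEQ_subseq_LIMSEQ\<close>)
  then show ?thesis using that r by (auto simp: o_def)
qed

end

subsection \<open>Functions given by the cost of reaching a compact set\<close>

lemma isometry_continuous_on:
  assumes "\<And>x y. dist (\<iota> x) (\<iota> y) = dist x y"
  shows "continuous_on S \<iota>"
  unfolding continuous_on_iff using assms by auto

text \<open>\<open>N\<close> is the image under \<iota> of the measure with density \<rho>^p on the
  ball. It lives on the Borel sets of the completion, so regularity and Lusin's theorem can be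
  applied there whether or not X is a Borel subset. The weight makes \<open>N\<close> bound both
  parts of the norm of a test function: \<rho>^p controls the gradient, and \<rho>^p >= 1 the
  function itself.\<close>

locale local_setting = cost_space "cball (\<iota> x\<^sub>0) R" \<rho>
  for \<iota> :: "'a::metric_space \<Rightarrow> 'b::metric_space" and x\<^sub>0 R \<rho> +
  fixes \<mu> :: "'a measure" and p :: real and N :: "'b measure"
  assumes isom: "dist (\<iota> x) (\<iota> y) = dist x y"
    and R: "0 < R" and p: "0 < p"
    and borel_mu: "sets borel \<subseteq> sets \<mu>" and space_mu: "space \<mu> = UNIV"
    and finite_N: "finite_measure N" and sets_N: "sets N = sets borel"
    and emeasure_N: "A \<in> sets borel \<Longrightarrow>
      emeasure N A = (\<integral>\<^sup>+x. ennpowr (\<rho> (\<iota> x)) p * indicator (ball x\<^sub>0 R \<inter> \<iota> -` A) x \<partial>\<mu>)"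
begin

lemma iota_borel[measurable]: "\<iota> \<in> borel_measurable borel"
  using isometry_continuous_on[OF isom] by (rule borel_measurable_continuous_onI)

lemma measurable_mu: "f \<in> measurable borel M \<Longrightarrow> f \<in> measurable \<mu> M"
  using borel_mu by (auto simp: measurable_def space_mu)

lemma vimage_closed: "closed C \<Longrightarrow> closed (\<iota> -` C)"
  by (rule closed_vimage[OF _ isometry_continuous_on[OF isom]])

lemma ball_vimage: "x \<in> ball x\<^sub>0 R \<Longrightarrow> \<iota> x \<in> cball (\<iota> x\<^sub>0) R"
  by (simp add: isom less_imp_le)

text \<open>The sphere is included so that extending the potential by 0 outside the ball is
  compatible with an upper gradient that vanishes there. Nothing is lost on the ball of half the
  radius, from which the sphere is not reached cheaply.\<close>

abbreviation target :: "'b set \<Rightarrow> 'b set" where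
  "target F \<equiv> F \<union> sphere (\<iota> x\<^sub>0) R"

definition exceptional :: "'b set \<Rightarrow> real \<Rightarrow> 'a set" where
  "exceptional F c = {x \<in> ball x\<^sub>0 R. \<not> (\<exists>y\<in>target F. reach c (\<iota> x) y)}"

lemma closed_target: "closed (sphere (\<iota> x\<^sub>0) R)"
  unfolding sphere_def by (intro closed_Collect_eq continuous_intros)

lemma compact_target:
  assumes "closed F" "F \<subseteq> cball (\<iota> x\<^sub>0) R"
  shows "compact (target F)"
proof -
  have "compact (cball (\<iota> x\<^sub>0) R \<inter> (target F))"
    using assms(1) by (intro compact_Int_closed compact_Z closed_Un closed_target)
  moreover have "cball (\<iota> x\<^sub>0) R \<inter> (target F) = target F"
    using assms(2) sphere_cball by blast
  ultimately show ?thesis by simp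
qed

lemma open_exceptional:
  assumes "closed F" "F \<subseteq> cball (\<iota> x\<^sub>0) R"
  shows "open (exceptional F c)"
proof -
  have "closed (\<iota> -` {z. \<exists>y\<in>target F. reach c z y})"
    by (intro vimage_closed closed_reach_from compact_target assms)
  moreover have "exceptional F c = ball x\<^sub>0 R - \<iota> -` {z. \<exists>y\<in>target F. reach c z y}"
    by (auto simp: exceptional_def)
  ultimately show ?thesis by auto
qed

abbreviation costs :: "'b set \<Rightarrow> real \<Rightarrow> 'a \<Rightarrow> real set" where
  "costs F c x \<equiv> {t / c |t. 0 \<le> t \<and> (\<exists>y\<in>target F. reach t (\<iota> x) y)}"

text \<open>Inserting 1 truncates the function and at the same time keeps the infimum over a
  nonempty set when the target is not reached at any cost.\<close>

definition potential :: "'b set \<Rightarrow> real \<Rightarrow> 'a \<Rightarrow> real" where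
  "potential F c x = (if x \<in> ball x\<^sub>0 R
     then Inf (insert 1 (costs F c x)) else 0)"

context
  fixes F :: "'b set" and c :: real
  assumes F: "closed F" "F \<subseteq> cball (\<iota> x\<^sub>0) R" and c: "0 < c"
begin

lemma potential_bdd:
  "bdd_below (insert 1 (costs F c x))"
  using c by (intro bdd_belowI[of _ 0]) auto

lemma potential_range: "0 \<le> potential F c x" "potential F c x \<le> 1"
  unfolding potential_def using c by (auto intro!: cInf_greatest cInf_lower2[OF insertI1] bdd_belowI[of _ 0])

lemma potential_le:
  assumes "0 \<le> t" "y \<in> target F" "reach t (\<iota> x) y"
  shows "potential F c x \<le> t / c"
proof (cases "x \<in> ball x\<^sub>0 R")
  case True
  have "Inf (insert 1 (costs F c x)) \<le> t / c"
    by (rule cInf_lower[OF _ potential_bdd]) (use assms in blast)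
  then show ?thesis using True by (simp add: potential_def)
qed (use assms c in \<open>simp add: potential_def\<close>)

text \<open>The infimum is attained: the target is compact and \<open>reach\<close> is closed, so
  near-optimal end points subconverge to an optimal one. Sublevel sets are therefore relatively
  closed in the ball, which makes the potential Borel.\<close>

lemma potential_le_iff:
  assumes "x \<in> ball x\<^sub>0 R" "0 \<le> s" "s < 1"
  shows "potential F c x \<le> s \<longleftrightarrow> (\<exists>y\<in>target F. reach (c * s) (\<iota> x) y)"
proof
  assume le: "potential F c x \<le> s"
  let ?T = "costs F c x"
  \<comment> \<open>The errors keep \<open>s + e n\<close> at most 1, so that a cost ratio below it
    cannot be the inserted 1.\<close>
  define e where "e n = (1 - s) / Suc n" for n :: nat
  have e: "0 < e n" "s + e n \<le> 1" for n
  proof -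
    show "0 < e n" using \<open>s < 1\<close> by (simp add: e_def)
    have "e n \<le> (1 - s) / 1" unfolding e_def using \<open>s < 1\<close> by (intro divide_left_mono) auto
    then show "s + e n \<le> 1" by simp
  qed
  have "\<exists>y. y \<in> target F \<and> reach (c * (s + e n)) (\<iota> x) y" for n
  proof -
    have "Inf (insert 1 ?T) < s + e n" using le e(1)[of n] assms(1) by (simp add: potential_def)
    then obtain z where z: "z \<in> insert 1 ?T" "z < s + e n" using cInf_lessD[of "insert 1 ?T"] by blast
    from z e(2)[of n] have "z \<in> ?T" by (simp only: insert_iff) linarith
    then obtain t y where "z = t / c" "y \<in> target F" "reach t (\<iota> x) y" by blast
    moreover have "t \<le> c * (s + e n)" using z(2) \<open>z = t / c\<close> c by (simp add: field_simps)
    ultimately show ?thesis using reach_mono by blast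
  qed
  then obtain y where y: "\<And>n. y n \<in> target F" "\<And>n. reach (c * (s + e n)) (\<iota> x) (y n)" by metis
  have "(\<lambda>n. c * (s + e n)) \<longlonglongrightarrow> c * (s + 0)"
    unfolding e_def by (intro tendsto_intros LIMSEQ_Suc[OF lim_const_over_n])
  from reach_limit_compact[OF compact_target[OF F] y(1,2) tendsto_const this]
  obtain y' where "y' \<in> target F" "reach (c * (s + 0)) (\<iota> x) y'" by blast
  then show "\<exists>y\<in>target F. reach (c * s) (\<iota> x) y" unfolding add_0_right by (rule rev_bexI)
next
  assume "\<exists>y\<in>target F. reach (c * s) (\<iota> x) y"
  then obtain y where y: "y \<in> target F" "reach (c * s) (\<iota> x) y" by (rule bexE)
  show "potential F c x \<le> s" using potential_le[OF _ y] assms c by simp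
qed

lemma potential_measurable[measurable]: "potential F c \<in> borel_measurable borel"
proof (rule borel_measurableI_le)
  fix s :: real
  have "closed {z. \<exists>y\<in>target F. reach (c * s) z y}"
    by (rule closed_reach_from[OF compact_target[OF F]])
  then have C: "closed (\<iota> -` {z. \<exists>y\<in>target F. reach (c * s) z y})" by (rule vimage_closed)
  consider "s < 0" | "1 \<le> s" | "0 \<le> s" "s < 1" by linarith
  then show "{x \<in> space borel. potential F c x \<le> s} \<in> sets borel"
  proof cases
    case 1
    then have "{x \<in> space borel. potential F c x \<le> s} = {}"
      using potential_range(1) by (auto simp: not_le intro: less_le_trans)
    then show ?thesis by simp
  next
    case 2
    then have "{x \<in> space borel. potential F c x \<le> s} = UNIV" using potential_range(2) by (auto intro: order_trans)
    then show ?thesis by simp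
  next
    case 3
    have "{x \<in> space borel. potential F c x \<le> s} =
        - ball x\<^sub>0 R \<union> (\<iota> -` {z. \<exists>y\<in>target F. reach (c * s) z y})"
      using 3 potential_le_iff[OF _ 3] potential_le[of "c * s"] c by (auto simp: potential_def)
    moreover have "closed (- ball x\<^sub>0 R \<union> (\<iota> -` {z. \<exists>y\<in>target F. reach (c * s) z y}))"
      using C by (intro closed_Un) auto
    ultimately show ?thesis by simp
  qed
qed

lemma potential_exceptional: "x \<in> exceptional F c \<Longrightarrow> potential F c x = 1"
proof -
  assume x: "x \<in> exceptional F c"
  have "1 \<le> z" if "z \<in> insert 1 (costs F c x)" for z
  proof (rule ccontr)
    assume "\<not> 1 \<le> z"
    with that have "z \<in> costs F c x" by blast
    then obtain t y where "z = t / c" and t: "y \<in> target F" "reach t (\<iota> x) y" by blast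
    then have "t / c < 1" using \<open>\<not> 1 \<le> z\<close> by simp
    then have "t \<le> c" using c by (simp add: field_simps)
    have "\<exists>y\<in>target F. reach c (\<iota> x) y"
      using t(1) reach_mono[OF t(2) \<open>t \<le> c\<close>] by (rule rev_bexI)
    moreover have "\<not> (\<exists>y\<in>target F. reach c (\<iota> x) y)"
      using x unfolding exceptional_def by (elim CollectE conjE)
    ultimately show False by (rule notE[rotated])
  qed
  then have "1 \<le> potential F c x" using x unfolding potential_def exceptional_def
    by (auto intro!: cInf_greatest)
  then show ?thesis using potential_range(2)[of x] by simp
qed

text \<open>The gradient can be 0 on all of \<open>F\<close>, not only on its interior, because only
  the part of a curve after its last visit to \<open>F\<close> or to the exterior of the ball enters
  the estimate.\<close>

definition potential_gradient :: "'a \<Rightarrow> ennreal" where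
  "potential_gradient x = (if x \<in> ball x\<^sub>0 R - \<iota> -` F then \<rho> (\<iota> x) * ennreal (1 / c) else 0)"

lemma potential_gradient_measurable[measurable]: "potential_gradient \<in> borel_measurable borel"
proof -
  have [measurable]: "ball x\<^sub>0 R - \<iota> -` F \<in> sets borel" using vimage_closed[OF F(1)] by (intro sets.Diff) auto
  show ?thesis unfolding potential_gradient_def by measurable
qed

text \<open>If the curve meets \<open>F\<close> or the complement of the ball, the piece after the
  last such moment avoids both and has \<rho>-cost at most \<open>c * I\<close>, so the potential at
  the end is at most \<open>I\<close>. Otherwise the whole curve, reversed, can be put in front of
  the curves that start at \<open>\<eta> 0\<close>.\<close>

lemma potential_along_curve:
  fixes \<eta> :: "real \<Rightarrow> 'a"
  assumes lip: "1-lipschitz_on {0..l} \<eta>" and l: "0 \<le> l"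
    and I: "line_integral l \<eta> potential_gradient = ennreal I" "0 \<le> I"
  shows "potential F c (\<eta> l) \<le> potential F c (\<eta> 0) + I"
proof (cases "\<eta> l \<in> ball x\<^sub>0 R")
  case l_in: True
  define \<Phi> where "\<Phi> = \<iota> -` F \<union> - ball x\<^sub>0 R"
  have "closed \<Phi>" unfolding \<Phi>_def using vimage_closed[OF F(1)] by (intro closed_Un) auto
  have contl: "continuous_on {0..l} \<eta>" using lip by (rule lipschitz_on_continuous_on)
  have lip': "1-lipschitz_on {a..l} (\<lambda>t. \<iota> (\<eta> t))" if "0 \<le> a" for a
    by (rule lipschitz_onI) (use lipschitz_onD[OF lip] isom that in auto)
  have reach_tail: "reach (c * I) (\<iota> (\<eta> a)) (\<iota> (\<eta> l))"
    if "0 \<le> a" "a \<le> l" and tail: "\<And>t. a < t \<Longrightarrow> t \<le> l \<Longrightarrow> \<eta> t \<notin> \<Phi>" and a: "\<iota> (\<eta> a) \<in> cball (\<iota> x\<^sub>0) R" for a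
  proof (rule reach_segment[OF lip'[OF \<open>0 \<le> a\<close>] \<open>a \<le> l\<close>])
    show "(\<lambda>t. \<iota> (\<eta> t)) ` {a..l} \<subseteq> cball (\<iota> x\<^sub>0) R"
    proof (intro image_subsetI)
      fix t assume t: "t \<in> {a..l}"
      show "\<iota> (\<eta> t) \<in> cball (\<iota> x\<^sub>0) R"
        using a tail[of t] t ball_vimage[of "\<eta> t"] by (cases "t = a") (auto simp: \<Phi>_def)
    qed
    have "1-lipschitz_on UNIV (\<lambda>t. \<eta> (max 0 (min l t)))" using lip l by (rule lipschitz_on_clamp)
    then have m[measurable]: "(\<lambda>t. \<eta> (max 0 (min l t))) \<in> borel_measurable borel" by (rule borel_measurable_lipschitz)
    have "(\<integral>\<^sup>+t\<in>{a..l}. \<rho> (\<iota> (\<eta> t)) \<partial>lborel) \<le> (\<integral>\<^sup>+t. ennreal c * (potential_gradient (\<eta> (max 0 (min l t))) * indicator {0..l} t) \<partial>lborel)"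
    proof (intro nn_integral_mono_AE eventually_mono[OF AE_lborel_singleton[of a]])
      fix t assume "t \<noteq> a"
      show "\<rho> (\<iota> (\<eta> t)) * indicator {a..l} t \<le> ennreal c * (potential_gradient (\<eta> (max 0 (min l t))) * indicator {0..l} t)"
      proof (cases "t \<in> {a..l}")
        case True
        then have "\<eta> t \<notin> \<Phi>" using tail[of t] \<open>t \<noteq> a\<close> by auto
        then have "potential_gradient (\<eta> t) = \<rho> (\<iota> (\<eta> t)) * ennreal (1 / c)"
          by (auto simp: potential_gradient_def \<Phi>_def)
        then have "ennreal c * potential_gradient (\<eta> t) = \<rho> (\<iota> (\<eta> t)) * (ennreal c * ennreal (1 / c))"
          by (simp add: mult_ac)
        also have "ennreal c * ennreal (1 / c) = 1" using c by (simp flip: ennreal_mult)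
        finally show ?thesis using True \<open>0 \<le> a\<close> by simp
      qed simp
    qed
    also have "\<dots> = ennreal c * (\<integral>\<^sup>+t. (potential_gradient (\<eta> (max 0 (min l t))) * indicator {0..l} t) \<partial>lborel)"
      by (rule nn_integral_cmult) measurable
    also have "(\<integral>\<^sup>+t. (potential_gradient (\<eta> (max 0 (min l t))) * indicator {0..l} t) \<partial>lborel) = ennreal I"
      unfolding I(1)[symmetric] line_integral_def by (intro nn_integral_cong) (auto split: split_indicator)
    also have "ennreal c * ennreal I = ennreal (c * I)" using c I by (simp add: ennreal_mult)
    finally show "(\<integral>\<^sup>+t\<in>{a..l}. \<rho> (\<iota> (\<eta> t)) \<partial>lborel) \<le> ennreal (c * I)" .
  qed
  show ?thesis
  proof (cases "\<exists>t\<in>{0..l}. \<eta> t \<in> \<Phi>")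
    case True
    define T where "T = {0..l} \<inter> \<eta> -` \<Phi>"
    have "closed T" unfolding T_def
      by (rule continuous_closed_preimage[OF contl closed_atLeastAtMost \<open>closed \<Phi>\<close>])
    then have "compact T" using compact_Int_closed[OF compact_Icc[of 0 l], of T] by (simp add: T_def Int_absorb1)
    moreover have "T \<noteq> {}" using True by (auto simp: T_def)
    ultimately obtain a where a: "a \<in> T" "\<And>t. t \<in> T \<Longrightarrow> t \<le> a" using compact_attains_sup by metis
    have a': "0 \<le> a" "a \<le> l" "\<eta> a \<in> \<Phi>" using a(1) by (auto simp: T_def)
    have tail: "\<eta> t \<notin> \<Phi>" if "a < t" "t \<le> l" for t using a(2)[of t] that a' by (auto simp: T_def)
    \<comment> \<open>If the last such point is not in \<open>F\<close>, it lies outside the open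
      ball while all later points lie inside; by continuity it is on the sphere.\<close>
    have target: "\<iota> (\<eta> a) \<in> target F"
    proof (cases "\<eta> a \<in> \<iota> -` F")
      case False
      then have out: "R \<le> dist x\<^sub>0 (\<eta> a)" using a'(3) by (auto simp: \<Phi>_def)
      then have "a < l" using l_in a' by (cases "a = l") auto
      have "dist x\<^sub>0 (\<eta> a) \<le> R"
      proof (rule field_le_epsilon)
        fix e :: real assume "0 < e"
        define t where "t = min l (a + e)"
        have t: "a < t" "t \<le> l" "t - a \<le> e" using \<open>a < l\<close> \<open>0 < e\<close> by (auto simp: t_def)
        have "dist x\<^sub>0 (\<eta> a) \<le> dist x\<^sub>0 (\<eta> t) + dist (\<eta> t) (\<eta> a)" by (rule dist_triangle)
        also have "dist (\<eta> t) (\<eta> a) \<le> e"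
          using lipschitz_onD[OF lip, of t a] t a' by (simp add: dist_real_def)
        also have "dist x\<^sub>0 (\<eta> t) < R" using tail[OF t(1,2)] by (auto simp: \<Phi>_def)
        finally show "dist x\<^sub>0 (\<eta> a) \<le> R + e" by simp
      qed
      then show ?thesis using out isom by simp
    qed simp
    then have "\<iota> (\<eta> a) \<in> cball (\<iota> x\<^sub>0) R" using F(2) by (auto simp: isom)
    from reach_sym[OF reach_tail[OF a'(1,2) tail this]]
    have "potential F c (\<eta> l) \<le> c * I / c" using target c I(2) by (intro potential_le) auto
    then show ?thesis using c potential_range(1)[of "\<eta> 0"] by simp
  next
    case False
    then have in0: "\<eta> 0 \<in> ball x\<^sub>0 R" using l by (auto simp: \<Phi>_def)
    have r: "reach (c * I) (\<iota> (\<eta> l)) (\<iota> (\<eta> 0))"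
      using False l ball_vimage[OF in0] by (intro reach_sym[OF reach_tail]) auto
    have "potential F c (\<eta> l) - I \<le> z"
      if z: "z \<in> insert 1 (costs F c (\<eta> 0))" for z
    proof (cases "z = 1")
      case True
      then show ?thesis using potential_range(2)[of "\<eta> l"] I(2) by simp
    next
      case False
      with z have "z \<in> costs F c (\<eta> 0)" by blast
      then obtain t y where t: "z = t / c" "0 \<le> t" "y \<in> target F" "reach t (\<iota> (\<eta> 0)) y" by blast
      have "reach (c * I + t) (\<iota> (\<eta> l)) y" using r t c I(2) by (intro reach_trans) auto
      then have "potential F c (\<eta> l) \<le> (c * I + t) / c" using t c I(2) by (intro potential_le) auto
      moreover have "(c * I + t) / c = I + z" using t(1) c by (simp add: add_divide_distrib)
      ultimately show ?thesis by simp
    qed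
    then have "potential F c (\<eta> l) - I \<le> potential F c (\<eta> 0)"
      unfolding potential_def[of F c "\<eta> 0"] using in0 by (auto intro!: cInf_greatest)
    then show ?thesis by simp
  qed
qed (use I(2) potential_range(1)[of "\<eta> 0"] in \<open>simp add: potential_def\<close>)

lemma upper_gradient_potential: "upper_gradient UNIV (\<lambda>x. ereal (potential F c x)) potential_gradient"
  unfolding upper_gradient_def measurable_restrict_UNIV
proof (intro conjI potential_gradient_measurable allI impI)
  fix l \<gamma> assume arc: "arc_length_curve UNIV l (\<gamma> :: real \<Rightarrow> 'a)"
  then have l: "0 \<le> l" by (simp add: arc_length_curve_def)
  have lip: "1-lipschitz_on {0..l} \<gamma>" using arc by (rule lipschitz_on_arc_length_curve)
  show "ereal_gap (ereal (potential F c (\<gamma> 0))) (ereal (potential F c (\<gamma> l))) \<le> line_integral l \<gamma> potential_gradient"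
  proof (cases "line_integral l \<gamma> potential_gradient")
    case (real I)
    have lip': "1-lipschitz_on {0..l} (\<lambda>t. \<gamma> (l - t))"
    proof (rule lipschitz_onI)
      fix s t assume "s \<in> {0..l}" "t \<in> {0..l}"
      then show "dist (\<gamma> (l - s)) (\<gamma> (l - t)) \<le> 1 * dist s t"
        using lipschitz_onD[OF lip, of "l - s" "l - t"] by (simp add: dist_real_def abs_minus_commute)
    qed simp
    have "line_integral l (\<lambda>t. \<gamma> (l - t)) potential_gradient = line_integral l \<gamma> potential_gradient"
    proof -
      let ?\<gamma> = "\<lambda>t. \<gamma> (max 0 (min l t))"
      have "?\<gamma> \<in> borel_measurable borel" by (rule borel_measurable_lipschitz[OF lipschitz_on_clamp[OF lip l]])
      from line_integral_reverse[OF potential_gradient_measurable this, of l]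
      have "line_integral l (\<lambda>t. ?\<gamma> (l - t)) potential_gradient = line_integral l ?\<gamma> potential_gradient" .
      moreover have "line_integral l (\<lambda>t. ?\<gamma> (l - t)) potential_gradient = line_integral l (\<lambda>t. \<gamma> (l - t)) potential_gradient"
        "line_integral l ?\<gamma> potential_gradient = line_integral l \<gamma> potential_gradient"
        unfolding line_integral_def by (intro nn_integral_cong; auto split: split_indicator)+
      ultimately show ?thesis by simp
    qed
    then have "potential F c (\<gamma> 0) \<le> potential F c (\<gamma> l) + I"
      using potential_along_curve[OF lip' l, of I] real by simp
    moreover have "potential F c (\<gamma> l) \<le> potential F c (\<gamma> 0) + I"
      using potential_along_curve[OF lip l, of I] real by simp
    ultimately show ?thesis using real by (simp add: ereal_gap_real ennreal_leI abs_le_iff)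
  qed auto
qed

text \<open>The summand 1 accounts for the function, which is at most 1 and hence at most \<rho>^p;
  the summand \<open>(1 / c) powr p\<close> accounts for the gradient \<rho>/c. Both vanish on
  \<open>F\<close> and outside the ball, and the integral of \<rho>^p over the rest is the measure
  of \<open>- F\<close>.\<close>

lemma cap_test_exceptional: "cap_test p \<mu> (exceptional F c) ((1 + (1 / c) powr p) * measure N (- F))"
proof -
  have F': "- F \<in> sets borel" using F(1) by auto
  define S where "S = ball x\<^sub>0 R \<inter> \<iota> -` (- F)"
  have "open S" unfolding S_def using vimage_closed[OF F(1)] by (intro open_Int) (auto simp: vimage_Compl)
  then have S[measurable]: "S \<in> sets \<mu>" using borel_mu by auto
  have [measurable]: "(\<lambda>x. \<rho> (\<iota> x)) \<in> borel_measurable \<mu>" by (rule measurable_mu) measurable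
  interpret N: finite_measure N by (rule finite_N)
  have NS: "(\<integral>\<^sup>+x. ennpowr (\<rho> (\<iota> x)) p * indicator S x \<partial>\<mu>) = ennreal (measure N (- F))"
    unfolding S_def using emeasure_N[OF F'] by (simp add: N.emeasure_eq_measure)
  have rho1: "1 \<le> ennpowr (\<rho> z) p" for z
    using ennpowr_mono[OF p ge1[of z]] by (simp add: ennpowr_def)
  have "(\<integral>\<^sup>+x. ennreal (potential F c x powr p) \<partial>\<mu>) \<le> (\<integral>\<^sup>+x. ennpowr (\<rho> (\<iota> x)) p * indicator S x \<partial>\<mu>)"
  proof (rule nn_integral_mono)
    fix x
    show "ennreal (potential F c x powr p) \<le> ennpowr (\<rho> (\<iota> x)) p * indicator S x"
    proof (cases "x \<in> S")
      case True
      have "potential F c x powr p \<le> 1" using potential_range p by (intro powr_le1) auto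
      then have "ennreal (potential F c x powr p) \<le> 1" by simp
      also have "\<dots> \<le> ennpowr (\<rho> (\<iota> x)) p" by (rule rho1)
      finally show ?thesis using True by simp
    next
      case False
      have "potential F c x \<le> 0"
      proof (cases "x \<in> ball x\<^sub>0 R")
        case True
        then have "\<iota> x \<in> F" using False by (auto simp: S_def)
        then have "potential F c x \<le> 0 / c" using ball_vimage[OF True] by (intro potential_le[of 0]) (auto intro: reach_refl)
        then show ?thesis by simp
      qed (simp add: potential_def)
      then show ?thesis using potential_range(1)[of x] p by (simp add: antisym)
    qed
  qed
  moreover have "(\<integral>\<^sup>+x. ennpowr (potential_gradient x) p \<partial>\<mu>) = ennreal ((1 / c) powr p) * ennreal (measure N (- F))"
  proof -
    have "ennpowr (potential_gradient x) p = ennreal ((1 / c) powr p) * (ennpowr (\<rho> (\<iota> x)) p * indicator S x)" for x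
      using c by (auto simp: potential_gradient_def S_def ennpowr_mult_ennreal ennpowr_0 mult.commute)
    then show ?thesis unfolding NS[symmetric] by (simp add: nn_integral_cmult)
  qed
  ultimately have "(\<integral>\<^sup>+x. ennreal (potential F c x powr p) \<partial>\<mu>) + (\<integral>\<^sup>+x. ennpowr (potential_gradient x) p \<partial>\<mu>) \<le>
      ennreal (measure N (- F)) + ennreal ((1 / c) powr p) * ennreal (measure N (- F))"
    using NS by (intro add_mono) auto
  also have "\<dots> = ennreal ((1 + (1 / c) powr p) * measure N (- F))"
    by (simp add: distrib_right ennreal_plus ennreal_mult)
  finally show ?thesis
    unfolding cap_test_def using upper_gradient_potential potential_exceptional potential_range
    by (intro exI[of _ "potential F c"] exI[of _ potential_gradient])
       (auto intro: measurable_mu)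
qed

end

end

subsection \<open>Small oscillation outside open sets of small capacity\<close>

lemma cap_test_mono: "cap_test p \<mu> E e \<Longrightarrow> e \<le> e' \<Longrightarrow> cap_test p \<mu> E e'"
  unfolding cap_test_def by (meson ennreal_leI order_trans)

text \<open>The radius may depend on the point. Each \<delta> is allowed its own exceptional set;
  off the union of these sets, arbitrarily small \<delta> give continuity.\<close>

definition nearly_continuous :: "real \<Rightarrow> ('a::metric_space \<Rightarrow> ereal) \<Rightarrow> 'a set \<Rightarrow> bool" where
  "nearly_continuous \<delta> u S \<longleftrightarrow> (\<forall>x\<in>S. \<bar>u x\<bar> \<noteq> \<infinity> \<and>
     (\<exists>r>0. \<forall>x'\<in>S. dist x' x < r \<longrightarrow> \<bar>real_of_ereal (u x') - real_of_ereal (u x)\<bar> \<le> \<delta>))"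

lemma nearly_continuousE:
  assumes "nearly_continuous \<delta> u S" "x \<in> S"
  obtains r where "\<bar>u x\<bar> \<noteq> \<infinity>" "0 < r"
    "\<And>x'. x' \<in> S \<Longrightarrow> dist x' x < r \<Longrightarrow> \<bar>real_of_ereal (u x') - real_of_ereal (u x)\<bar> \<le> \<delta>"
  using bspec[OF assms(1)[unfolded nearly_continuous_def] assms(2)] by (elim conjE exE) simp

lemma nearly_continuous_subset:
  assumes S: "nearly_continuous \<delta> u S" and "T \<subseteq> S"
  shows "nearly_continuous \<delta> u T"
  unfolding nearly_continuous_def[of \<delta> u T]
proof (rule ballI)
  fix x assume "x \<in> T"
  then have "x \<in> S" using \<open>T \<subseteq> S\<close> by blast
  then obtain r where "\<bar>u x\<bar> \<noteq> \<infinity>" "0 < r"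
    "\<And>x'. x' \<in> S \<Longrightarrow> dist x' x < r \<Longrightarrow> \<bar>real_of_ereal (u x') - real_of_ereal (u x)\<bar> \<le> \<delta>"
    by (rule nearly_continuousE[OF S]) (rule that)
  then show "\<bar>u x\<bar> \<noteq> \<infinity> \<and> (\<exists>r>0. \<forall>x'\<in>T. dist x' x < r \<longrightarrow>
      \<bar>real_of_ereal (u x') - real_of_ereal (u x)\<bar> \<le> \<delta>)"
    using \<open>T \<subseteq> S\<close> by (intro conjI exI[of _ r]) auto
qed

text \<open>\<open>loc\<close> is the conclusion of \<open>reach_local\<close>, with a
  \<open>w\<close> that depends on \<open>x\<close>. The function \<open>h\<close> is tied to
  \<open>u\<close> only at points of X in the ball and off a null set; its values at points outside
  X carry no information about \<open>u\<close>.\<close>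

locale oscillation_setting = local_setting \<iota> x\<^sub>0 R \<rho> \<mu> p N
  for \<iota> :: "'a::metric_space \<Rightarrow> 'b::metric_space" and x\<^sub>0 R \<rho> \<mu> p N +
  fixes u :: "'a \<Rightarrow> ereal" and h :: "'b \<Rightarrow> real" and Z\<^sub>0 :: "'b set"
  assumes h_meas[measurable]: "h \<in> borel_measurable borel"
    and null_borel: "Z\<^sub>0 \<in> sets borel" and null: "emeasure N Z\<^sub>0 = 0"
    and u_h: "x \<in> ball x\<^sub>0 R \<Longrightarrow> \<iota> x \<notin> Z\<^sub>0 \<Longrightarrow> u x = ereal (h (\<iota> x))"
    and loc: "\<iota> x \<in> cball (\<iota> x\<^sub>0) R \<Longrightarrow> \<exists>w>0. \<forall>t<w. \<forall>y. reach t (\<iota> x) y \<longrightarrow>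
        (\<exists>x'. y = \<iota> x' \<and> (x' = x \<or> ereal_gap (u x) (u x') \<le> ennreal t))"
begin

section \<open>Lusin sets and jump sets\<close>

definition regular_set :: "'b set" where
  "regular_set = ball (\<iota> x\<^sub>0) R - Z\<^sub>0"

lemma regular_set_borel: "regular_set \<in> sets borel"
  unfolding regular_set_def using null_borel by (intro sets.Diff) auto

lemma u_regular: "\<iota> x \<in> regular_set \<Longrightarrow> u x = ereal (h (\<iota> x))"
  using u_h[of x] by (auto simp: regular_set_def isom)

text \<open>\<open>N\<close> has no mass outside the open ball or on \<open>Z\<^sub>0\<close>.
  Covering most of \<open>regular_set\<close> thus bounds the quantity that occurs in
  \<open>cap_test_exceptional\<close>.\<close>

lemma measure_compl_regular_subset:
  assumes "F \<in> sets borel" "F \<subseteq> regular_set"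
  shows "measure N (- F) = measure N (regular_set - F)"
proof -
  interpret N: finite_measure N by (rule finite_N)
  have "emeasure N (- ball (\<iota> x\<^sub>0) R) = (\<integral>\<^sup>+x. ennpowr (\<rho> (\<iota> x)) p * indicator (ball x\<^sub>0 R \<inter> \<iota> -` (- ball (\<iota> x\<^sub>0) R)) x \<partial>\<mu>)"
    by (rule emeasure_N) simp
  also have "ball x\<^sub>0 R \<inter> \<iota> -` (- ball (\<iota> x\<^sub>0) R) = {}" by (auto simp: isom)
  finally have 1: "- ball (\<iota> x\<^sub>0) R \<in> null_sets N" by (auto simp: null_sets_def sets_N)
  have 2: "Z\<^sub>0 \<in> null_sets N" using null null_borel by (auto simp: null_sets_def sets_N)
  have "AE x in N. x \<notin> (- ball (\<iota> x\<^sub>0) R) \<union> Z\<^sub>0" using null_sets.Un[OF 1 2] by (rule AE_not_in)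
  then have "AE x in N. (x \<in> - F) = (x \<in> regular_set - F)"
    by eventually_elim (auto simp: regular_set_def)
  then show ?thesis
    using assms regular_set_borel by (intro N.finite_measure_eq_AE) (auto simp: sets_N)
qed

lemma lusin_h:
  assumes "0 < e"
  shows "\<exists>F. closed F \<and> F \<subseteq> regular_set \<and> measure N (regular_set - F) < e \<and> continuous_on F h"
proof -
  obtain q :: "nat \<Rightarrow> real" where q: "range q = \<rat>" by (rule enumerate_rationals)
  have E: "{x. q n < h x} \<in> sets borel" for n by measurable
  obtain F where F: "closed F" "F \<subseteq> regular_set" "measure N (regular_set - F) < e"
    "\<And>n. closed (F \<inter> {x. q n < h x})" "\<And>n. closed (F - {x. q n < h x})"
    by (rule lusin_family[OF finite_N sets_N regular_set_borel E assms]) (rule that)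
  have "continuous_on F h"
  proof (rule continuous_on_rational_superlevel)
    fix r :: real assume "r \<in> \<rat>"
    then obtain n where "r = q n" using q by (metis imageE)
    then show "closed (F \<inter> {x. r < h x})" "closed (F - {x. r < h x})" using F(4,5) by auto
  qed
  then show ?thesis using F by blast
qed

text \<open>One sequence is fixed before \<delta> and the costs are chosen. End points are then
  confined to countably many compact sets on which \<open>h\<close> is continuous, and this is what
  keeps the jump sets Borel.\<close>

definition lusin_set :: "nat \<Rightarrow> 'b set" where
  "lusin_set n = (SOME F. closed F \<and> F \<subseteq> regular_set \<and> measure N (regular_set - F) < 1 / Suc n \<and> continuous_on F h)"

lemma lusin_set:
  "closed (lusin_set n)" "lusin_set n \<subseteq> regular_set" "measure N (regular_set - lusin_set n) < 1 / Suc n"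
  "continuous_on (lusin_set n) h"
  using someI_ex[OF lusin_h[of "1 / Suc n"]] unfolding lusin_set_def by auto

lemma compact_lusin_subset: "closed F \<Longrightarrow> F \<subseteq> regular_set \<Longrightarrow> compact F"
proof -
  assume F: "closed F" "F \<subseteq> regular_set"
  have "compact (cball (\<iota> x\<^sub>0) R \<inter> F)" by (rule compact_Int_closed[OF compact_Z F(1)])
  moreover have "cball (\<iota> x\<^sub>0) R \<inter> F = F" using F(2) by (auto simp: regular_set_def)
  ultimately show ?thesis by simp
qed

definition jump_pairs :: "real \<Rightarrow> nat \<Rightarrow> nat \<Rightarrow> ('b \<times> 'b) set" where
  "jump_pairs \<delta> n m = {(a, b) \<in> lusin_set n \<times> lusin_set m. \<delta> \<le> \<bar>h a - h b\<bar>}"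

text \<open>An F-sigma set: \<open>jump_pairs\<close> is compact and \<open>reach\<close> is closed,
  so each member of the union is closed. Being Borel, it can be fed to
  \<open>lusin_family\<close>.\<close>

definition jump_set :: "real \<Rightarrow> real \<Rightarrow> 'b set" where
  "jump_set \<delta> t = (\<Union>n m. {x. \<exists>(a, b)\<in>jump_pairs \<delta> n m. reach t x a \<and> reach t x b})"

lemma compact_jump_pairs: "compact (jump_pairs \<delta> n m)"
proof -
  let ?K = "lusin_set n \<times> lusin_set m"
  have K: "compact ?K" using lusin_set(1,2) by (intro compact_Times compact_lusin_subset)
  have "continuous_on ?K (\<lambda>z. h (fst z))" "continuous_on ?K (\<lambda>z. h (snd z))"
    by (rule continuous_on_compose2[OF lusin_set(4)]; auto intro!: continuous_intros)+
  then have "continuous_on ?K (\<lambda>z. \<bar>h (fst z) - h (snd z)\<bar>)" by (intro continuous_intros)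
  then have "closed (?K \<inter> (\<lambda>z. \<bar>h (fst z) - h (snd z)\<bar>) -` {\<delta>..})"
    by (rule continuous_closed_preimage) (use lusin_set(1) in \<open>auto intro: closed_Times\<close>)
  from compact_Int_closed[OF K this]
  have "compact (?K \<inter> (?K \<inter> (\<lambda>z. \<bar>h (fst z) - h (snd z)\<bar>) -` {\<delta>..}))" .
  moreover have "?K \<inter> (?K \<inter> (\<lambda>z. \<bar>h (fst z) - h (snd z)\<bar>) -` {\<delta>..}) = jump_pairs \<delta> n m"
    by (auto simp: jump_pairs_def)
  ultimately show ?thesis by (simp only:)
qed

lemma jump_set_borel: "jump_set \<delta> t \<in> sets borel"
  unfolding jump_set_def
  by (intro sets.countable_UN'' borel_closed closed_reach_set compact_jump_pairs) auto

lemma jump_setI: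
  assumes "a \<in> lusin_set n" "b \<in> lusin_set m" "\<delta> \<le> \<bar>h a - h b\<bar>" "reach t x a" "reach t x b"
  shows "x \<in> jump_set \<delta> t"
  using assms unfolding jump_set_def jump_pairs_def by blast

lemma jump_setE:
  assumes "x \<in> jump_set \<delta> t"
  obtains n m a b where "a \<in> lusin_set n" "b \<in> lusin_set m" "\<delta> \<le> \<bar>h a - h b\<bar>" "reach t x a" "reach t x b"
  using assms unfolding jump_set_def jump_pairs_def by blast

lemma jump_set_reach:
  assumes "x \<in> jump_set \<delta> t" "reach s x' x" "0 \<le> s" "0 \<le> t"
  shows "x' \<in> jump_set \<delta> (s + t)"
proof -
  obtain n m a b where ab: "a \<in> lusin_set n" "b \<in> lusin_set m" "\<delta> \<le> \<bar>h a - h b\<bar>" "reach t x a" "reach t x b"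
    using assms(1) by (rule jump_setE)
  show ?thesis
    by (rule jump_setI[OF ab(1-3)]; rule reach_trans[OF assms(2)]) (use ab assms(3,4) in auto)
qed

definition scale :: "nat \<Rightarrow> real" where "scale k = 1 / Suc k"

lemma scale_pos: "0 < scale k" by (simp add: scale_def)

lemma scale_small: "0 < e \<Longrightarrow> \<exists>k. scale k < e"
  using reals_Archimedean[of e] by (simp add: scale_def inverse_eq_divide)

text \<open>\<open>lusin_family\<close> is applied inside one \<open>lusin_set\<close>, this time to
  jump sets instead of superlevel sets. The cost \<open>2 * scale j\<close> pays for going back from
  a point of \<open>F\<close> to the point that reached it and for going on from there, at cost
  \<open>scale j\<close> each.\<close>

lemma fine_set_exists:
  assumes "0 < e"
  shows "\<exists>F. closed F \<and> (\<exists>n. F \<subseteq> lusin_set n) \<and> measure N (- F) < e \<and> (\<forall>j. closed (F \<inter> jump_set \<delta> (2 * scale j)))"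
proof -
  interpret N: finite_measure N by (rule finite_N)
  obtain n where n: "scale n < e / 2" using scale_small[of "e/2"] assms by auto
  have L: "lusin_set n \<in> sets borel" using lusin_set(1) by auto
  have E: "jump_set \<delta> (2 * scale j) \<in> sets borel" for j by (rule jump_set_borel)
  have e2: "0 < e / 2" using assms by simp
  obtain F where F: "closed F" "F \<subseteq> lusin_set n" "measure N (lusin_set n - F) < e/2"
    "\<And>j. closed (F \<inter> jump_set \<delta> (2 * scale j))" "\<And>j. closed (F - jump_set \<delta> (2 * scale j))"
    by (rule lusin_family[OF finite_N sets_N L E e2]) (rule that)
  have F': "F \<in> sets borel" using F(1) by auto
  have "measure N (- F) = measure N (regular_set - F)"
    using F(2) lusin_set(2)[of n] F' by (intro measure_compl_regular_subset) auto
  also have "\<dots> \<le> measure N ((regular_set - lusin_set n) \<union> (lusin_set n - F))"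
    using F' regular_set_borel lusin_set(1)[of n] by (intro N.finite_measure_mono) (auto simp: sets_N)
  also have "\<dots> \<le> measure N (regular_set - lusin_set n) + measure N (lusin_set n - F)"
    using F' regular_set_borel lusin_set(1)[of n] by (intro measure_Un_le) (auto simp: sets_N)
  also have "\<dots> < e" using F(3) lusin_set(3)[of n] n by (simp add: scale_def)
  finally show ?thesis using F by blast
qed

lemma small_oscillation:
  assumes "0 < e" "0 < \<delta>"
  shows "\<exists>G. open G \<and> cap_test p \<mu> G e \<and> nearly_continuous (4 * \<delta>) u (ball x\<^sub>0 (R/2) - G)"
proof -
  interpret N: finite_measure N by (rule finite_N)
  \<comment> \<open>The tolerance cancels the factor of \<open>cap_test_exceptional\<close> at cost
    \<open>scale k\<close> and leaves \<open>e * (1/2)^Suc k\<close>, which sums to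
    \<open>e\<close>.\<close>
  define \<eta> where "\<eta> k = e * (1/2)^Suc k / (1 + (1 / scale k) powr p)" for k
  have \<eta>: "0 < \<eta> k" for k
    unfolding \<eta>_def using assms(1) by (intro divide_pos_pos mult_pos_pos) (auto intro: add_pos_nonneg)
  define F where "F k = (SOME F. closed F \<and> (\<exists>n. F \<subseteq> lusin_set n) \<and> measure N (- F) < \<eta> k \<and>
      (\<forall>j. closed (F \<inter> jump_set \<delta> (2 * scale j))))" for k
  have F: "closed (F k)" "\<exists>n. F k \<subseteq> lusin_set n" "measure N (- F k) < \<eta> k"
    "closed (F k \<inter> jump_set \<delta> (2 * scale j))" for k j
    using someI_ex[OF fine_set_exists[OF \<eta>[of k], of \<delta>]] unfolding F_def by auto
  have F_reg: "F k \<subseteq> regular_set" for k using F(2)[of k] lusin_set(2) by blast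
  have F_ball: "F k \<subseteq> cball (\<iota> x\<^sub>0) R" for k using F_reg[of k] by (auto simp: regular_set_def)
  define G where "G = (\<Union>k. exceptional (F k) (scale k))"
  have "open G" unfolding G_def by (intro open_UN ballI open_exceptional F F_ball)
  have "cap_test p \<mu> (exceptional (F k) (scale k)) (e * (1/2)^Suc k)" for k
  proof (rule cap_test_mono[OF cap_test_exceptional[OF F(1) F_ball scale_pos]])
    have D: "0 < 1 + (1 / scale k) powr p" by (auto intro: add_pos_nonneg)
    have "(1 + (1 / scale k) powr p) * measure N (- F k) \<le> (1 + (1 / scale k) powr p) * \<eta> k"
      using F(3)[of k] D by (intro mult_left_mono) auto
    also have "\<dots> = e * (1/2)^Suc k" unfolding \<eta>_def
      by (simp only: times_divide_eq_right nonzero_mult_div_cancel_left[OF D[THEN less_imp_neq, symmetric]])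
    finally show "(1 + (1 / scale k) powr p) * measure N (- F k) \<le> e * (1/2)^Suc k" .
  qed
  moreover have sums: "(\<lambda>k. e * (1/2)^Suc k) sums (e * 1)" using power_half_series by (rule sums_mult)
  ultimately have capG: "cap_test p \<mu> G e"
    unfolding G_def using cap_test_UN[OF p, of \<mu> "\<lambda>k. exceptional (F k) (scale k)" "\<lambda>k. e * (1/2)^Suc k"]
      borel_mu space_mu assms(1) by (simp add: sums_iff)
  let ?U = "ball x\<^sub>0 (R/2) - G"
  have U: "\<iota> x \<in> cball (\<iota> x\<^sub>0) R" "x \<in> ball x\<^sub>0 R" if "x \<in> ?U" for x using that R isom[of x\<^sub>0 x] by auto
  \<comment> \<open>From the ball of radius \<open>R/2\<close> the sphere is more than
    \<open>R/2\<close> away, and distance is at most cost. A point that is not exceptional at a cost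
    below \<open>R/2\<close> therefore reaches \<open>F k\<close> itself.\<close>
  have approx: "\<exists>y\<in>F k. reach (scale k) (\<iota> x) y" if x: "x \<in> ?U" and k: "scale k < R/2" for x k
  proof -
    have "x \<notin> exceptional (F k) (scale k)" using x by (auto simp: G_def)
    then obtain y where y: "y \<in> target (F k)" "reach (scale k) (\<iota> x) y"
      using U(2)[OF x] unfolding exceptional_def by blast
    have "y \<notin> sphere (\<iota> x\<^sub>0) R"
    proof
      assume "y \<in> sphere (\<iota> x\<^sub>0) R"
      then have "R \<le> dist (\<iota> x\<^sub>0) (\<iota> x) + dist (\<iota> x) y" by (metis dist_triangle mem_sphere)
      moreover have "dist (\<iota> x) y \<le> scale k" using reach_dist_le[OF y(2)] scale_pos[of k] by simp
      ultimately show False using x k isom[of x\<^sub>0 x] by auto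
    qed
    then show ?thesis using y by blast
  qed
  \<comment> \<open>\<open>w\<close> is the threshold of \<open>x\<close> alone. The maximum with 0
    covers negative \<open>t\<close>, for which \<open>ennreal t\<close> is 0.\<close>
  have close: "\<exists>w>0. \<forall>t<w. \<forall>y. y \<in> regular_set \<and> reach t (\<iota> x) y \<longrightarrow> \<bar>u x\<bar> \<noteq> \<infinity> \<and> \<bar>real_of_ereal (u x) - h y\<bar> \<le> max 0 t"
    if x: "x \<in> ?U" for x
  proof -
    obtain w where w: "w > 0" "\<forall>t<w. \<forall>y. reach t (\<iota> x) y \<longrightarrow>
        (\<exists>x'. y = \<iota> x' \<and> (x' = x \<or> ereal_gap (u x) (u x') \<le> ennreal t))" using loc[OF U(1)[OF x]] by blast
    have bound: "\<bar>u x\<bar> \<noteq> \<infinity> \<and> \<bar>real_of_ereal (u x) - h y\<bar> \<le> max 0 t" if t: "t < w" "y \<in> regular_set" "reach t (\<iota> x) y" for t y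
    proof -
      obtain x' where x': "y = \<iota> x'" "x' = x \<or> ereal_gap (u x) (u x') \<le> ennreal t" using w t by blast
      have ux': "u x' = ereal (h y)" using u_regular[of x'] x' t by simp
      from x'(2) show ?thesis
      proof
        assume "x' = x" then show ?thesis using ux' by simp
      next
        assume g: "ereal_gap (u x) (u x') \<le> ennreal t"
        then have fin: "\<bar>u x\<bar> \<noteq> \<infinity>" by (auto simp: ereal_gap_def top_unique)
        then obtain s where s: "u x = ereal s" by (cases "u x") auto
        then have "ennreal \<bar>s - h y\<bar> \<le> ennreal t" using g ux' by (simp add: ereal_gap_real)
        then have "\<bar>s - h y\<bar> \<le> max 0 t" by (cases "0 \<le> t") (auto simp: ennreal_neg)
        then show ?thesis using fin s by simp
      qed
    qed
    show ?thesis
    proof (rule exI[of _ w], rule conjI[OF w(1)], intro allI impI, elim conjE)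
      fix t y assume "t < w" "y \<in> regular_set" "reach t (\<iota> x) y"
      then show "\<bar>u x\<bar> \<noteq> \<infinity> \<and> \<bar>real_of_ereal (u x) - h y\<bar> \<le> max 0 t" by (rule bound)
    qed
  qed
  \<comment> \<open>Here \<open>k\<close> depends on \<open>x\<close>, since \<open>scale k\<close>
    must be below the threshold of \<open>x\<close>. This is why \<open>G\<close> removes the
    exceptional sets of all \<open>F k\<close> at once.\<close>
  have approx_value: "\<exists>k. \<exists>y\<in>F k. scale k < s \<and> reach (scale k) (\<iota> x) y \<and> \<bar>u x\<bar> \<noteq> \<infinity> \<and> \<bar>real_of_ereal (u x) - h y\<bar> \<le> s"
    if x: "x \<in> ?U" and s: "0 < s" for x s
  proof -
    obtain w where w: "w > 0" "\<forall>t<w. \<forall>y. y \<in> regular_set \<and> reach t (\<iota> x) y \<longrightarrow> \<bar>u x\<bar> \<noteq> \<infinity> \<and> \<bar>real_of_ereal (u x) - h y\<bar> \<le> max 0 t"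
      using close[OF x] by blast
    obtain k where k: "scale k < min s (min w (R/2))" using scale_small[of "min s (min w (R/2))"] s w(1) R by auto
    then obtain y where y: "y \<in> F k" "reach (scale k) (\<iota> x) y" using approx[OF x] by auto
    then have "\<bar>u x\<bar> \<noteq> \<infinity> \<and> \<bar>real_of_ereal (u x) - h y\<bar> \<le> max 0 (scale k)" using w(2) k F_reg[of k] by auto
    then show ?thesis using y k scale_pos[of k] by (intro exI[of _ k] bexI[of _ y]) auto
  qed
  have osc: "\<bar>u x\<bar> \<noteq> \<infinity> \<and> (\<exists>r>0. \<forall>x'\<in>?U. dist x' x < r \<longrightarrow> \<bar>real_of_ereal (u x') - real_of_ereal (u x)\<bar> \<le> 4 * \<delta>)"
    if x: "x \<in> ?U" for x
  proof
    show "\<bar>u x\<bar> \<noteq> \<infinity>" using approx_value[OF x zero_less_one] by (elim exE bexE conjE)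
    obtain w where w: "w > 0" "\<forall>t<w. \<forall>y. y \<in> regular_set \<and> reach t (\<iota> x) y \<longrightarrow> \<bar>u x\<bar> \<noteq> \<infinity> \<and> \<bar>real_of_ereal (u x) - h y\<bar> \<le> max 0 t"
      using close[OF x] by blast
    have val: "\<bar>real_of_ereal (u x) - h y\<bar> \<le> t" if "t < w" "0 < t" "y \<in> regular_set" "reach t (\<iota> x) y" for t y
    proof -
      have "\<bar>real_of_ereal (u x) - h y\<bar> \<le> max 0 t"
        using w(2)[rule_format, OF that(1) conjI[OF that(3,4)]] by (rule conjunct2)
      then show ?thesis using that(2) by simp
    qed
    \<comment> \<open>\<open>3 * c < w\<close> puts curves of cost \<open>3 * c\<close> from
      \<open>x\<close> under its threshold, and \<open>6 * c < \<delta>\<close> then excludes a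
      jump, because both values of \<open>h\<close> are within \<open>3 * c\<close> of the value of
      \<open>u\<close> at \<open>x\<close>.\<close>
    obtain k where k': "scale k < min (min (w/3) (\<delta>/6)) (R/2)"
      using scale_small[of "min (min (w/3) (\<delta>/6)) (R/2)"] assms(2) w(1) R by auto
    define c where "c = scale k"
    have c: "0 < c" "3 * c < w" "6 * c < \<delta>" "c < R/2" using k' scale_pos[of k] by (auto simp: c_def)
    have not_jump: "\<iota> x \<notin> jump_set \<delta> (3 * c)"
    proof
      assume "\<iota> x \<in> jump_set \<delta> (3 * c)"
      then obtain n m a b where ab: "a \<in> lusin_set n" "b \<in> lusin_set m" "\<delta> \<le> \<bar>h a - h b\<bar>"
        "reach (3 * c) (\<iota> x) a" "reach (3 * c) (\<iota> x) b" by (rule jump_setE)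
      then have "\<bar>real_of_ereal (u x) - h a\<bar> \<le> 3 * c" "\<bar>real_of_ereal (u x) - h b\<bar> \<le> 3 * c"
        using c by (auto intro!: val subsetD[OF lusin_set(2)])
      then show False using ab(3) c(3) by linarith
    qed
    show "\<exists>r>0. \<forall>x'\<in>?U. dist x' x < r \<longrightarrow> \<bar>real_of_ereal (u x') - real_of_ereal (u x)\<bar> \<le> 4 * \<delta>"
    proof (rule ccontr)
      assume neg: "\<not> ?thesis"
      have "\<forall>i. \<exists>x'. x' \<in> ?U \<and> dist x' x < inverse (real (Suc i)) \<and> \<not> \<bar>real_of_ereal (u x') - real_of_ereal (u x)\<bar> \<le> 4 * \<delta>"
        using neg by (meson inverse_positive_iff_positive of_nat_0_less_iff zero_less_Suc)
      from choice[OF this] obtain xs where xs: "\<And>i. xs i \<in> ?U" "\<And>i. dist (xs i) x < inverse (real (Suc i))"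
        "\<And>i. \<not> \<bar>real_of_ereal (u (xs i)) - real_of_ereal (u x)\<bar> \<le> 4 * \<delta>" by blast
      have "(\<lambda>i. dist (\<iota> (xs i)) (\<iota> x)) \<longlonglongrightarrow> 0"
        by (rule Lim_null_comparison[OF _ LIMSEQ_inverse_real_of_nat])
           (use xs(2) isom in \<open>auto intro!: always_eventually less_imp_le simp del: of_nat_Suc\<close>)
      then have lim: "(\<lambda>i. \<iota> (xs i)) \<longlonglongrightarrow> \<iota> x" using tendsto_dist_iff by blast
      have "\<forall>i. \<exists>y. y \<in> F k \<and> reach c (\<iota> (xs i)) y" using approx[OF xs(1), of k] c(4) by (auto simp: c_def)
      from choice[OF this] obtain y where y: "\<And>i. y i \<in> F k" "\<And>i. reach c (\<iota> (xs i)) (y i)" by blast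
      have "compact (F k)" using F(1) F_reg by (rule compact_lusin_subset)
      from reach_limit_compact[OF this y lim tendsto_const]
      obtain r y' where r: "strict_mono r" "y' \<in> F k" "(\<lambda>i. y (r i)) \<longlonglongrightarrow> y'" "reach c (\<iota> x) y'" by blast
      have uy': "\<bar>real_of_ereal (u x) - h y'\<bar> \<le> c"
        using c r(2,4) F_reg[of k] by (auto intro!: val)
      \<comment> \<open>A jump seen from \<open>y'\<close> at cost \<open>2 * c\<close> would be
        seen from \<open>x\<close> at cost \<open>3 * c\<close>. As \<open>F k\<close> meets this
        jump set in a closed set, the points \<open>y (r i)\<close> near \<open>y'\<close> avoid it
        too.\<close>
      have "y' \<notin> jump_set \<delta> (2 * c)"
      proof
        assume "y' \<in> jump_set \<delta> (2 * c)"
        from jump_set_reach[OF this r(4)] c(1) have "\<iota> x \<in> jump_set \<delta> (3 * c)" by simp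
        then show False using not_jump by simp
      qed
      then have "y' \<in> - (F k \<inter> jump_set \<delta> (2 * c))" by simp
      moreover have "open (- (F k \<inter> jump_set \<delta> (2 * c)))" unfolding c_def by (rule open_Compl[OF F(4)])
      ultimately have ev1: "eventually (\<lambda>i. y (r i) \<in> - (F k \<inter> jump_set \<delta> (2 * c))) sequentially"
        using topological_tendstoD[OF r(3)] by blast
      obtain n where n: "F k \<subseteq> lusin_set n" using F(2) by blast
      have "continuous_on (F k) h" using lusin_set(4) n by (rule continuous_on_subset)
      then have "(\<lambda>i. h (y (r i))) \<longlonglongrightarrow> h y'"
        by (rule continuous_on_tendsto_compose[OF _ r(3,2)]) (use y(1) in auto)
      then have ev2: "eventually (\<lambda>i. dist (h (y (r i))) (h y') < \<delta>) sequentially" using assms(2) by (rule tendstoD)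
      obtain i where i: "y (r i) \<in> - (F k \<inter> jump_set \<delta> (2 * c))" "dist (h (y (r i))) (h y') < \<delta>"
        using eventually_happens'[OF sequentially_bot eventually_conj[OF ev1 ev2]] by blast
      \<comment> \<open>\<open>c\<close> may exceed the threshold of \<open>xs (r i)\<close>, so
        \<open>y (r i)\<close> says nothing about \<open>u\<close> there; the end point
        \<open>z\<close> of a cheaper curve, with \<open>k2\<close> depending on \<open>i\<close>,
        does.\<close>
      obtain k2 z where z: "z \<in> F k2" "scale k2 < c" "reach (scale k2) (\<iota> (xs (r i))) z"
        "\<bar>real_of_ereal (u (xs (r i))) - h z\<bar> \<le> c" using approx_value[OF xs(1) c(1)] by blast
      have "\<bar>h (y (r i)) - h z\<bar> < \<delta>"
      proof (rule ccontr)
        assume "\<not> ?thesis"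
        then have d: "\<delta> \<le> \<bar>h (y (r i)) - h z\<bar>" by simp
        obtain m where m: "F k2 \<subseteq> lusin_set m" using F(2) by blast
        have "\<iota> (xs (r i)) \<in> jump_set \<delta> c"
          by (rule jump_setI[OF _ _ d y(2) reach_mono[OF z(3)]]) (use n m y(1) z in auto)
        from jump_set_reach[OF this reach_sym[OF y(2)]] c(1) have "y (r i) \<in> jump_set \<delta> (2 * c)" by simp
        then show False using i(1) y(1) by blast
      qed
      \<comment> \<open>From \<open>u\<close> at \<open>xs (r i)\<close> through \<open>h z\<close>,
        \<open>h (y (r i))\<close> and \<open>h y'\<close> to \<open>u\<close> at \<open>x\<close>
        the differences are at most \<open>c\<close>, below \<delta>, below \<delta> and at most
        \<open>c\<close>: in total less than \<open>4 * \<delta>\<close>.\<close>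
      then show False using z(4) i(2) uy' c xs(3)[of "r i"] by (simp add: dist_real_def abs_le_iff abs_less_iff)
    qed
  qed
  show ?thesis
    unfolding nearly_continuous_def
    by (rule exI[of _ G], rule conjI[OF \<open>open G\<close> conjI[OF capG ballI]], rule osc)
qed

end

subsection \<open>Separability and compactness\<close>

lemma metric_measure_spaceD:
  assumes "metric_measure_space \<mu>"
  shows "sets borel \<subseteq> sets \<mu>" "space \<mu> = UNIV"
    "0 < r \<Longrightarrow> 0 < emeasure \<mu> (ball x r)" "emeasure \<mu> (ball x r) < \<infinity>"
proof -
  obtain \<nu> where \<nu>: "sets \<nu> = sets borel" "\<mu> = completion \<nu>"
    using assms unfolding metric_measure_space_def complete_borel_measure_def by blast
  show "sets borel \<subseteq> sets \<mu>" using \<nu> by (auto intro: sets_completionI_sets)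
  show "space \<mu> = UNIV" using \<nu> sets_eq_imp_space_eq[OF \<nu>(1)] by simp
  show "0 < r \<Longrightarrow> 0 < emeasure \<mu> (ball x r)" using assms unfolding metric_measure_space_def by blast
  show "emeasure \<mu> (ball x r) < \<infinity>"
    using assms unfolding metric_measure_space_def by (cases "0 < r") (auto simp: ball_empty)
qed

definition separated :: "real \<Rightarrow> 'a::metric_space set \<Rightarrow> bool" where
  "separated e A \<longleftrightarrow> (\<forall>a\<in>A. \<forall>b\<in>A. a \<noteq> b \<longrightarrow> e \<le> dist a b)"

lemma maximal_separated_subset:
  obtains A where "A \<subseteq> S" "separated e A" "\<And>x. x \<in> S \<Longrightarrow> 0 < e \<Longrightarrow> \<exists>a\<in>A. dist a x < e"
proof -
  let ?\<A> = "{A. A \<subseteq> S \<and> separated e A}"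
  have "\<exists>M\<in>?\<A>. \<forall>X\<in>?\<A>. M \<subseteq> X \<longrightarrow> X = M"
  proof (rule subset_Zorn)
    fix C assume C: "subset.chain ?\<A> C"
    have "separated e (\<Union>C)"
      unfolding separated_def
    proof (intro ballI impI)
      fix a b assume "a \<in> \<Union>C" "b \<in> \<Union>C" "a \<noteq> b"
      then obtain X Y where XY: "X \<in> C" "a \<in> X" "Y \<in> C" "b \<in> Y" by blast
      have "X \<subseteq> Y \<or> Y \<subseteq> X" using C XY(1,3) by (rule subset_chain_def[THEN iffD1, THEN conjunct2, rule_format])
      then have "a \<in> X \<union> Y \<and> b \<in> X \<union> Y \<and> X \<union> Y \<in> {X, Y}" using XY by auto
      moreover have "separated e X" "separated e Y" using C XY by (auto simp: subset_chain_def)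
      ultimately show "e \<le> dist a b" using \<open>a \<noteq> b\<close> by (auto simp: separated_def)
    qed
    then show "\<exists>U\<in>?\<A>. \<forall>X\<in>C. X \<subseteq> U" using C by (intro bexI[of _ "\<Union>C"]) (auto simp: subset_chain_def)
  qed
  then obtain M where M0: "M \<in> ?\<A>" "\<forall>X\<in>?\<A>. M \<subseteq> X \<longrightarrow> X = M" by (rule bexE)
  then have M: "M \<subseteq> S" "separated e M" "\<And>X. X \<subseteq> S \<Longrightarrow> separated e X \<Longrightarrow> M \<subseteq> X \<Longrightarrow> X = M"
    by simp_all
  have "\<exists>a\<in>M. dist a x < e" if x: "x \<in> S" "0 < e" for x
  proof (rule ccontr)
    assume *: "\<not> ?thesis"
    then have "separated e (insert x M)"
      using M(2) unfolding separated_def by (auto simp: not_less dist_commute)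
    then have "x \<in> M" using M(3)[of "insert x M"] M(1) x by auto
    then show False using * x by auto
  qed
  then show ?thesis using that M by blast
qed

text \<open>Balls of half the separation around the points are disjoint and lie in the enlarged
  ball, so a common lower bound on their measures limits the number of points.\<close>

lemma packing:
  fixes \<mu> :: "'a::metric_space measure" and m :: real
  assumes "metric_measure_space \<mu>" "0 < e" "finite P" "separated e P" "P \<subseteq> ball z r"
    and m: "\<And>a. a \<in> P \<Longrightarrow> m \<le> measure \<mu> (ball a (e/2))"
  shows "card P * m \<le> measure \<mu> (ball z (r + e))"
proof -
  note M = metric_measure_spaceD[OF assms(1)]
  have meas: "ball a s \<in> fmeasurable \<mu>" for a s
    using M(1) M(4)[of a s] by (intro fmeasurableI) auto
  have "disjoint_family_on (\<lambda>a. ball a (e/2)) P"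
    unfolding disjoint_family_on_def
  proof (intro ballI impI)
    fix a b assume "a \<in> P" "b \<in> P" "a \<noteq> b"
    then have "e \<le> dist a b" using assms(4) by (auto simp: separated_def)
    show "ball a (e/2) \<inter> ball b (e/2) = {}"
    proof (rule ccontr)
      assume "ball a (e/2) \<inter> ball b (e/2) \<noteq> {}"
      then obtain c where "dist a c < e/2" "dist b c < e/2" by auto
      then show False using dist_triangle[of a b c] \<open>e \<le> dist a b\<close> by (simp add: dist_commute)
    qed
  qed
  then have "measure \<mu> (\<Union>a\<in>P. ball a (e/2)) = (\<Sum>a\<in>P. measure \<mu> (ball a (e/2)))"
    using assms(3) meas by (intro measure_finite_Union) (auto dest: fmeasurableD2 fmeasurableD)
  also have "\<dots> \<ge> card P * m" using sum_mono[OF m, of P "\<lambda>a. a"] by simp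
  also have "measure \<mu> (\<Union>a\<in>P. ball a (e/2)) \<le> measure \<mu> (ball z (r + e))"
  proof (rule measure_mono_fmeasurable)
    show "(\<Union>a\<in>P. ball a (e/2)) \<subseteq> ball z (r + e)"
    proof
      fix x assume "x \<in> (\<Union>a\<in>P. ball a (e/2))"
      then obtain a where "a \<in> P" "dist a x < e/2" by auto
      moreover have "dist z a < r" using \<open>a \<in> P\<close> assms(5) by auto
      ultimately show "x \<in> ball z (r + e)" using dist_triangle[of z x a] \<open>0 < e\<close> by simp
    qed
  qed (use meas assms(3) in \<open>auto intro!: sets.finite_UN dest: fmeasurableD\<close>)
  finally show ?thesis .
qed

text \<open>Since balls have positive measure, every point falls into a class given by a ball of
  radius \<open>n\<close> that contains it and a lower bound \<open>1 / Suc k\<close> for the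
  measure of \<open>ball a (e/2)\<close>. By packing, each class is finite.\<close>

lemma countable_separated:
  fixes A :: "'a::metric_space set" and \<mu> :: "'a measure"
  assumes "metric_measure_space \<mu>" "0 < e" "separated e A"
  shows "countable A"
proof -
  note M = metric_measure_spaceD[OF assms(1)]
  fix z :: 'a
  have "finite {a \<in> A \<inter> ball z n. 1 / real (Suc k) \<le> measure \<mu> (ball a (e/2))}" (is "finite ?P") for n k :: nat
  proof -
    have "card G \<le> nat \<lfloor>Suc k * measure \<mu> (ball z (n + e))\<rfloor>" if "G \<subseteq> ?P" "finite G" for G
    proof -
      have "separated e G" using assms(3) that(1) unfolding separated_def by blast
      then have "card G * (1 / real (Suc k)) \<le> measure \<mu> (ball z (real n + e))"
        by (rule packing[OF assms(1,2) that(2)]) (use that in auto)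
      then have "real (card G) \<le> Suc k * measure \<mu> (ball z (n + e))" by (simp add: field_simps)
      then show ?thesis by linarith
    qed
    then show ?thesis using finite_if_finite_subsets_card_bdd by blast
  qed
  then have "countable (\<Union>n::nat. \<Union>k::nat. {a \<in> A \<inter> ball z n. 1 / real (Suc k) \<le> measure \<mu> (ball a (e/2))})"
    by - (rule countable_UN[OF countableI_type], rule countable_UN[OF countableI_type], rule countable_finite)
  moreover have "A \<subseteq> (\<Union>n::nat. \<Union>k::nat. {a \<in> A \<inter> ball z n. 1 / real (Suc k) \<le> measure \<mu> (ball a (e/2))})"
  proof
    fix a assume "a \<in> A"
    obtain n :: nat where "dist z a < n" using reals_Archimedean2 by blast
    have "0 < measure \<mu> (ball a (e/2))"
      using M(3)[of "e/2" a] M(4)[of a "e/2"] \<open>0 < e\<close> by (simp add: measure_def enn2real_positive_iff)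
    then obtain k where "inverse (real (Suc k)) < measure \<mu> (ball a (e/2))" using reals_Archimedean by blast
    then have "1 / real (Suc k) \<le> measure \<mu> (ball a (e/2))" by (simp add: inverse_eq_divide del: of_nat_Suc)
    with \<open>a \<in> A\<close> \<open>dist z a < n\<close> show "a \<in> (\<Union>n::nat. \<Union>k::nat. {a \<in> A \<inter> ball z n. 1 / real (Suc k) \<le> measure \<mu> (ball a (e/2))})"
      by auto
  qed
  ultimately show ?thesis by (rule countable_subset[rotated])
qed

text \<open>Balls with centres in \<open>D\<close> and radii \<open>1 / Suc n\<close> form a
  countable base, which reduces the global statement to a countable union of local exceptional
  sets.\<close>

lemma countable_dense:
  fixes \<mu> :: "'a::metric_space measure"
  assumes "metric_measure_space \<mu>"
  obtains D :: "'a set" where "countable D" "\<And>x e. 0 < e \<Longrightarrow> \<exists>d\<in>D. dist d x < e"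
proof -
  have "\<exists>A :: 'a set. separated (1 / real (Suc n)) A \<and> (\<forall>x. \<exists>a\<in>A. dist a x < 1 / real (Suc n))" for n :: nat
    by (rule maximal_separated_subset[of UNIV "1 / real (Suc n)"]) (auto simp del: of_nat_Suc)
  then obtain A :: "nat \<Rightarrow> 'a set" where A: "\<And>n. separated (1 / real (Suc n)) (A n)" "\<And>n x. \<exists>a\<in>A n. dist a x < 1 / real (Suc n)" by metis
  have "countable (\<Union>n. A n)" using countable_separated[OF assms _ A(1)] by (intro countable_UN) auto
  moreover have "\<exists>d\<in>(\<Union>n. A n). dist d x < e" if "0 < e" for x e
  proof -
    obtain n where "inverse (real (Suc n)) < e" using reals_Archimedean[OF \<open>0 < e\<close>] by blast
    moreover obtain a where "a \<in> A n" "dist a x < 1 / real (Suc n)" using A(2) by blast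
    ultimately show ?thesis by (auto simp: inverse_eq_divide intro!: bexI[of _ a])
  qed
  ultimately show ?thesis by (rule that)
qed

section \<open>Compact balls in the completion\<close>

lemma doubling_iterate:
  assumes C: "\<And>x r. 0 < r \<Longrightarrow> ball x r \<subseteq> ball x\<^sub>0 r\<^sub>0 \<Longrightarrow> emeasure \<mu> (ball x (2 * r)) \<le> ennreal C * emeasure \<mu> (ball x r)"
    and "0 \<le> C" "0 < s" and sub: "\<And>j. j < k \<Longrightarrow> ball x (2 ^ j * s) \<subseteq> ball x\<^sub>0 r\<^sub>0"
  shows "emeasure \<mu> (ball x (2 ^ k * s)) \<le> ennreal (C ^ k) * emeasure \<mu> (ball x s)"
  using sub
proof (induction k)
  case (Suc k)
  have "emeasure \<mu> (ball x (2 * (2 ^ k * s))) \<le> ennreal C * emeasure \<mu> (ball x (2 ^ k * s))"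
    using Suc.prems[of k] \<open>0 < s\<close> by (intro C) auto
  also have "\<dots> \<le> ennreal C * (ennreal (C ^ k) * emeasure \<mu> (ball x s))"
    using Suc by (intro mult_left_mono) auto
  also have "\<dots> = ennreal (C ^ Suc k) * emeasure \<mu> (ball x s)"
    using \<open>0 \<le> C\<close> by (simp add: ennreal_mult mult.assoc)
  finally show ?case by (simp add: mult.assoc)
qed simp

text \<open>Total boundedness by volume: the points of a separated set in X carry disjoint balls
  whose measures doubling bounds from below. X is only dense, so the separated set is taken in the
  larger ball of radius \<open>2 * R\<close>, which contains approximations to all points of the
  closed ball.\<close>

lemma compact_cball_completion:
  fixes \<iota> :: "'a::metric_space \<Rightarrow> 'b::complete_space"
  assumes mms: "metric_measure_space \<mu>" and compl: "is_completion \<iota>"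
    and doubling: "doubling_within \<mu> x\<^sub>0 r\<^sub>0" and R: "0 < R" "6 * R \<le> r\<^sub>0"
  shows "compact (cball (\<iota> x\<^sub>0) R)"
proof -
  note M = metric_measure_spaceD[OF mms]
  obtain C where C: "0 < C" "\<And>x r. 0 < r \<Longrightarrow> ball x r \<subseteq> ball x\<^sub>0 r\<^sub>0 \<Longrightarrow> emeasure \<mu> (ball x (2 * r)) \<le> ennreal C * emeasure \<mu> (ball x r)"
    using doubling unfolding doubling_within_def by blast
  have isom: "dist (\<iota> x) (\<iota> y) = dist x y" for x y using compl by (simp add: is_completion_def)
  have real: "emeasure \<mu> (ball a s) = ennreal (measure \<mu> (ball a s))" for a s
    using M(4)[of a s] by (intro emeasure_eq_ennreal_measure) auto
  have "\<exists>k. finite k \<and> cball (\<iota> x\<^sub>0) R \<subseteq> (\<Union>x\<in>k. ball x e)" if "0 < e" for e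
  proof -
    define s where "s = min (e / 2) R"
    have s: "0 < s" "s \<le> e/2" "s \<le> R" using \<open>0 < e\<close> R(1) by (auto simp: s_def)
    obtain A where A: "A \<subseteq> ball x\<^sub>0 (2*R)" "separated s A" "\<And>x. x \<in> ball x\<^sub>0 (2*R) \<Longrightarrow> \<exists>a\<in>A. dist a x < s"
      using maximal_separated_subset[of "ball x\<^sub>0 (2*R)" s] s(1) by metis
    \<comment> \<open>At radius \<open>4 * R\<close> a ball about a point of \<open>A\<close>
      contains \<open>ball x\<^sub>0 R\<close>. By minimality all radii that get doubled are below
      \<open>4 * R\<close>; with centres within \<open>2 * R\<close> these balls stay in the ball of
      radius \<open>6 * R\<close>, which explains the factor 6.\<close>
    define k where "k = (LEAST k. 4 * R \<le> 2 ^ k * (s/2))"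
    have "\<exists>k. 4 * R / (s/2) < 2 ^ k" by (rule real_arch_pow) simp
    then have "\<exists>k. 4 * R \<le> 2 ^ k * (s/2)" using s(1) by (auto simp: field_simps intro: less_imp_le)
    then have k: "4 * R \<le> 2 ^ k * (s/2)" unfolding k_def by (rule LeastI_ex)
    have k_less: "2 ^ j * (s/2) < 4 * R" if "j < k" for j
      using not_less_Least[of j "\<lambda>k. 4 * R \<le> 2 ^ k * (s/2)"] that by (auto simp: k_def)
    define m where "m = measure \<mu> (ball x\<^sub>0 R) / C ^ k"
    have "0 < m" using M(3)[OF R(1), of x\<^sub>0] C(1) real[of x\<^sub>0 R] by (simp add: m_def)
    have m: "m \<le> measure \<mu> (ball a (s/2))" if "a \<in> A" for a
    proof -
      have a: "dist x\<^sub>0 a < 2 * R" using that A(1) by auto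
      have "ennreal (measure \<mu> (ball x\<^sub>0 R)) \<le> emeasure \<mu> (ball a (2 ^ k * (s/2)))"
        unfolding real[symmetric]
      proof (rule emeasure_mono)
        show "ball x\<^sub>0 R \<subseteq> ball a (2 ^ k * (s/2))"
        proof
          fix x assume "x \<in> ball x\<^sub>0 R"
          then show "x \<in> ball a (2 ^ k * (s/2))"
            using a k dist_triangle[of a x x\<^sub>0] R(1) by (simp add: dist_commute)
        qed
      qed (use M(1) in auto)
      also have "\<dots> \<le> ennreal (C ^ k) * emeasure \<mu> (ball a (s/2))"
      proof (rule doubling_iterate[OF C(2)])
        fix j assume "j < k"
        show "ball a (2 ^ j * (s/2)) \<subseteq> ball x\<^sub>0 r\<^sub>0"
        proof
          fix x assume "x \<in> ball a (2 ^ j * (s/2))"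
          then show "x \<in> ball x\<^sub>0 r\<^sub>0"
            using a k_less[OF \<open>j < k\<close>] dist_triangle[of x\<^sub>0 x a] R by simp
        qed
      qed (use C(1) s(1) in auto)
      also have "\<dots> = ennreal (C ^ k * measure \<mu> (ball a (s/2)))"
        using C(1) by (simp add: real ennreal_mult)
      finally have "measure \<mu> (ball x\<^sub>0 R) \<le> C ^ k * measure \<mu> (ball a (s/2))" using C(1) by simp
      then show ?thesis using C(1) by (simp add: m_def field_simps)
    qed
    have "card G \<le> nat \<lfloor>measure \<mu> (ball x\<^sub>0 (2*R + s)) / m\<rfloor>" if "G \<subseteq> A" "finite G" for G
    proof -
      have "separated s G" using A(2) that(1) unfolding separated_def by blast
      then have "card G * m \<le> measure \<mu> (ball x\<^sub>0 (2*R + s))"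
        by (rule packing[OF mms s(1) that(2)]) (use that A(1) m in auto)
      then have "real (card G) \<le> measure \<mu> (ball x\<^sub>0 (2*R + s)) / m" using \<open>0 < m\<close> by (simp add: field_simps)
      then show ?thesis by linarith
    qed
    then have "finite A" using finite_if_finite_subsets_card_bdd by blast
    moreover have "cball (\<iota> x\<^sub>0) R \<subseteq> (\<Union>y\<in>\<iota> ` A. ball y e)"
    proof
      fix y assume y: "y \<in> cball (\<iota> x\<^sub>0) R"
      have "y \<in> closure (range \<iota>)" using compl by (simp add: is_completion_def)
      then obtain x where x: "dist (\<iota> x) y < s" using s(1) unfolding closure_approachable by blast
      have "dist (\<iota> x\<^sub>0) (\<iota> x) < 2 * R" using y x s(3) dist_triangle[of "\<iota> x\<^sub>0" "\<iota> x" y] by (simp add: dist_commute)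
      then obtain a where a: "a \<in> A" "dist a x < s" using A(3)[of x] isom by auto
      have "dist (\<iota> a) y < e" using dist_triangle[of "\<iota> a" y "\<iota> x"] a(2) x s(2) isom[of a x] by simp
      then show "y \<in> (\<Union>y\<in>\<iota> ` A. ball y e)" using a(1) by auto
    qed
    ultimately show ?thesis by (intro exI[of _ "\<iota> ` A"]) auto
  qed
  then show ?thesis
    unfolding compact_eq_totally_bounded by (auto simp: complete_eq_closed)
qed

subsection \<open>Borel representatives and semicontinuous majorants\<close>

lemma isometry_open_vimage:
  fixes \<iota> :: "'a::metric_space \<Rightarrow> 'b::metric_space"
  assumes isom: "\<And>x y. dist (\<iota> x) (\<iota> y) = dist x y" and "open V"
  shows "\<exists>W. open W \<and> V = \<iota> -` W"
proof (intro exI conjI)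
  let ?W = "\<Union>(x, r)\<in>{(x, r). ball x r \<subseteq> V}. ball (\<iota> x) r"
  show "open ?W" by auto
  show "V = \<iota> -` ?W"
  proof (intro equalityI subsetI)
    fix x assume "x \<in> V"
    then obtain r where "0 < r" "ball x r \<subseteq> V" using \<open>open V\<close> open_contains_ball by blast
    then show "x \<in> \<iota> -` ?W" by (auto intro!: exI[of _ x] exI[of _ r])
  next
    fix x assume "x \<in> \<iota> -` ?W"
    then obtain y r where "ball y r \<subseteq> V" "\<iota> x \<in> ball (\<iota> y) r" by auto
    then show "x \<in> V" using isom by auto
  qed
qed

lemma isometry_borel_vimage:
  fixes \<iota> :: "'a::metric_space \<Rightarrow> 'b::metric_space"
  assumes isom: "\<And>x y. dist (\<iota> x) (\<iota> y) = dist x y" and "A \<in> sets borel"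
  shows "\<exists>E. E \<in> sets borel \<and> A = \<iota> -` E"
proof -
  have "A \<in> sigma_sets UNIV {S. open S}" using assms(2) by (simp add: borel_def)
  then show ?thesis
  proof (induction rule: sigma_sets.induct)
    case (Basic a)
    then obtain W where "open W" "a = \<iota> -` W" using isometry_open_vimage[OF isom] by blast
    then show ?case by (intro exI[of _ W]) simp
  next
    case Empty
    then show ?case by (intro exI[of _ "{}"]) simp
  next
    case (Compl a)
    then obtain E where "E \<in> sets borel" "a = \<iota> -` E" by blast
    then show ?case by (intro exI[of _ "- E"]) auto
  next
    case (Union a)
    then have "\<forall>i. \<exists>E. E \<in> sets borel \<and> a i = \<iota> -` E" by blast
    from choice[OF this] obtain E where "\<And>i. E i \<in> sets borel \<and> a i = \<iota> -` E i" by blast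
    then show ?case by (intro exI[of _ "\<Union>i. E i"]) auto
  qed
qed

text \<open>Borel sets of X are traces of Borel sets of the completion. Such sets for the rational
  superlevels of \<open>f\<close> rebuild the function, as the supremum of the rationals whose set
  contains the point. Off the range of \<iota> this may be infinite, and
  \<open>real_of_ereal\<close> then supplies the harmless value 0.\<close>

lemma isometry_borel_measurable_factor:
  fixes \<iota> :: "'a::metric_space \<Rightarrow> 'b::metric_space" and f :: "'a \<Rightarrow> real"
  assumes isom: "\<And>x y. dist (\<iota> x) (\<iota> y) = dist x y" and [measurable]: "f \<in> borel_measurable borel"
  obtains h where "h \<in> borel_measurable borel" "\<And>x. h (\<iota> x) = f x"
proof -
  obtain q :: "nat \<Rightarrow> real" where q: "range q = \<rat>" by (rule enumerate_rationals)
  have "\<forall>n. \<exists>E. E \<in> sets borel \<and> {x. q n < f x} = \<iota> -` E"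
  proof
    fix n
    have "{x. q n < f x} \<in> sets borel" by measurable
    then show "\<exists>E. E \<in> sets borel \<and> {x. q n < f x} = \<iota> -` E" by (rule isometry_borel_vimage[OF isom])
  qed
  from choice[OF this] obtain E where E: "\<And>n. E n \<in> sets borel \<and> {x. q n < f x} = \<iota> -` E n" by blast
  then have [measurable]: "E n \<in> sets borel" for n by blast
  define H where "H y = (SUP n. if y \<in> E n then ereal (q n) else - \<infinity>)" for y
  have "H \<in> borel_measurable borel" unfolding H_def by measurable
  then have "(\<lambda>y. real_of_ereal (H y)) \<in> borel_measurable borel" by simp
  moreover have "H (\<iota> x) = ereal (f x)" for x
  proof (rule antisym)
    have iff: "\<iota> x \<in> E n \<longleftrightarrow> q n < f x" for n using E[of n] by blast
    show "H (\<iota> x) \<le> ereal (f x)" unfolding H_def by (rule SUP_least) (simp add: iff)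
    show "ereal (f x) \<le> H (\<iota> x)"
    proof (rule ereal_le_real)
      fix z assume z: "H (\<iota> x) \<le> ereal z"
      show "ereal (f x) \<le> ereal z"
      proof (rule ccontr)
        assume "\<not> ?thesis"
        then have "z < f x" by simp
        then obtain r where "r \<in> \<rat>" "z < r" "r < f x" using Rats_dense_in_real by blast
        then obtain n where n: "q n = r" using q by (metis imageE)
        have "ereal (q n) \<le> H (\<iota> x)"
          unfolding H_def by (rule SUP_upper2[of n]) (use n \<open>r < f x\<close> iff in auto)
        then show False using z n \<open>z < r\<close> by (simp add: order_trans) (metis ereal_less_eq(3) not_le order_trans)
      qed
    qed
  qed
  ultimately show ?thesis using that[of "\<lambda>y. real_of_ereal (H y)"] by simp
qed

text \<open>A function measurable for the completed measure equals a Borel function almost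
  everywhere, and \<open>u\<close> is finite almost everywhere by \<open>fin\<close>. The
  exceptional set is enlarged to a Borel null set and, like the function, carried over to the
  completed space.\<close>

lemma borel_representative:
  fixes \<iota> :: "'a::metric_space \<Rightarrow> 'b::metric_space" and u :: "'a \<Rightarrow> ereal"
  assumes isom: "\<And>x y. dist (\<iota> x) (\<iota> y) = dist x y" and mms: "metric_measure_space \<mu>"
    and u: "u \<in> borel_measurable (restrict_space \<mu> B)" and B: "open B"
    and fin: "(\<integral>\<^sup>+x\<in>B. ennpowr (e2ennreal \<bar>u x\<bar>) p \<partial>\<mu>) < \<infinity>"
  obtains h Z where "h \<in> borel_measurable borel" "Z \<in> sets borel" "emeasure \<mu> (\<iota> -` Z) = 0"
    "\<And>x. x \<in> B \<Longrightarrow> \<iota> x \<notin> Z \<Longrightarrow> u x = ereal (h (\<iota> x))"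
proof -
  obtain \<nu> where \<nu>: "sets \<nu> = sets borel" "\<mu> = completion \<nu>"
    using mms unfolding metric_measure_space_def complete_borel_measure_def by blast
  note M = metric_measure_spaceD[OF mms]
  have B\<mu>: "B \<in> sets \<mu>" using B M(1) by auto
  define v where "v x = (if x \<in> B then u x else 0)" for x
  have v[measurable]: "v \<in> borel_measurable \<mu>"
    unfolding v_def by (subst measurable_If_restrict_space_iff) (use B\<mu> u M(2) in auto)
  have "(\<integral>\<^sup>+x. ennpowr (e2ennreal \<bar>v x\<bar>) p \<partial>\<mu>) < \<infinity>"
  proof -
    have "(\<integral>\<^sup>+x. ennpowr (e2ennreal \<bar>v x\<bar>) p \<partial>\<mu>) = (\<integral>\<^sup>+x\<in>B. ennpowr (e2ennreal \<bar>u x\<bar>) p \<partial>\<mu>)"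
      by (intro nn_integral_cong) (auto simp: v_def ennpowr_0 zero_ennreal.abs_eq[symmetric] split: split_indicator)
    then show ?thesis using fin by simp
  qed
  then have "AE x in \<mu>. ennpowr (e2ennreal \<bar>v x\<bar>) p \<noteq> \<infinity>"
    by (intro nn_integral_PInf_AE) auto
  then have fin_AE: "AE x in \<mu>. \<bar>v x\<bar> \<noteq> \<infinity>"
    by eventually_elim (auto simp: ennpowr_def)
  have "(\<lambda>x. real_of_ereal (v x)) \<in> borel_measurable (completion \<nu>)" using v \<nu>(2) by simp
  from completion_ex_borel_measurable_real[OF this]
  obtain f where f: "f \<in> borel_measurable \<nu>" "AE x in \<nu>. real_of_ereal (v x) = f x" by blast
  have "AE x in \<nu>. v x = ereal (f x)"
    using fin_AE f(2) unfolding \<nu>(2) AE_completion_iff by eventually_elim (auto simp: ereal_real)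
  then obtain N0 where N0: "{x \<in> space \<nu>. v x \<noteq> ereal (f x)} \<subseteq> N0" "emeasure \<nu> N0 = 0" "N0 \<in> sets \<nu>"
    by (rule AE_E)
  obtain Z where Z: "Z \<in> sets borel" "N0 = \<iota> -` Z" using isometry_borel_vimage[OF isom, of N0] N0(3) \<nu>(1) by auto
  have "f \<in> borel_measurable borel" using f(1) measurable_cong_sets[OF \<nu>(1) refl] by blast
  then obtain h where h: "h \<in> borel_measurable borel" "\<And>x. h (\<iota> x) = f x"
    using isometry_borel_measurable_factor[OF isom] by blast
  have sp: "space \<nu> = UNIV" using sets_eq_imp_space_eq[OF \<nu>(1)] by simp
  have "emeasure \<mu> (\<iota> -` Z) = 0" using N0 Z \<nu>(2) by simp
  moreover have "u x = ereal (h (\<iota> x))" if "x \<in> B" "\<iota> x \<notin> Z" for x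
  proof -
    have "x \<notin> N0" using that(2) Z(2) by simp
    then have "v x = ereal (f x)" using N0(1) sp by blast
    then show ?thesis using that(1) h(2) by (simp add: v_def)
  qed
  ultimately show ?thesis using that h(1) Z(1) by blast
qed

lemma nn_integral_distr_restrict:
  assumes "B \<in> sets \<mu>" "\<kappa> \<in> measurable \<mu> borel" and f: "f \<in> borel_measurable borel"
  shows "(\<integral>\<^sup>+y. f y \<partial>distr (density \<mu> (indicator B)) borel \<kappa>) = (\<integral>\<^sup>+x\<in>B. f (\<kappa> x) \<partial>\<mu>)"
proof -
  have \<kappa>: "\<kappa> \<in> measurable (density \<mu> (indicator B)) borel" using assms(2) by simp
  have f\<kappa>: "(\<lambda>x. f (\<kappa> x)) \<in> borel_measurable \<mu>" using assms(2,3) by (rule measurable_compose)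
  have "(\<integral>\<^sup>+y. f y \<partial>distr (density \<mu> (indicator B)) borel \<kappa>) = (\<integral>\<^sup>+x. f (\<kappa> x) \<partial>density \<mu> (indicator B))"
    by (rule nn_integral_distr) (use \<kappa> f in auto)
  also have "\<dots> = (\<integral>\<^sup>+x. indicator B x * f (\<kappa> x) \<partial>\<mu>)"
    by (rule nn_integral_density) (use assms(1) f\<kappa> in auto)
  finally show ?thesis by (simp add: mult.commute)
qed

lemma emeasure_distr_restrict:
  assumes "B \<in> sets \<mu>" "\<kappa> \<in> measurable \<mu> borel" and "A \<in> sets borel"
  shows "emeasure (distr (density \<mu> (indicator B)) borel \<kappa>) A = (\<integral>\<^sup>+x. indicator A (\<kappa> x) * indicator B x \<partial>\<mu>)"
  using nn_integral_distr_restrict[OF assms(1,2), of "indicator A"] assms(3) by simp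

text \<open>Vitali-Caratheodory is applied to \<open>p\<close>-th powers: of \<open>g\<close> on X
  itself, and of \<open>\<rho>0\<close> on the completion with the image measure. Open sets of X are
  traces of open sets of the completion, so both majorants can be taken on the completion; their
  maximum with 1 is then raised to the power \<open>1 / p\<close>.\<close>

lemma lsc_majorant:
  fixes \<iota> :: "'a::metric_space \<Rightarrow> 'b::metric_space"
  assumes isom: "\<And>x y. dist (\<iota> x) (\<iota> y) = dist x y" and mms: "metric_measure_space \<mu>" and p: "0 < p"
    and g: "g \<in> borel_measurable borel" "(\<integral>\<^sup>+x. ennpowr (g x) p \<partial>\<mu>) < \<infinity>"
    and \<rho>0: "\<rho>0 \<in> borel_measurable borel" "(\<integral>\<^sup>+x. ennpowr (\<rho>0 (\<iota> x)) p \<partial>\<mu>) < \<infinity>"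
  obtains \<rho> where "\<And>c. open {y. c < \<rho> y}" "\<And>y. 1 \<le> \<rho> y" "\<And>x. g x \<le> \<rho> (\<iota> x)" "\<And>y. \<rho>0 y \<le> \<rho> y"
    "(\<integral>\<^sup>+x\<in>ball x\<^sub>0 R. ennpowr (\<rho> (\<iota> x)) p \<partial>\<mu>) < \<infinity>"
proof -
  note M = metric_measure_spaceD[OF mms]
  define B where "B = ball x\<^sub>0 R"
  have B: "B \<in> sets \<mu>" using M(1) by (auto simp: B_def)
  have meas: "f \<in> measurable \<mu> K" if "f \<in> measurable borel K" for f :: "'a \<Rightarrow> 'c" and K
    using that M(1,2) by (auto simp: measurable_def)
  have \<iota>b: "\<iota> \<in> borel_measurable borel"
    using isometry_continuous_on[OF isom] by (rule borel_measurable_continuous_onI)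
  have \<iota>m[measurable]: "\<iota> \<in> measurable \<mu> borel" using meas[OF \<iota>b] .
  have idm[measurable]: "(\<lambda>x. x) \<in> measurable \<mu> borel" by (rule meas, rule measurable_ident_sets) simp
  let ?N1 = "distr (density \<mu> (indicator B)) borel (\<lambda>x. x)"
  let ?N2 = "distr (density \<mu> (indicator B)) borel \<iota>"
  have finB: "emeasure \<mu> B < \<infinity>" using M(4) by (simp add: B_def)
  have fin: "finite_measure (density \<mu> (indicator B))"
  proof (rule finite_measureI)
    have "emeasure (density \<mu> (indicator B)) UNIV = emeasure \<mu> B"
      using emeasure_density[of "indicator B" \<mu> UNIV] sets.top[of \<mu>] B M(2) by simp
    then show "emeasure (density \<mu> (indicator B)) (space (density \<mu> (indicator B))) \<noteq> \<infinity>"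
      using finB M(2) by simp
  qed
  have F1: "finite_measure ?N1" by (rule finite_measure.finite_measure_distr[OF fin]) simp
  have F2: "finite_measure ?N2" by (rule finite_measure.finite_measure_distr[OF fin]) simp
  have gm[measurable]: "(\<lambda>x. ennpowr (g x) p) \<in> borel_measurable borel"
    and \<rho>m[measurable]: "(\<lambda>x. ennpowr (\<rho>0 x) p) \<in> borel_measurable borel"
    using g(1) \<rho>0(1) by simp_all
  have I1: "(\<integral>\<^sup>+x. ennpowr (g x) p \<partial>?N1) < \<infinity>"
  proof -
    have "(\<integral>\<^sup>+x. ennpowr (g x) p \<partial>?N1) = (\<integral>\<^sup>+x\<in>B. ennpowr (g x) p \<partial>\<mu>)"
      using B by (rule nn_integral_distr_restrict) simp_all
    also have "\<dots> \<le> (\<integral>\<^sup>+x. ennpowr (g x) p \<partial>\<mu>)" by (intro nn_integral_mono) (auto split: split_indicator)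
    finally show ?thesis using g(2) by simp
  qed
  have I2: "(\<integral>\<^sup>+x. ennpowr (\<rho>0 x) p \<partial>?N2) < \<infinity>"
  proof -
    have "(\<integral>\<^sup>+x. ennpowr (\<rho>0 x) p \<partial>?N2) = (\<integral>\<^sup>+x\<in>B. ennpowr (\<rho>0 (\<iota> x)) p \<partial>\<mu>)"
      using B by (rule nn_integral_distr_restrict) simp_all
    also have "\<dots> \<le> (\<integral>\<^sup>+x. ennpowr (\<rho>0 (\<iota> x)) p \<partial>\<mu>)" by (intro nn_integral_mono) (auto split: split_indicator)
    finally show ?thesis using \<rho>0(2) by simp
  qed
  obtain V1 where V1: "\<And>k. open (V1 k)" "\<And>x. ennpowr (g x) p \<le> (SUP k. ennreal (Suc k) * indicator (V1 k) x)"
    "(\<Sum>k. ennreal (Suc k) * emeasure ?N1 (V1 k)) < \<infinity>"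
    by (rule vitali_caratheodory[OF F1 sets_distr gm I1]) (rule that)
  obtain V2 where V2: "\<And>k. open (V2 k)" "\<And>x. ennpowr (\<rho>0 x) p \<le> (SUP k. ennreal (Suc k) * indicator (V2 k) x)"
    "(\<Sum>k. ennreal (Suc k) * emeasure ?N2 (V2 k)) < \<infinity>"
    by (rule vitali_caratheodory[OF F2 sets_distr \<rho>m I2]) (rule that)
  from choice[OF allI[OF isometry_open_vimage[OF isom V1(1)]]]
  obtain W where W': "\<forall>k. open (W k) \<and> V1 k = \<iota> -` W k" by (rule exE)
  have W1: "open (W k)" for k using spec[OF W'] by (rule conjunct1)
  have W2: "V1 k = \<iota> -` W k" for k using spec[OF W'] by (rule conjunct2)
  define r1 where "r1 y = (SUP k. ennreal (Suc k) * indicator (W k) y)" for y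
  define r2 where "r2 y = (SUP k. ennreal (Suc k) * indicator (V2 k) y)" for y
  define r where "r y = max 1 (max (r1 y) (r2 y))" for y
  define \<rho> where "\<rho> y = ennpowr (r y) (1 / p)" for y
  have \<rho>p: "ennpowr (\<rho> y) p = r y" for y unfolding \<rho>_def using p by (intro ennpowr_ennpowr) auto
  have inv: "ennpowr (ennpowr c p) (1 / p) = c" for c using p by (intro ennpowr_ennpowr) auto
  \<comment> \<open>Raising to the power \<open>p\<close> is an order isomorphism of
    [0, \<infinity>], so comparisons with \<rho> and with \<open>r\<close> can be exchanged.\<close>
  have le_rho: "c \<le> \<rho> y \<longleftrightarrow> ennpowr c p \<le> r y" for c y
  proof
    assume "c \<le> \<rho> y"
    from ennpowr_mono[OF p this] show "ennpowr c p \<le> r y" by (simp only: \<rho>p)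
  next
    assume "ennpowr c p \<le> r y"
    from ennpowr_mono[OF _ this, of "1 / p"] p show "c \<le> \<rho> y" by (simp add: inv \<rho>_def)
  qed
  have rho_le: "\<rho> y \<le> c \<longleftrightarrow> r y \<le> ennpowr c p" for c y
  proof
    assume "\<rho> y \<le> c"
    from ennpowr_mono[OF p this] show "r y \<le> ennpowr c p" by (simp only: \<rho>p)
  next
    assume "r y \<le> ennpowr c p"
    from ennpowr_mono[OF _ this, of "1 / p"] p show "\<rho> y \<le> c" by (simp add: inv \<rho>_def)
  qed
  have lsc_sup: "open {y. c < (SUP k. ennreal (Suc k) * indicator (U k) y)}" if "\<And>k. open (U k)" for c and U :: "nat \<Rightarrow> 'b set"
  proof -
    have "open {y. c < ennreal (Suc k) * indicator (U k) y}" for k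
    proof -
      have "{y. c < ennreal (Suc k) * indicator (U k) y} = (if c < ennreal (Suc k) then U k else {})"
        by (auto simp: indicator_def split: if_splits)
      then show ?thesis using that by simp
    qed
    moreover have "{y. c < (SUP k. ennreal (Suc k) * indicator (U k) y)} = (\<Union>k. {y. c < ennreal (Suc k) * indicator (U k) y})"
      by (auto simp: less_SUP_iff)
    ultimately show ?thesis by auto
  qed
  have "open {y. c < \<rho> y}" for c
  proof -
    have "{y. c < \<rho> y} = {y. ennpowr c p < 1} \<union> {y. ennpowr c p < r1 y} \<union> {y. ennpowr c p < r2 y}"
      using rho_le[of _ c] by (auto simp: not_le[symmetric] r_def)
    moreover have "open {y::'b. ennpowr c p < 1}" by (cases "ennpowr c p < 1") auto
    ultimately show ?thesis using lsc_sup[OF W1] lsc_sup[OF V2(1)] unfolding r1_def r2_def by auto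
  qed
  moreover have "1 \<le> \<rho> y" for y
    unfolding le_rho by (simp add: r_def ennpowr_def)
  moreover have "g x \<le> \<rho> (\<iota> x)" for x
  proof -
    have "indicator (V1 k) x = (indicator (W k) (\<iota> x) :: ennreal)" for k by (simp add: W2 indicator_def)
    then have "ennpowr (g x) p \<le> r1 (\<iota> x)" using V1(2)[of x] by (simp add: r1_def)
    then show ?thesis unfolding le_rho r_def by (simp add: le_max_iff_disj)
  qed
  moreover have "\<rho>0 y \<le> \<rho> y" for y
    unfolding le_rho r_def using V2(2)[of y] by (simp add: r2_def le_max_iff_disj)
  moreover have "(\<integral>\<^sup>+x\<in>B. ennpowr (\<rho> (\<iota> x)) p \<partial>\<mu>) < \<infinity>"
  proof -
    have Wm[measurable]: "W k \<in> sets borel" "V2 k \<in> sets borel" for k using W1 V2(1) by auto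
    have [measurable]: "(\<lambda>x. indicator B x :: ennreal) \<in> borel_measurable \<mu>" using B by simp
    have sup_le: "(SUP k. ennreal (Suc k) * indicator (U k) y) \<le> (\<Sum>k. ennreal (Suc k) * indicator (U k) y)" for U :: "nat \<Rightarrow> 'b set" and y
      by (rule SUP_least) (rule ennreal_le_suminf)
    have "(\<integral>\<^sup>+x\<in>B. ennpowr (\<rho> (\<iota> x)) p \<partial>\<mu>) \<le> (\<integral>\<^sup>+x. indicator B x
        + (\<Sum>k. ennreal (Suc k) * (indicator (W k) (\<iota> x) * indicator B x))
        + (\<Sum>k. ennreal (Suc k) * (indicator (V2 k) (\<iota> x) * indicator B x)) \<partial>\<mu>)"
    proof (rule nn_integral_mono)
      fix x
      show "ennpowr (\<rho> (\<iota> x)) p * indicator B x \<le> indicator B x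
        + (\<Sum>k. ennreal (Suc k) * (indicator (W k) (\<iota> x) * indicator B x))
        + (\<Sum>k. ennreal (Suc k) * (indicator (V2 k) (\<iota> x) * indicator B x))"
      proof (cases "x \<in> B")
        case True
        have "r (\<iota> x) \<le> 1 + r1 (\<iota> x) + r2 (\<iota> x)" unfolding r_def
          by (auto simp: add.assoc intro: add_increasing add_increasing2)
        also have "\<dots> \<le> 1 + (\<Sum>k. ennreal (Suc k) * indicator (W k) (\<iota> x)) + (\<Sum>k. ennreal (Suc k) * indicator (V2 k) (\<iota> x))"
          unfolding r1_def r2_def by (intro add_mono sup_le order_refl)
        finally show ?thesis using True by (simp add: \<rho>p)
      qed simp
    qed
    also have "\<dots> = (\<integral>\<^sup>+x. indicator B x \<partial>\<mu>)
        + (\<Sum>k. ennreal (Suc k) * (\<integral>\<^sup>+x. indicator (W k) (\<iota> x) * indicator B x \<partial>\<mu>))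
        + (\<Sum>k. ennreal (Suc k) * (\<integral>\<^sup>+x. indicator (V2 k) (\<iota> x) * indicator B x \<partial>\<mu>))"
      by (subst nn_integral_add; simp?) (subst nn_integral_add; simp?; (subst nn_integral_suminf; simp?)+; simp add: nn_integral_cmult)
    also have "\<dots> < \<infinity>"
    proof -
      have "(\<integral>\<^sup>+x. indicator (W k) (\<iota> x) * indicator B x \<partial>\<mu>) = emeasure ?N1 (V1 k)" for k
        by (subst emeasure_distr_restrict[OF B idm]) (use V1(1) in \<open>auto simp: W2 indicator_def intro!: nn_integral_cong\<close>)
      moreover have "(\<integral>\<^sup>+x. indicator (V2 k) (\<iota> x) * indicator B x \<partial>\<mu>) = emeasure ?N2 (V2 k)" for k
        by (subst emeasure_distr_restrict[OF B \<iota>m]) auto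
      ultimately show ?thesis using finB B V1(3) V2(3) by simp
    qed
    finally show ?thesis .
  qed
  ultimately show ?thesis unfolding B_def by (rule that)
qed

subsection \<open>Quasicontinuity\<close>

lemma nn_integral_completion_measure:
  fixes \<iota> :: "'a::metric_space \<Rightarrow> 'b::metric_space"
  assumes isom: "\<And>x y. dist (\<iota> x) (\<iota> y) = dist x y" and mms: "metric_measure_space \<mu>"
    and f: "f \<in> borel_measurable borel"
  shows "(\<integral>\<^sup>+y. f y \<partial>completion_measure \<iota> \<mu>) = (\<integral>\<^sup>+x. f (\<iota> x) \<partial>\<mu>)"
proof -
  note M = metric_measure_spaceD[OF mms]
  let ?S = "sigma UNIV {E. \<iota> -` E \<in> sets \<mu>}"
  have S: "sets ?S = {E. \<iota> -` E \<in> sets \<mu>}"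
    using sets_completion_measure[OF M(2), of \<iota>] by (simp add: completion_measure_def)
  have \<iota>: "\<iota> \<in> measurable \<mu> ?S" by (rule measurableI) (use S M(2) in auto)
  have "\<iota> \<in> borel_measurable borel"
    using isometry_continuous_on[OF isom] by (rule borel_measurable_continuous_onI)
  then have "sets borel \<subseteq> sets ?S" using M(1) measurable_sets[of \<iota> borel borel] by (fastforce simp: S)
  then have fS: "f \<in> borel_measurable ?S" using f by (auto simp: measurable_def)
  show ?thesis unfolding completion_measure_def by (rule nn_integral_distr) (use \<iota> fS in auto)
qed

lemma local_small_oscillation:
  fixes \<mu> :: "'a::metric_space measure" and \<iota> :: "'a \<Rightarrow> 'b::complete_space"
  assumes mms: "metric_measure_space \<mu>" and compl: "is_completion \<iota>" and p: "1 < p"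
    and doubling: "locally_doubling \<mu>" and path_open: "p_path_open p \<iota> \<mu>" and u: "u \<in> N1p_loc p \<mu>"
  obtains r where "0 < r"
    "\<And>e \<delta>. 0 < e \<Longrightarrow> 0 < \<delta> \<Longrightarrow> \<exists>G. open G \<and> cap_test p \<mu> G e \<and> nearly_continuous (4 * \<delta>) u (ball x\<^sub>0 r - G)"
proof -
  note M = metric_measure_spaceD[OF mms]
  have isom: "dist (\<iota> x) (\<iota> y) = dist x y" for x y using compl by (simp add: is_completion_def)
  have p0: "0 < p" using p by simp
  have \<iota>b: "\<iota> \<in> borel_measurable borel"
    using isometry_continuous_on[OF isom] by (rule borel_measurable_continuous_onI)
  have meas: "f \<in> measurable \<mu> K" if "f \<in> measurable borel K" for f :: "'a \<Rightarrow> 'c" and K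
    using that M(1,2) by (auto simp: measurable_def)
  have \<iota>m[measurable]: "\<iota> \<in> measurable \<mu> borel" using meas[OF \<iota>b] .
  obtain y r where yr: "x\<^sub>0 \<in> ball y r" "u \<in> N1p p \<mu> (ball y r)" using u unfolding N1p_loc_def by blast
  define B where "B = ball y r"
  have B: "open B" by (simp add: B_def)
  have Bm: "B \<in> sets borel" "B \<in> sets \<mu>" using B M(1) by auto
  have u_meas: "u \<in> borel_measurable (restrict_space \<mu> B)" and norm: "N1p_norm_pow p \<mu> B u < \<infinity>"
    using yr(2) by (auto simp: N1p_def B_def)
  have u_fin: "(\<integral>\<^sup>+x\<in>B. ennpowr (e2ennreal \<bar>u x\<bar>) p \<partial>\<mu>) < \<infinity>"
    and "(INF g \<in> {g. upper_gradient B u g}. \<integral>\<^sup>+x\<in>B. ennpowr (g x) p \<partial>\<mu>) < \<infinity>"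
    using norm unfolding N1p_norm_pow_def by auto
  then obtain g where g: "upper_gradient B u g" "(\<integral>\<^sup>+x\<in>B. ennpowr (g x) p \<partial>\<mu>) < \<infinity>"
    unfolding INF_less_iff by blast
  \<comment> \<open>\<open>g\<close> is known to be measurable only on \<open>B\<close>; extended by
    0 it becomes Borel on X.\<close>
  define g' where "g' x = g x * indicator B x" for x
  have g'_meas: "g' \<in> borel_measurable borel"
    using g(1) Bm(1) unfolding upper_gradient_def g'_def
    by (subst (asm) borel_measurable_restrict_space_iff_ennreal) auto
  have g'_fin: "(\<integral>\<^sup>+x. ennpowr (g' x) p \<partial>\<mu>) < \<infinity>"
  proof -
    have "(\<integral>\<^sup>+x. ennpowr (g' x) p \<partial>\<mu>) = (\<integral>\<^sup>+x\<in>B. ennpowr (g x) p \<partial>\<mu>)"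
      by (intro nn_integral_cong) (auto simp: g'_def ennpowr_0 split: split_indicator)
    then show ?thesis using g(2) by simp
  qed
  obtain \<rho>0 :: "'b \<Rightarrow> ennreal" where \<rho>0_meas: "\<rho>0 \<in> borel_measurable borel"
    and \<rho>0_int: "(\<integral>\<^sup>+y\<in>UNIV. ennpowr (\<rho>0 y) p \<partial>completion_measure \<iota> \<mu>) < \<infinity>"
    and ex': "\<forall>l \<gamma>. arc_length_curve UNIV l \<gamma> \<longrightarrow>
      \<not> openin (top_of_set {0..l}) {t \<in> {0..l}. \<gamma> t \<in> range \<iota>} \<longrightarrow> line_integral l \<gamma> \<rho>0 = \<infinity>"
    using path_open unfolding p_path_open_def p_ae_curve_def measurable_restrict_UNIV by (elim exE conjE)
  have \<rho>0: "\<rho>0 \<in> borel_measurable borel" "(\<integral>\<^sup>+y. ennpowr (\<rho>0 y) p \<partial>completion_measure \<iota> \<mu>) < \<infinity>"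
    using \<rho>0_meas \<rho>0_int by simp_all
  note ex = ex'[rule_format]
  have "(\<lambda>y. ennpowr (\<rho>0 y) p) \<in> borel_measurable borel" using \<rho>0(1) by simp
  from nn_integral_completion_measure[OF isom mms this]
  have \<rho>0_fin: "(\<integral>\<^sup>+x. ennpowr (\<rho>0 (\<iota> x)) p \<partial>\<mu>) < \<infinity>"
    using \<rho>0(2) by (simp only:)
  obtain r\<^sub>0 where r0: "0 < r\<^sub>0" "doubling_within \<mu> x\<^sub>0 r\<^sub>0" using doubling unfolding locally_doubling_def by blast
  \<comment> \<open>The bound \<open>r\<^sub>0 / 6\<close> is that of
    \<open>compact_cball_completion\<close>; the other one keeps the closed ball of radius
    \<open>R\<close> inside \<open>B\<close>, where \<open>g\<close> controls
    \<open>u\<close>.\<close>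
  define R where "R = min (r\<^sub>0 / 6) ((r - dist y x\<^sub>0) / 2)"
  have R: "0 < R" "6 * R \<le> r\<^sub>0" "dist y x\<^sub>0 + R < r" using r0(1) yr(1) by (auto simp: R_def min_def field_simps)
  have cball_B: "x \<in> B" if "dist x\<^sub>0 x \<le> R" for x
    using that R(3) dist_triangle[of y x x\<^sub>0] by (simp add: B_def)
  obtain \<rho> where \<rho>: "\<And>c. open {y. c < \<rho> y}" "\<And>y. 1 \<le> \<rho> y" "\<And>x. g' x \<le> \<rho> (\<iota> x)" "\<And>y. \<rho>0 y \<le> \<rho> y"
    "(\<integral>\<^sup>+x\<in>ball x\<^sub>0 R. ennpowr (\<rho> (\<iota> x)) p \<partial>\<mu>) < \<infinity>"
    by (rule lsc_majorant[OF isom mms p0 g'_meas g'_fin \<rho>0(1) \<rho>0_fin]) (rule that)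
  obtain h Z where h: "h \<in> borel_measurable borel" "Z \<in> sets borel" "emeasure \<mu> (\<iota> -` Z) = 0"
    "\<And>x. x \<in> B \<Longrightarrow> \<iota> x \<notin> Z \<Longrightarrow> u x = ereal (h (\<iota> x))"
    by (rule borel_representative[OF isom mms u_meas B u_fin]) (rule that)
  interpret cost_space "cball (\<iota> x\<^sub>0) R" \<rho>
    by unfold_locales (rule compact_cball_completion[OF mms compl r0(2) R(1,2)] \<rho>(1,2))+
  define D where "D = density \<mu> (\<lambda>x. ennpowr (\<rho> (\<iota> x)) p * indicator (ball x\<^sub>0 R) x)"
  define N where "N = distr D borel \<iota>"
  have ball_m[measurable]: "ball x\<^sub>0 R \<in> sets \<mu>" using M(1) by auto
  have D_meas: "(\<lambda>x. ennpowr (\<rho> (\<iota> x)) p * indicator (ball x\<^sub>0 R) x) \<in> borel_measurable \<mu>" by measurable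
  have N: "emeasure N A = (\<integral>\<^sup>+x. ennpowr (\<rho> (\<iota> x)) p * indicator (ball x\<^sub>0 R \<inter> \<iota> -` A) x \<partial>\<mu>)" if A: "A \<in> sets borel" for A
  proof -
    have "\<iota> -` A \<in> sets \<mu>" using measurable_sets[OF \<iota>m A] M(2) by simp
    moreover have "emeasure N A = emeasure D (\<iota> -` A)"
      unfolding N_def by (subst emeasure_distr) (use A M(2) in \<open>auto simp: D_def\<close>)
    ultimately have "emeasure N A = (\<integral>\<^sup>+x. (ennpowr (\<rho> (\<iota> x)) p * indicator (ball x\<^sub>0 R) x) * indicator (\<iota> -` A) x \<partial>\<mu>)"
      unfolding D_def using D_meas by (simp add: emeasure_density)
    also have "\<dots> = (\<integral>\<^sup>+x. ennpowr (\<rho> (\<iota> x)) p * indicator (ball x\<^sub>0 R \<inter> \<iota> -` A) x \<partial>\<mu>)"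
      by (intro nn_integral_cong) (auto split: split_indicator)
    finally show ?thesis .
  qed
  have N_null: "emeasure N Z = 0"
  proof -
    have "\<iota> -` Z \<in> null_sets \<mu>"
      using h(3) measurable_sets[OF \<iota>m h(2)] M(2) by (auto simp: null_sets_def)
    then have "AE x in \<mu>. ennpowr (\<rho> (\<iota> x)) p * indicator (ball x\<^sub>0 R \<inter> \<iota> -` Z) x = 0"
      by (rule eventually_mono[OF AE_not_in]) auto
    from nn_integral_cong_AE[OF this] show ?thesis by (simp add: N[OF h(2)])
  qed
  have N_finite: "finite_measure N"
  proof (rule finite_measureI)
    have "emeasure N UNIV = (\<integral>\<^sup>+x\<in>ball x\<^sub>0 R. ennpowr (\<rho> (\<iota> x)) p \<partial>\<mu>)" by (subst N) auto
    then show "emeasure N (space N) \<noteq> \<infinity>" using \<rho>(5) by (simp add: N_def)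
  qed
  \<comment> \<open>\<rho> dominates \<open>\<rho>0\<close>, so no curve of finite \<rho>-cost
    belongs to the exceptional family.\<close>
  have path: "openin (top_of_set {0..l}) {t \<in> {0..l}. \<sigma> t \<in> range \<iota>}"
    if "arc_length_curve UNIV l \<sigma>" "line_integral l \<sigma> \<rho> < \<infinity>" for l \<sigma>
  proof (rule ccontr)
    assume "\<not> ?thesis"
    with ex[OF that(1)] have "line_integral l \<sigma> \<rho>0 = \<infinity>" .
    moreover have "line_integral l \<sigma> \<rho>0 \<le> line_integral l \<sigma> \<rho>" using \<rho>(4) by (intro line_integral_mono) auto
    ultimately show False using that(2) by (simp add: top_unique)
  qed
  interpret N: finite_measure N by (rule N_finite)
  interpret oscillation_setting \<iota> x\<^sub>0 R \<rho> \<mu> p N u h Z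
  proof
    fix x assume x: "\<iota> x \<in> cball (\<iota> x\<^sub>0) R"
    have g_le: "g z \<le> \<rho> (\<iota> z)" if "z \<in> B" for z using \<rho>(3)[of z] that by (simp add: g'_def)
    have sub: "\<iota> -` cball (\<iota> x\<^sub>0) R \<subseteq> B" using cball_B isom by auto
    obtain w where w: "0 < w" "\<And>t y. t < w \<Longrightarrow> reach t (\<iota> x) y \<Longrightarrow> \<exists>x'. y = \<iota> x' \<and> (x' = x \<or> ereal_gap (u x) (u x') \<le> ennreal t)"
      by (rule reach_local[OF isom _ g(1) g_le sub x]) (rule path, assumption, assumption, assumption, rule that)
    then show "\<exists>w>0. \<forall>t<w. \<forall>y. reach t (\<iota> x) y \<longrightarrow> (\<exists>x'. y = \<iota> x' \<and> (x' = x \<or> ereal_gap (u x) (u x') \<le> ennreal t))"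
      by (intro exI[of _ w] conjI allI impI)
  next
    show "emeasure N A = (\<integral>\<^sup>+x. ennpowr (\<rho> (\<iota> x)) p * indicator (ball x\<^sub>0 R \<inter> \<iota> -` A) x \<partial>\<mu>)"
      if "A \<in> sets borel" for A using that by (rule N)
    show "u x = ereal (h (\<iota> x))" if "x \<in> ball x\<^sub>0 R" "\<iota> x \<notin> Z" for x
      using that by (intro h(4) cball_B) simp_all
    show "dist (\<iota> x) (\<iota> y) = dist x y" for x y by (rule isom)
    show "sets N = sets borel" by (simp add: N_def)
  qed (rule R(1) p0 M(1) M(2) N_null h(1) h(2))+
  show ?thesis
    by (rule that[of "R / 2"]) (use R(1) in simp, rule small_oscillation)
qed

theorem proposition4p9:
  fixes \<mu> :: "'a::metric_space measure"
    and \<iota> :: "'a \<Rightarrow> 'b::complete_space"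
    and p :: real
    and u :: "'a \<Rightarrow> ereal"
  assumes "metric_measure_space \<mu>"
    and "is_completion \<iota>"
    and "1 < p"
    and "locally_doubling \<mu>"
    and "local_poincare p \<mu>"
    and "p_path_open p \<iota> \<mu>"
    and "u \<in> N1p_loc p \<mu>"
  shows "quasicontinuous p \<mu> u"
  unfolding quasicontinuous_def
proof (intro allI impI)
  fix \<epsilon> :: real assume "0 < \<epsilon>"
  note M = metric_measure_spaceD[OF assms(1)]
  have p: "0 < p" using assms(3) by simp
  define small where "small U e \<delta> G \<longleftrightarrow> open G \<and> cap_test p \<mu> G e \<and> nearly_continuous (4 * \<delta>) u (U - G)"
    for U e \<delta> G
  define good where "good U \<longleftrightarrow> (\<forall>e>0. \<forall>\<delta>>0. \<exists>G. small U e \<delta> G)" for U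
  have good_mono: "good V" if U: "good U" and "V \<subseteq> U" for U V
    unfolding good_def
  proof (intro allI impI)
    fix e \<delta> :: real assume "0 < e" "0 < \<delta>"
    with U obtain G where "small U e \<delta> G" unfolding good_def by blast
    then have "small V e \<delta> G"
      unfolding small_def using \<open>V \<subseteq> U\<close> by (auto intro: nearly_continuous_subset)
    then show "\<exists>G. small V e \<delta> G" ..
  qed
  have local: "\<exists>r>0. good (ball x r)" for x
  proof -
    obtain r where "0 < r" and r: "\<And>e \<delta>. 0 < e \<Longrightarrow> 0 < \<delta> \<Longrightarrow>
        \<exists>G. open G \<and> cap_test p \<mu> G e \<and> nearly_continuous (4 * \<delta>) u (ball x r - G)"
      by (rule local_small_oscillation[OF assms(1-4,6,7), of x]) (rule that)
    have "good (ball x r)" unfolding good_def small_def by (intro allI impI r)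
    with \<open>0 < r\<close> show ?thesis by blast
  qed
  obtain D :: "'a set" where D: "countable D" "\<And>x e. 0 < e \<Longrightarrow> \<exists>d\<in>D. dist d x < e"
    by (rule countable_dense[OF assms(1)]) (rule that)
  \<comment> \<open>Goodness passes to subsets, so each good ball about a point contains a good ball
    that has centre in \<open>D\<close> and radius \<open>1 / Suc n\<close> and still contains the
    point. Countably many such balls cover X.\<close>
  define I where "I = {(d, n :: nat). d \<in> D \<and> good (ball d (1 / real (Suc n)))}"
  have "countable I" by (rule countable_subset[of _ "D \<times> UNIV"]) (use D(1) in \<open>auto simp: I_def\<close>)
  have cover: "\<exists>(d, n)\<in>I. x \<in> ball d (1 / real (Suc n))" for x
  proof -
    obtain r where r: "0 < r" "good (ball x r)" using local by blast
    obtain n where "inverse (real (Suc n)) < r / 2" using reals_Archimedean[of "r/2"] r(1) by auto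
    then have n: "1 / real (Suc n) < r / 2" by (simp add: inverse_eq_divide del: of_nat_Suc)
    obtain d where d: "d \<in> D" "dist d x < 1 / real (Suc n)" using D(2)[of "1 / real (Suc n)" x] by auto
    have "ball d (1 / real (Suc n)) \<subseteq> ball x r"
    proof
      fix z assume "z \<in> ball d (1 / real (Suc n))"
      then show "z \<in> ball x r" using d(2) n dist_triangle[of x z d] by (simp add: dist_commute del: of_nat_Suc)
    qed
    then have "(d, n) \<in> I" using d(1) good_mono[OF r(2)] by (simp add: I_def)
    then show ?thesis using d(2) by (intro bexI[of _ "(d, n)"]) auto
  qed
  then have "I \<noteq> {}" by blast
  define U where "U i = (case from_nat_into I i of (d, n) \<Rightarrow> ball d (1 / real (Suc n)))" for i :: nat
  have U_good: "good (U i)" and U_open: "open (U i)" for i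
    using from_nat_into[OF \<open>I \<noteq> {}\<close>, of i] by (auto simp: U_def I_def split: prod.splits)
  have U_cover: "\<exists>i. x \<in> U i" for x
  proof -
    obtain d n where dn: "(d, n) \<in> I" "x \<in> ball d (1 / real (Suc n))" using cover[of x] by auto
    obtain i where "from_nat_into I i = (d, n)" using from_nat_into_surj[OF \<open>countable I\<close> dn(1)] by blast
    then show ?thesis using dn(2) by (intro exI[of _ i]) (simp add: U_def)
  qed
  \<comment> \<open>The sum is \<open>\<epsilon> / 2\<close> because the capacity has to be strictly
    below \<epsilon>.\<close>
  define e where "e k = \<epsilon> / 2 * (1/2) ^ Suc k" for k :: nat
  have e_pos: "0 < e k" for k using \<open>0 < \<epsilon>\<close> by (simp add: e_def)
  have e_sums: "e sums (\<epsilon> / 2)"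
    using sums_mult[OF power_half_series, of "\<epsilon> / 2"] by (simp add: e_def[abs_def])
  \<comment> \<open>The index \<open>k\<close> codes a pair consisting of a ball \<open>U i\<close>
    and an accuracy \<open>1 / Suc m\<close>, so that the single union \<open>H\<close> serves all
    balls and all accuracies.\<close>
  have "\<exists>G. small (U (fst (prod_decode k))) (e k) (1 / real (Suc (snd (prod_decode k)))) G" for k
    using U_good[of "fst (prod_decode k)"] e_pos[of k] unfolding good_def by simp
  then have "\<forall>k. \<exists>G. small (U (fst (prod_decode k))) (e k) (1 / real (Suc (snd (prod_decode k)))) G" ..
  from choice[OF this] obtain G where G: "\<And>k. small (U (fst (prod_decode k))) (e k) (1 / real (Suc (snd (prod_decode k)))) (G k)"
    by blast
  define H where "H = (\<Union>k. G k)"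
  have "open H" unfolding H_def using G by (auto simp: small_def)
  have "cap_test p \<mu> H (suminf e)"
    unfolding H_def using G e_pos sums_summable[OF e_sums] M(1,2)
    by (intro cap_test_UN[OF p]) (auto simp: small_def less_imp_le)
  then have "capacity p \<mu> H < ennreal \<epsilon>"
    using sums_unique[OF e_sums] \<open>0 < \<epsilon>\<close> by (intro capacity_less_cap_test[of p \<mu> H "suminf e"]) auto
  have small: "nearly_continuous (4 * (1 / real (Suc m))) u (U i - H)" for i m
  proof -
    define k where "k = prod_encode (i, m)"
    have "small (U i) (e k) (1 / real (Suc m)) (G k)" using G[of k] by (simp add: k_def)
    then have "nearly_continuous (4 * (1 / real (Suc m))) u (U i - G k)" unfolding small_def by (elim conjE)
    moreover have "U i - H \<subseteq> U i - G k" by (auto simp: H_def)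
    ultimately show ?thesis by (rule nearly_continuous_subset)
  qed
  have fin: "\<bar>u x\<bar> \<noteq> \<infinity>" if "x \<notin> H" for x
  proof -
    obtain i where "x \<in> U i" using U_cover by blast
    then have "x \<in> U i - H" using that by simp
    then show ?thesis by (rule nearly_continuousE[OF small])
  qed
  have "continuous_on (- H) (\<lambda>x. real_of_ereal (u x))"
    unfolding continuous_on_iff
  proof (intro ballI allI impI)
    fix x and a :: real assume "x \<in> - H" "0 < a"
    obtain i where i: "x \<in> U i" using U_cover by blast
    obtain m where "inverse (real (Suc m)) < a / 4" using reals_Archimedean[of "a/4"] \<open>0 < a\<close> by auto
    then have m: "4 / real (Suc m) < a" by (simp add: inverse_eq_divide field_simps)
    have "x \<in> U i - H" using i \<open>x \<in> - H\<close> by simp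
    then obtain s where s: "0 < s" "\<And>x'. x' \<in> U i - H \<Longrightarrow> dist x' x < s \<Longrightarrow>
      \<bar>real_of_ereal (u x') - real_of_ereal (u x)\<bar> \<le> 4 * (1 / real (Suc m))"
      by (rule nearly_continuousE[OF small]) (rule that)
    obtain d where d: "0 < d" "ball x d \<subseteq> U i" using U_open i open_contains_ball by blast
    have "dist (real_of_ereal (u x')) (real_of_ereal (u x)) < a" if "x' \<in> - H" "dist x' x < min s d" for x'
    proof -
      have "x' \<in> U i - H" using d(2) that by (auto simp: dist_commute)
      then have "\<bar>real_of_ereal (u x') - real_of_ereal (u x)\<bar> \<le> 4 * (1 / real (Suc m))" using that(2) by (intro s(2)) simp_all
      then show ?thesis using m by (simp add: dist_real_def)
    qed
    then show "\<exists>d>0. \<forall>x'\<in>- H. dist x' x < d \<longrightarrow> dist (real_of_ereal (u x')) (real_of_ereal (u x)) < a"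
      using s(1) d(1) by (intro exI[of _ "min s d"]) auto
  qed
  then show "\<exists>G. open G \<and> capacity p \<mu> G < ennreal \<epsilon> \<and> (\<forall>x. x \<notin> G \<longrightarrow> \<bar>u x\<bar> \<noteq> \<infinity>) \<and>
      continuous_on (- G) (\<lambda>x. real_of_ereal (u x))"
    using \<open>open H\<close> \<open>capacity p \<mu> H < ennreal \<epsilon>\<close> fin by blast
qed

end
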